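(* Let $L$ be a finite-dimensional Lie algebra over a field $F$ of characteristic zero. Then $L$ is minimal non-elementary if and only if either (i) $L=L^2\rtimes Fx$ for some $x\in L$, where $L^2=[L,L]$ is abelian, $\phi(L)=\mathrm{Asoc}(L)\neq 0$, and $\mathrm{Asoc}(L)$ is the largest ideal of $L$ properly contained in $L^2$ (every ideal of $L$ properly contained in $L^2$ is contained in $\mathrm{Asoc}(L)$, and $\mathrm{Asoc}(L)\ne L^2$); or (ii) $L$ is the three-dimensional Heisenberg algebra.
   Context: The Frattini ideal $\phi(B)$ of a Lie algebra $B$ is the largest ideal of $B$ contained in every maximal subalgebra of $B$. $B$ is elementary if $\phi(C)=0$ for every subalgebra $C$ of $B$. $L$ is minimal non-elementary if $L$ is not elementary but every proper subalgebra of $L$ is elementary. $\mathrm{Asoc}(L)$ is the sum of all minimal abelian ideals of $L$. $\rtimes$ denotes a semidirect product (here $L^2$ is an ideal and $Fx$ a one-dimensional complementary subalgebra). The three-dimensional Heisenberg algebra has basis $x,y,z$ with $[x,y]=z$ and $[x,z]=[y,z]=0$. *)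

theory Defs
  imports Main "HOL.Vector_Spaces"
begin

text \<open>A Lie algebra is modelled on a type 'v carrying a vector space structure over a
field 'f (scalar multiplication sc) and a Lie bracket br.  All notions below are relative
to a carrier set A (a subalgebra), since elementarity refers to subalgebras.\<close>

definition lie_algebra :: "('f::field \<Rightarrow> 'v::ab_group_add \<Rightarrow> 'v) \<Rightarrow> ('v \<Rightarrow> 'v \<Rightarrow> 'v) \<Rightarrow> bool" where
  "lie_algebra sc br \<longleftrightarrow> vector_space sc
     \<and> (\<forall>x y z. br (x + y) z = br x z + br y z)
     \<and> (\<forall>x y z. br x (y + z) = br x y + br x z)
     \<and> (\<forall>c x y. br (sc c x) y = sc c (br x y))
     \<and> (\<forall>c x y. br x (sc c y) = sc c (br x y))
     \<and> (\<forall>x. br x x = 0)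
     \<and> (\<forall>x y z. br x (br y z) + br y (br z x) + br z (br x y) = 0)"

definition fin_dim :: "('f::field \<Rightarrow> 'v::ab_group_add \<Rightarrow> 'v) \<Rightarrow> bool" where
  "fin_dim sc \<longleftrightarrow> (\<exists>B. finite B \<and> module.span sc B = UNIV)"

definition subalg :: "('f::field \<Rightarrow> 'v::ab_group_add \<Rightarrow> 'v) \<Rightarrow> ('v \<Rightarrow> 'v \<Rightarrow> 'v) \<Rightarrow> 'v set \<Rightarrow> 'v set \<Rightarrow> bool" where
  "subalg sc br A S \<longleftrightarrow> S \<subseteq> A \<and> module.subspace sc S \<and> (\<forall>x\<in>S. \<forall>y\<in>S. br x y \<in> S)"

definition ideal_in :: "('f::field \<Rightarrow> 'v::ab_group_add \<Rightarrow> 'v) \<Rightarrow> ('v \<Rightarrow> 'v \<Rightarrow> 'v) \<Rightarrow> 'v set \<Rightarrow> 'v set \<Rightarrow> bool" where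
  "ideal_in sc br A I \<longleftrightarrow> I \<subseteq> A \<and> module.subspace sc I \<and> (\<forall>a\<in>A. \<forall>y\<in>I. br a y \<in> I)"

definition maximal_subalg :: "('f::field \<Rightarrow> 'v::ab_group_add \<Rightarrow> 'v) \<Rightarrow> ('v \<Rightarrow> 'v \<Rightarrow> 'v) \<Rightarrow> 'v set \<Rightarrow> 'v set \<Rightarrow> bool" where
  "maximal_subalg sc br A M \<longleftrightarrow> subalg sc br A M \<and> M \<noteq> A
     \<and> (\<forall>S. subalg sc br A S \<and> M \<subseteq> S \<longrightarrow> S = M \<or> S = A)"

text \<open>Frattini ideal: the largest ideal contained in every maximal subalgebra, i.e. the
sum (span of the union) of all such ideals.\<close>
definition frattini :: "('f::field \<Rightarrow> 'v::ab_group_add \<Rightarrow> 'v) \<Rightarrow> ('v \<Rightarrow> 'v \<Rightarrow> 'v) \<Rightarrow> 'v set \<Rightarrow> 'v set" where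
  "frattini sc br A = module.span sc (\<Union>{I. ideal_in sc br A I \<and> (\<forall>M. maximal_subalg sc br A M \<longrightarrow> I \<subseteq> M)})"

definition elementary :: "('f::field \<Rightarrow> 'v::ab_group_add \<Rightarrow> 'v) \<Rightarrow> ('v \<Rightarrow> 'v \<Rightarrow> 'v) \<Rightarrow> 'v set \<Rightarrow> bool" where
  "elementary sc br B \<longleftrightarrow> (\<forall>C. subalg sc br B C \<longrightarrow> frattini sc br C = {0})"

definition minimal_non_elementary :: "('f::field \<Rightarrow> 'v::ab_group_add \<Rightarrow> 'v) \<Rightarrow> ('v \<Rightarrow> 'v \<Rightarrow> 'v) \<Rightarrow> bool" where
  "minimal_non_elementary sc br \<longleftrightarrow> \<not> elementary sc br UNIV
     \<and> (\<forall>C. subalg sc br UNIV C \<and> C \<noteq> UNIV \<longrightarrow> elementary sc br C)"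

definition derived :: "('f::field \<Rightarrow> 'v::ab_group_add \<Rightarrow> 'v) \<Rightarrow> ('v \<Rightarrow> 'v \<Rightarrow> 'v) \<Rightarrow> 'v set \<Rightarrow> 'v set" where
  "derived sc br A = module.span sc {br a b | a b. a \<in> A \<and> b \<in> A}"

definition abelian :: "('v \<Rightarrow> 'v \<Rightarrow> 'v::ab_group_add) \<Rightarrow> 'v set \<Rightarrow> bool" where
  "abelian br S \<longleftrightarrow> (\<forall>x\<in>S. \<forall>y\<in>S. br x y = 0)"

definition minimal_abelian_ideal :: "('f::field \<Rightarrow> 'v::ab_group_add \<Rightarrow> 'v) \<Rightarrow> ('v \<Rightarrow> 'v \<Rightarrow> 'v) \<Rightarrow> 'v set \<Rightarrow> 'v set \<Rightarrow> bool" where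
  "minimal_abelian_ideal sc br A I \<longleftrightarrow> ideal_in sc br A I \<and> I \<noteq> {0} \<and> abelian br I
     \<and> (\<forall>J. ideal_in sc br A J \<and> J \<subseteq> I \<and> J \<noteq> {0} \<longrightarrow> J = I)"

definition asoc :: "('f::field \<Rightarrow> 'v::ab_group_add \<Rightarrow> 'v) \<Rightarrow> ('v \<Rightarrow> 'v \<Rightarrow> 'v) \<Rightarrow> 'v set \<Rightarrow> 'v set" where
  "asoc sc br A = module.span sc (\<Union>{I. minimal_abelian_ideal sc br A I})"

end

theory Submission
  imports "HOL-Algebra.Algebraic_Closure_Type" "Jordan_Normal_Form.Jordan_Normal_Form_Existence"
    "HOL-Library.Function_Algebras" Defs
begin

text \<open>If every proper subalgebra of \<open>L\<close> has zero Frattini ideal but \<open>L\<close> does not, take a minimal ideal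
  \<open>A\<close> of \<open>L\<close> inside \<open>\<phi>(L)\<close>.  It is abelian by Engel's theorem and has no complement in \<open>L\<close>, whereas
  abelian ideals of proper subalgebras are complemented.  A noncommuting pair whose commutator is
  central in the subalgebra it generates spans a non-elementary Heisenberg algebra, hence all of
  \<open>L\<close>; assume that there is none.

  Let \<open>B\<close> be a maximal abelian ideal containing \<open>A\<close>.  If \<open>L = B + Fx\<close>, then every proper
  \<open>ad x\<close>-invariant subspace of \<open>B\<close> is completely reducible and \<open>B\<close> is not, so \<open>ad x\<close> maps \<open>B\<close> onto
  itself by Fitting's lemma, and the socle of \<open>B\<close> is its largest proper invariant subspace and
  equals both \<open>\<phi>(L)\<close> and \<open>Asoc(L)\<close>.  If \<open>B\<close> has larger codimension, then each \<open>ad x\<close> acts completely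
  reducibly on \<open>B\<close>, and \<open>A\<close> would have a complement: when \<open>L / B\<close> has no abelian ideal by a
  Casimir argument (Cartan's criterion makes the relevant trace forms nondegenerate), and
  otherwise by decomposing \<open>B\<close> under an element \<open>r\<close> of an abelian ideal of \<open>L / B\<close>.\<close>

\<comment> \<open>these names would shadow those of the linear algebra library and of the definitions\<close>
hide_const LinearCombinations.module.span Generated_Groups.derived


section \<open>Subspaces of finite dimension\<close>

text \<open>Subalgebras and modules are subsets of one type and a quotient \<open>M / P\<close> is a
  pair of subsets, so every statement about a quotient becomes membership in \<open>P\<close>.
  \<open>A\<close> has no complement because a proper subalgebra \<open>S\<close> with
  \<open>A + S = L\<close> lies in a maximal one, which also contains \<phi>(L) and hence
  \<open>A\<close>. The codimension of \<open>B\<close> matters for one reason: if no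
  \<open>B + Fx\<close> is \<open>L\<close>, each of them is a proper subalgebra with zero Frattini
  ideal, and this makes \<open>B\<close> completely reducible under \<open>ad x\<close>.
  Reducibility under single elements is the tool when \<open>L / B\<close> has an abelian ideal;
  otherwise semisimplicity of \<open>L / B\<close> alone yields the complement. The absence of
  Heisenberg pairs enters twice: it keeps \<open>ad x\<close> from being nilpotent on
  \<open>B\<close> in codimension one, and it makes the centralizer of \<open>B\<close> in an ideal
  \<open>I\<close> with \<open>[I, I]\<close> inside \<open>B\<close> abelian, hence equal to
  \<open>B\<close>. Cartan's criterion is proved over the algebraic closure, since F need not
  contain the eigenvalues.\<close>

definition ssum :: "'a::ab_group_add set \<Rightarrow> 'a set \<Rightarrow> 'a set" (infixl \<open>\<boxplus>\<close> 65)
  where "U \<boxplus> V = {u + v |u v. u \<in> U \<and> v \<in> V}"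

lemma ssumI: "u \<in> U \<Longrightarrow> v \<in> V \<Longrightarrow> u + v \<in> U \<boxplus> V"
  by (auto simp: ssum_def)

lemma ssumE: "x \<in> U \<boxplus> V \<Longrightarrow> (\<And>u v. u \<in> U \<Longrightarrow> v \<in> V \<Longrightarrow> x = u + v \<Longrightarrow> R) \<Longrightarrow> R"
  by (auto simp: ssum_def)

locale vspace = vector_space scale for scale :: "'a::field \<Rightarrow> 'b::ab_group_add \<Rightarrow> 'b"
begin

text \<open>A property of subsets, because the modules of linear maps live in the function type
  \<open>'v \<Rightarrow> 'v\<close>, whose dimension may be infinite.\<close>

definition fdim :: "'b set \<Rightarrow> bool" where "fdim M \<longleftrightarrow> (\<exists>S. finite S \<and> M \<subseteq> span S)"

lemma fdim_mono: "fdim M \<Longrightarrow> U \<subseteq> M \<Longrightarrow> fdim U"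
  by (auto simp: fdim_def)

lemma subspace_ssum: "subspace U \<Longrightarrow> subspace V \<Longrightarrow> subspace (U \<boxplus> V)"
  unfolding ssum_def by (rule subspace_sums)

lemma ssum_left: "subspace V \<Longrightarrow> U \<subseteq> U \<boxplus> V"
  using ssumI[of _ U 0 V] subspace_0 by fastforce

lemma ssum_right: "subspace U \<Longrightarrow> V \<subseteq> U \<boxplus> V"
  using ssumI[of 0 U _ V] subspace_0 by fastforce

lemma ssum_least: "subspace W \<Longrightarrow> U \<subseteq> W \<Longrightarrow> V \<subseteq> W \<Longrightarrow> U \<boxplus> V \<subseteq> W"
  by (auto elim!: ssumE intro: subspace_add)

lemma independent_fdim_finite:
  assumes "fdim M" "independent B" "B \<subseteq> M"
  shows "finite B"
  using assms independent_span_bound unfolding fdim_def by blast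

lemma basis_extension:
  assumes U: "subspace U" "U \<subseteq> M" and M: "subspace M" "fdim M"
  obtains B C where "finite C" "B \<subseteq> C" "independent C" "span B = U" "span C = M" "B \<subseteq> U" "C \<subseteq> M"
proof -
  obtain B where B: "B \<subseteq> U" "independent B" "U \<subseteq> span B"
    by (rule maximal_independent_subset)
  obtain C where C: "B \<subseteq> C" "C \<subseteq> M" "independent C" "M \<subseteq> span C"
    using maximal_independent_subset_extend[OF subset_trans[OF B(1) U(2)] B(2)] by metis
  have "span B = U" using B U span_minimal by blast
  moreover have "span C = M" using C M span_minimal by blast
  moreover have "finite C" using independent_fdim_finite[OF M(2) C(3) C(2)] .
  ultimately show ?thesis using that B C by blast
qed

lemma dim_strict_mono:
  assumes "subspace U" "U \<subset> M" "subspace M" "fdim M"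
  shows "dim U < dim M"
proof -
  have "U \<subseteq> M" using assms by auto
  then obtain B C where bc: "finite C" "B \<subseteq> C" "independent C" "span B = U" "span C = M" "B \<subseteq> U" "C \<subseteq> M"
    by (rule basis_extension[OF assms(1) _ assms(3,4)])
  have "B \<noteq> C" using bc assms by auto
  then have "card B < card C" using bc by (simp add: psubset_card_mono psubsetI)
  moreover have "dim U = card B"
    using bc dim_span_eq_card_independent[of B] independent_mono by blast
  moreover have "dim M = card C" using bc dim_span_eq_card_independent[of C] by simp
  ultimately show ?thesis by simp
qed

lemma minimal_subspace:
  assumes "P N" "\<And>N. P N \<Longrightarrow> subspace N \<and> fdim N"
  obtains N where "P N" "\<And>N'. P N' \<Longrightarrow> N' \<subseteq> N \<Longrightarrow> N' = N"
proof -
  obtain N0 where N0: "P N0" "\<And>N'. P N' \<Longrightarrow> dim N0 \<le> dim N'"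
    using ex_has_least_nat[of P _ dim] assms(1) by blast
  have "N' = N0" if "P N'" "N' \<subseteq> N0" for N'
  proof (rule ccontr)
    assume "N' \<noteq> N0"
    then have "dim N' < dim N0" using dim_strict_mono[of N' N0] assms(2) that N0(1) by blast
    with N0(2)[OF that(1)] show False by simp
  qed
  with N0(1) that show ?thesis by blast
qed

lemma maximal_subspace:
  assumes "P N" "\<And>N. P N \<Longrightarrow> subspace N \<and> N \<subseteq> M" "fdim M"
  obtains N where "P N" "\<And>N'. P N' \<Longrightarrow> N \<subseteq> N' \<Longrightarrow> N' = N"
proof -
  obtain S where S: "finite S" "M \<subseteq> span S" using assms(3) unfolding fdim_def by auto
  have b: "dim N < Suc (card S)" if "P N" for N
    using dim_le_card[of N S] S assms(2)[OF that] by (meson le_imp_less_Suc order_trans)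
  obtain N0 where N0: "P N0" "\<And>N'. P N' \<Longrightarrow> dim N' \<le> dim N0"
    using ex_has_greatest_nat[of P N dim "Suc (card S)"] assms(1) b by (meson less_imp_le)
  have "N' = N0" if "P N'" "N0 \<subseteq> N'" for N'
  proof (rule ccontr)
    assume "N' \<noteq> N0"
    then have "dim N0 < dim N'"
      using dim_strict_mono[of N0 N'] assms that N0(1) fdim_mono by blast
    with N0(2)[OF that(1)] show False by simp
  qed
  with N0(1) that show ?thesis by blast
qed

lemma complement_exists:
  assumes U: "subspace U" "U \<subseteq> M" and M: "subspace M" "fdim M"
  obtains D where "subspace D" "D \<subseteq> M" "U \<inter> D = {0}" "U \<boxplus> D = M"
proof -
  define Q where "Q D \<longleftrightarrow> subspace D \<and> D \<subseteq> M \<and> U \<inter> D = {0}" for D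
  have "Q {0}" unfolding Q_def using U M subspace_0 by auto
  from maximal_subspace[of Q "{0}" M, OF this _ M(2)]
  obtain D where D: "Q D" "\<And>N'. Q N' \<Longrightarrow> D \<subseteq> N' \<Longrightarrow> N' = D" unfolding Q_def by blast
  note d = D(1)[unfolded Q_def]
  have sub: "U \<boxplus> D \<subseteq> M" using ssum_least d U M by blast
  have "m \<in> U \<boxplus> D" if m: "m \<in> M" for m
  proof (rule ccontr)
    assume n: "m \<notin> U \<boxplus> D"
    let ?E = "D \<boxplus> span {m}"
    have se: "subspace ?E" using d by (intro subspace_ssum) auto
    have DE: "D \<subseteq> ?E" by (intro ssum_left) auto
    have mE: "m \<in> ?E" using ssum_right[of D "span {m}"] d span_base[of m "{m}"] by blast
    have "?E \<subseteq> M" using ssum_least[of M D "span {m}"] d m M span_minimal[of "{m}" M] by blast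
    moreover have "U \<inter> ?E = {0}"
    proof -
      have "x = 0" if x: "x \<in> U" "x \<in> ?E" for x
      proof -
        obtain e k where ek: "e \<in> D" "x = e + scale k m"
          using x(2) by (auto elim!: ssumE simp: span_singleton)
        show ?thesis
        proof (cases "k = 0")
          case True then show ?thesis using ek x d by auto
        next
          case False
          have "scale k m = x + (- e)" using ek by simp
          then have "scale k m \<in> U \<boxplus> D" using ssumI x(1) d ek(1) subspace_neg by metis
          then have "scale (inverse k) (scale k m) \<in> U \<boxplus> D"
            using subspace_scale subspace_ssum U(1) d by blast
          with False n show ?thesis by simp
        qed
      qed
      then show ?thesis using U se subspace_0 by auto
    qed
    ultimately have "Q ?E" unfolding Q_def using se by simp
    from D(2)[OF this DE] mE have "m \<in> D" by simp
    then show False using n ssum_right[OF U(1)] by blast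
  qed
  with sub have "U \<boxplus> D = M" by blast
  with that d show ?thesis by blast
qed

text \<open>A basis of \<open>M / P\<close> with its dual basis, as data on the ambient space. A
  basis of \<open>P\<close> is extended first to \<open>M\<close> and then to the whole space, so
  that the coordinates \<open>c i\<close> are linear everywhere and not just on
  \<open>M\<close>.\<close>

lemma quotient_coordinates:
  assumes P: "subspace P" "P \<subseteq> M" and M: "subspace M" "fdim M"
  obtains n :: nat and b :: "nat \<Rightarrow> 'b" and c :: "nat \<Rightarrow> 'b \<Rightarrow> 'a" where
    "\<And>i. i < n \<Longrightarrow> b i \<in> M"
    "\<And>i u v. c i (u + v) = c i u + c i v"
    "\<And>i k v. c i (scale k v) = k * c i v"
    "\<And>i p. i < n \<Longrightarrow> p \<in> P \<Longrightarrow> c i p = 0"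
    "\<And>i j. i < n \<Longrightarrow> j < n \<Longrightarrow> c i (b j) = (if i = j then 1 else 0)"
    "\<And>v. v \<in> M \<Longrightarrow> v - (\<Sum>i<n. scale (c i v) (b i)) \<in> P"
proof -
  obtain B C where bc: "finite C" "B \<subseteq> C" "independent C" "span B = P" "span C = M" "B \<subseteq> P" "C \<subseteq> M"
    by (rule basis_extension[OF assms])
  define E where "E = extend_basis C"
  have E: "C \<subseteq> E" "independent E" "span E = UNIV"
    unfolding E_def using extend_basis_superset independent_extend_basis span_extend_basis bc by auto
  define n where "n = card (C - B)"
  obtain b where b: "bij_betw b {..<n} (C - B)"
    using ex_bij_betw_nat_finite[of "C - B"] bc(1) by (auto simp: n_def atLeast0LessThan)
  define c where "c i v = representation E v (b i)" for i v
  have bE: "b i \<in> C - B" if "i < n" for i using b that by (auto simp: bij_betw_def)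
  have reps: "representation E v x = representation D v x"
    if "D \<subseteq> E" "v \<in> span D" for D v x
    using representation_extend[OF E(2) that(2) that(1)] by simp
  have c0: "c i p = 0" if "i < n" "p \<in> P" for i p
  proof -
    have "p \<in> span B" using that bc by simp
    then have "representation E p (b i) = representation B p (b i)"
      by (intro reps) (use E bc in auto)
    also have "\<dots> = 0" using representation_ne_zero[of B p "b i"] bE[OF that(1)] by blast
    finally show ?thesis by (simp add: c_def)
  qed
  have cb: "c i (b j) = (if i = j then 1 else 0)" if "i < n" "j < n" for i j
  proof -
    have "b j \<in> E" using bE[OF that(2)] E by blast
    then have "c i (b j) = (if b i = b j then 1 else 0)"
      unfolding c_def using representation_basis[OF E(2)] by auto
    moreover have "b i = b j \<longleftrightarrow> i = j" using b that by (auto simp: bij_betw_def inj_on_def)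
    ultimately show ?thesis by simp
  qed
  have dec: "v - (\<Sum>i<n. scale (c i v) (b i)) \<in> P" if v: "v \<in> M" for v
  proof -
    have vC: "v \<in> span C" using v bc by simp
    have eq: "representation E v x = representation C v x" for x by (rule reps[OF E(1) vC])
    have "v = (\<Sum>x\<in>C. scale (representation C v x) x)"
      using sum_representation_eq[OF bc(3) vC bc(1)] by simp
    also have "\<dots> = (\<Sum>x\<in>B. scale (representation C v x) x) + (\<Sum>x\<in>C-B. scale (representation C v x) x)"
      using sum.subset_diff[OF bc(2) bc(1), of "\<lambda>x. scale (representation C v x) x"] by (simp add: add.commute)
    also have "(\<Sum>x\<in>C-B. scale (representation C v x) x) = (\<Sum>i<n. scale (c i v) (b i))"
      unfolding c_def eq using sum.reindex_bij_betw[OF b, of "\<lambda>x. scale (representation C v x) x"] by simp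
    finally have "v - (\<Sum>i<n. scale (c i v) (b i)) = (\<Sum>x\<in>B. scale (representation C v x) x)"
      by (simp add: algebra_simps)
    also have "\<dots> \<in> P" using bc P by (intro subspace_sum subspace_scale) auto
    finally show ?thesis .
  qed
  show ?thesis
  proof (rule that[of n b c])
    show "c i (u + v) = c i u + c i v" for i u v
      unfolding c_def using representation_add[OF E(2)] E(3) by simp
    show "c i (scale k v) = k * c i v" for i k v
      unfolding c_def using representation_scale[OF E(2)] E(3) by simp
  qed (use bE bc c0 cb dec in auto)
qed

text \<open>The images of the powers of \<open>T\<close> shrink and become stationary, so some
  \<open>T^N\<close> and \<open>T^(2N)\<close> have the same image and \<open>v - T^N w\<close>
  lands in the kernel of \<open>T^N\<close>. The exponent is kept positive because
  \<open>T^N w\<close> must later lie in the image of \<open>T\<close>.\<close>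

lemma fitting:
  assumes M: "subspace M" "fdim M" and T: "\<And>u v. T (u + v) = T u + T v" "\<And>k v. T (scale k v) = scale k (T v)"
    and inv: "\<And>v. v \<in> M \<Longrightarrow> T v \<in> M"
  shows "\<exists>N. \<forall>v\<in>M. \<exists>w\<in>M. (T ^^ Suc N) (v - (T ^^ Suc N) w) = 0"
proof -
  have Tn: "(T ^^ n) (u + v) = (T ^^ n) u + (T ^^ n) v" "(T ^^ n) (scale k v) = scale k ((T ^^ n) v)"
    for n u v k by (induction n) (auto simp: T)
  have Ti: "v \<in> M \<Longrightarrow> (T ^^ n) v \<in> M" for n v by (induction n) (auto simp: inv)
  have sub: "subspace ((T ^^ n) ` M)" for n
  proof (rule subspaceI)
    have "(T ^^ n) 0 = 0" using Tn(1)[of n 0 0] by simp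
    then show "0 \<in> (T ^^ n) ` M" using M subspace_0 by (metis imageI)
    show "x + y \<in> (T ^^ n) ` M" if "x \<in> (T ^^ n) ` M" "y \<in> (T ^^ n) ` M" for x y
      using that M(1) subspace_add by (force simp flip: Tn(1))
    show "scale k x \<in> (T ^^ n) ` M" if "x \<in> (T ^^ n) ` M" for k x
      using that M(1) subspace_scale by (force simp flip: Tn(2))
  qed
  have fd: "fdim ((T ^^ n) ` M)" for n using fdim_mono[OF M(2)] Ti by blast
  define Q where "Q V \<longleftrightarrow> (\<exists>n. V = (T ^^ n) ` M)" for V
  have "Q ((T ^^ 0) ` M)" unfolding Q_def by blast
  then obtain V where V: "Q V" "\<And>N'. Q N' \<Longrightarrow> N' \<subseteq> V \<Longrightarrow> N' = V"
    by (rule minimal_subspace) (use sub fd in \<open>auto simp: Q_def\<close>)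
  then obtain K where K: "V = (T ^^ K) ` M" by (auto simp: Q_def)
  define N where "N = Suc K"
  have "(T ^^ N) ` M \<subseteq> V" unfolding K N_def funpow_Suc_right using inv by auto
  then have N: "V = (T ^^ N) ` M" using V(2)[of "(T ^^ N) ` M"] unfolding Q_def by blast
  have "(T ^^ (N + N)) ` M \<subseteq> V" unfolding N funpow_add using Ti by auto
  then have eq: "(T ^^ (N + N)) ` M = (T ^^ N) ` M" using V(2)[of "(T ^^ (N + N)) ` M"] N unfolding Q_def by blast
  have "\<exists>w\<in>M. (T ^^ N) (v - (T ^^ N) w) = 0" if "v \<in> M" for v
  proof -
    have "(T ^^ N) v \<in> (T ^^ (N + N)) ` M" unfolding eq using that by (rule imageI)
    then obtain w where w: "w \<in> M" "(T ^^ N) v = (T ^^ (N + N)) w" by (rule imageE)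
    have "(T ^^ N) (v - (T ^^ N) w) = (T ^^ N) v - (T ^^ N) ((T ^^ N) w)"
      using Tn(1)[of N "v - (T ^^ N) w" "(T ^^ N) w"] by (simp add: eq_diff_eq)
    also have "\<dots> = 0" using w(2) by (simp add: funpow_add)
    finally show ?thesis using w(1) by (rule bexI)
  qed
  then show ?thesis unfolding N_def by blast
qed

end

text \<open>Replaces the dimension count that identifies a space with its dual through a
  nondegenerate form.\<close>

lemma functional_in_span:
  fixes f :: "'v::ab_group_add \<Rightarrow> 'f::field" and g :: "'i \<Rightarrow> 'v \<Rightarrow> 'f"
  assumes "finite I"
    and "\<And>u v. f (u + v) = f u + f v" "\<And>k u. f (sc k u) = k * f u"
    and "\<And>i u v. i \<in> I \<Longrightarrow> g i (u + v) = g i u + g i v" "\<And>i k u. i \<in> I \<Longrightarrow> g i (sc k u) = k * g i u"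
    and "\<And>v. (\<And>i. i \<in> I \<Longrightarrow> g i v = 0) \<Longrightarrow> f v = 0"
  shows "\<exists>a. \<forall>v. f v = (\<Sum>i\<in>I. a i * g i v)"
  using assms
proof (induction I arbitrary: f rule: finite_induct)
  case empty
  then show ?case by auto
next
  case (insert j I)
  note flin = insert.prems(1,2) and glin = insert.prems(3,4)
  have diff: "h (u - v) = h u - h v" if "\<And>u v. h (u + v) = h u + h v" for h :: "'v \<Rightarrow> 'f" and u v
    using that[of "u - v" v] by (simp add: eq_diff_eq)
  show ?case
  proof (cases "\<exists>w. (\<forall>i\<in>I. g i w = 0) \<and> g j w \<noteq> 0")
    case False
    then have "\<And>v. (\<And>i. i \<in> I \<Longrightarrow> g i v = 0) \<Longrightarrow> f v = 0" using insert.prems(5) by blast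
    then have "\<exists>a. \<forall>v. f v = (\<Sum>i\<in>I. a i * g i v)"
      by (intro insert.IH) (use flin glin in auto)
    then obtain a where a: "\<forall>v. f v = (\<Sum>i\<in>I. a i * g i v)" by blast
    have "(\<Sum>i\<in>I. (a(j := 0)) i * g i v) = (\<Sum>i\<in>I. a i * g i v)" for v
      using insert.hyps by (intro sum.cong) auto
    then have "f v = (\<Sum>i\<in>insert j I. (a(j := 0)) i * g i v)" for v
      using insert.hyps a by simp
    then show ?thesis by blast
  next
    case True
    then obtain w where w: "\<And>i. i \<in> I \<Longrightarrow> g i w = 0" "g j w \<noteq> 0" by blast
    \<comment> \<open>With this multiple, \<open>f'\<close> vanishes at \<open>w\<close>.
      Subtracting from \<open>v\<close> its component along \<open>w\<close> leaves a vector killed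
      by all the \<open>g i\<close>, where \<open>f\<close> is zero.\<close>
    define q where "q = f w / g j w"
    define f' where "f' v = f v - q * g j v" for v
    have f'lin: "f' (u + v) = f' u + f' v" "f' (sc k u) = k * f' u" for u v k
      using flin glin[of j] by (auto simp: f'_def algebra_simps)
    have f'0: "f' v = 0" if v: "\<And>i. i \<in> I \<Longrightarrow> g i v = 0" for v
    proof -
      define u where "u = v - sc (g j v / g j w) w"
      have "g i u = g i v - g j v / g j w * g i w" if "i \<in> insert j I" for i
        unfolding u_def using diff[of "g i" v] glin[OF that] by simp
      then have "g i u = 0" if "i \<in> insert j I" for i
        using that v w by (cases "i = j") simp_all
      then have "f u = 0" using insert.prems(5) by blast
      moreover have "f u = f v - g j v / g j w * f w"
        unfolding u_def using diff[of f v] flin by simp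
      ultimately show ?thesis unfolding f'_def q_def by simp
    qed
    have "\<exists>a. \<forall>v. f' v = (\<Sum>i\<in>I. a i * g i v)"
      by (intro insert.IH) (use f'lin f'0 glin in auto)
    then obtain a where a: "\<forall>v. f' v = (\<Sum>i\<in>I. a i * g i v)" by blast
    have "f v = (\<Sum>i\<in>insert j I. (a(j := q)) i * g i v)" for v
    proof -
      have "(\<Sum>i\<in>I. (a(j := q)) i * g i v) = (\<Sum>i\<in>I. a i * g i v)"
        using insert.hyps by (intro sum.cong) auto
      then show ?thesis using insert.hyps a by (simp add: f'_def algebra_simps)
    qed
    then show ?thesis by blast
  qed
qed


section \<open>Cartan's trace criterion\<close>

context vspace
begin

text \<open>Modulo \<open>U\<close>, the vector \<open>z\<close> would be an eigenvector for \<nu>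
  and a generalized one for \<mu>. Concretely, \<open>(\<mu> - \<nu>) z\<close> is
  \<open>(T - \<nu>) z - (T - \<mu>) z\<close>; the first term is in \<open>U\<close>, and the
  second satisfies the same hypotheses with \<open>N\<close> smaller.\<close>

lemma shift_mem:
  assumes U: "subspace U" and inv: "\<And>z. z \<in> U \<Longrightarrow> T z \<in> U"
    and T: "\<And>u v. T (u + v) = T u + T v" "\<And>k v. T (scale k v) = scale k (T v)"
    and "\<mu> \<noteq> \<nu>" "((\<lambda>z. T z - scale \<mu> z) ^^ N) z = 0" "T z - scale \<nu> z \<in> U"
  shows "z \<in> U"
  using assms(6,7)
proof (induction N arbitrary: z)
  case 0
  then show ?case using subspace_0[OF U] by simp
next
  case (Suc N)
  define z' where "z' = T z - scale \<mu> z"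
  define w where "w = T z - scale \<nu> z"
  have diff: "T (u - v) = T u - T v" for u v using T(1)[of "u - v" v] by (simp add: eq_diff_eq)
  have w: "w \<in> U" using Suc.prems w_def by simp
  have "T z' - scale \<nu> z' = T w - scale \<mu> w"
    unfolding z'_def w_def diff T by (simp add: algebra_simps)
  then have "T z' - scale \<nu> z' \<in> U" using inv w U subspace_diff subspace_scale by metis
  moreover have "((\<lambda>z. T z - scale \<mu> z) ^^ N) z' = 0"
    using Suc.prems(1) unfolding z'_def funpow_Suc_right by simp
  ultimately have "z' \<in> U" using Suc.IH by blast
  moreover have "scale (\<mu> - \<nu>) z = w - z'" by (simp add: w_def z'_def algebra_simps)
  ultimately have "scale (\<mu> - \<nu>) z \<in> U" using U w subspace_diff by metis
  then have "scale (inverse (\<mu> - \<nu>)) (scale (\<mu> - \<nu>) z) \<in> U" using U subspace_scale by blast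
  then show ?case using \<open>\<mu> \<noteq> \<nu>\<close> by simp
qed

lemma shift_power_mem:
  assumes U: "subspace U" and inv: "\<And>z. z \<in> U \<Longrightarrow> T z \<in> U"
    and T: "\<And>u v. T (u + v) = T u + T v" "\<And>k v. T (scale k v) = scale k (T v)"
    and ne: "\<mu> \<noteq> \<nu>" and "((\<lambda>z. T z - scale \<mu> z) ^^ N) z = 0"
    and "((\<lambda>z. T z - scale \<nu> z) ^^ k) z \<in> U"
  shows "z \<in> U"
  using assms(6,7)
proof (induction k arbitrary: z)
  case 0
  then show ?case by simp
next
  case (Suc k)
  have diff: "T (u - v) = T u - T v" for u v using T(1)[of "u - v" v] by (simp add: eq_diff_eq)
  let ?z = "T z - scale \<nu> z"
  have "((\<lambda>z. T z - scale \<mu> z) ^^ N) (T z - scale \<nu> z)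
      = T (((\<lambda>z. T z - scale \<mu> z) ^^ N) z) - scale \<nu> (((\<lambda>z. T z - scale \<mu> z) ^^ N) z)"
  proof (induction N)
    case (Suc N)
    show ?case
      by (simp only: funpow.simps comp_apply Suc.IH) (simp add: diff T algebra_simps)
  qed simp
  also have "\<dots> = 0" using Suc.prems(1) T(2)[of 0 0] by simp
  finally have "?z \<in> U" using Suc.IH[of ?z] Suc.prems(2) unfolding funpow_Suc_right by simp
  then show ?case using shift_mem[OF U inv T ne Suc.prems(1)] by blast
qed

text \<open>Applying \<open>(T - \<nu>)^N\<close> deletes the component for \<nu> and keeps the
  others generalized eigenvectors, so by induction their images lie in \<open>U\<close>;
  \<open>shift_power_mem\<close> then removes the operator again.\<close>

lemma components_mem:
  assumes U: "subspace U" and inv: "\<And>z. z \<in> U \<Longrightarrow> T z \<in> U"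
    and T: "\<And>u v. T (u + v) = T u + T v" "\<And>k v. T (scale k v) = scale k (T v)"
    and "finite S" "\<And>\<mu>. \<mu> \<in> S \<Longrightarrow> ((\<lambda>z. T z - scale \<mu> z) ^^ N) (Z \<mu>) = 0"
    and "(\<Sum>\<mu>\<in>S. Z \<mu>) \<in> U" "\<mu> \<in> S"
  shows "Z \<mu> \<in> U"
  using assms(5-)
proof (induction S arbitrary: Z \<mu> rule: finite_induct)
  case empty
  then show ?case by simp
next
  case (insert \<nu> S)
  have diff: "T (u - v) = T u - T v" for u v using T(1)[of "u - v" v] by (simp add: eq_diff_eq)
  define F where "F = (\<lambda>z. T z - scale \<nu> z) ^^ N"
  have Fadd: "F (u + v) = F u + F v" for u v
    unfolding F_def by (induction N arbitrary: u v) (auto simp: T algebra_simps)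
  have F0: "F 0 = 0" using Fadd[of 0 0] by simp
  have FU: "z \<in> U \<Longrightarrow> F z \<in> U" for z
    unfolding F_def by (induction N) (auto intro: inv subspace_diff[OF U] subspace_scale[OF U])
  have Fsum: "F (\<Sum>\<mu>\<in>A. Z \<mu>) = (\<Sum>\<mu>\<in>A. F (Z \<mu>))" for A
    by (induction A rule: infinite_finite_induct) (auto simp: Fadd F0)
  have comm: "T (F z) = F (T z)" for z
    unfolding F_def by (induction N arbitrary: z) (auto simp: diff T)
  have Fsc: "F (scale k z) = scale k (F z)" for k z
    unfolding F_def by (induction N arbitrary: z) (auto simp: T algebra_simps)
  have Fdiff: "F (u - v) = F u - F v" for u v using Fadd[of "u - v" v] by (simp add: eq_diff_eq)
  have commN: "((\<lambda>z. T z - scale \<rho> z) ^^ m) (F z) = F (((\<lambda>z. T z - scale \<rho> z) ^^ m) z)" for \<rho> m z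
    by (induction m) (auto simp: comm Fsc Fdiff)
  have "F (\<Sum>\<mu>\<in>insert \<nu> S. Z \<mu>) = (\<Sum>\<mu>\<in>S. F (Z \<mu>))"
    unfolding Fsum using insert.hyps insert.prems(1)[of \<nu>] by (simp add: F_def)
  then have "(\<Sum>\<mu>\<in>S. F (Z \<mu>)) \<in> U" using FU[OF insert.prems(2)] by simp
  moreover have "((\<lambda>z. T z - scale \<mu> z) ^^ N) (F (Z \<mu>)) = 0" if "\<mu> \<in> S" for \<mu>
    unfolding commN using insert.prems(1)[of \<mu>] that F0 by simp
  ultimately have FZ: "F (Z \<mu>) \<in> U" if "\<mu> \<in> S" for \<mu>
    using insert.IH[of "\<lambda>\<mu>. F (Z \<mu>)" \<mu>] that by blast
  have ZS: "Z \<mu> \<in> U" if "\<mu> \<in> S" for \<mu>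
  proof (rule shift_power_mem[OF U inv T])
    show "\<mu> \<noteq> \<nu>" using that insert.hyps by blast
    show "((\<lambda>z. T z - scale \<mu> z) ^^ N) (Z \<mu>) = 0" using insert.prems(1) that by blast
    show "((\<lambda>z. T z - scale \<nu> z) ^^ N) (Z \<mu>) \<in> U" using FZ[OF that] unfolding F_def .
  qed
  have "(\<Sum>\<mu>\<in>S. Z \<mu>) \<in> U" using ZS by (rule subspace_sum[OF U])
  with insert.prems(2) have "(\<Sum>\<mu>\<in>insert \<nu> S. Z \<mu>) - (\<Sum>\<mu>\<in>S. Z \<mu>) \<in> U"
    by (rule subspace_diff[OF U])
  moreover have "(\<Sum>\<mu>\<in>insert \<nu> S. Z \<mu>) - (\<Sum>\<mu>\<in>S. Z \<mu>) = Z \<nu>" using insert.hyps by simp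
  ultimately have "Z \<nu> \<in> U" by simp
  with ZS insert.prems(3) show ?case by blast
qed

end

text \<open>Square matrices of size \<open>n\<close> as functions vanishing outside \<open>{..<n} \<times> {..<n}\<close>.\<close>

definition mm :: "nat \<Rightarrow> (nat \<Rightarrow> nat \<Rightarrow> 'e::comm_ring_1) \<Rightarrow> (nat \<Rightarrow> nat \<Rightarrow> 'e) \<Rightarrow> nat \<Rightarrow> nat \<Rightarrow> 'e"
  where "mm n A B = (\<lambda>i j. if i < n \<and> j < n then \<Sum>k<n. A i k * B k j else 0)"

definition mid :: "nat \<Rightarrow> nat \<Rightarrow> nat \<Rightarrow> 'e::comm_ring_1"
  where "mid n = (\<lambda>i j. if i < n \<and> i = j then 1 else 0)"

definition msupp :: "nat \<Rightarrow> (nat \<Rightarrow> nat \<Rightarrow> 'e::comm_ring_1) \<Rightarrow> bool"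
  where "msupp n A \<longleftrightarrow> (\<forall>i j. \<not> (i < n \<and> j < n) \<longrightarrow> A i j = 0)"

definition mtrace :: "nat \<Rightarrow> (nat \<Rightarrow> nat \<Rightarrow> 'e::comm_ring_1) \<Rightarrow> 'e"
  where "mtrace n A = (\<Sum>i<n. A i i)"

primrec mpow :: "nat \<Rightarrow> (nat \<Rightarrow> nat \<Rightarrow> 'e::comm_ring_1) \<Rightarrow> nat \<Rightarrow> nat \<Rightarrow> nat \<Rightarrow> 'e" where
  "mpow n A 0 = mid n"
| "mpow n A (Suc m) = mm n A (mpow n A m)"

lemma mm_assoc: "mm n (mm n A B) C = mm n A (mm n B C)"
proof (intro ext)
  fix i j
  show "mm n (mm n A B) C i j = mm n A (mm n B C) i j"
  proof (cases "i < n \<and> j < n")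
    case True
    have "(\<Sum>k<n. (\<Sum>l<n. A i l * B l k) * C k j) = (\<Sum>k<n. \<Sum>l<n. A i l * B l k * C k j)"
      by (simp add: sum_distrib_right)
    also have "\<dots> = (\<Sum>l<n. \<Sum>k<n. A i l * B l k * C k j)" by (rule sum.swap)
    also have "\<dots> = (\<Sum>l<n. A i l * (\<Sum>k<n. B l k * C k j))"
      by (simp add: sum_distrib_left mult.assoc)
    finally show ?thesis using True by (simp add: mm_def)
  qed (auto simp: mm_def)
qed

lemma mm_diff: "mm n (A - B) C = mm n A C - mm n B C" "mm n A (B - C) = mm n A B - mm n A C"
  by (intro ext; simp add: mm_def algebra_simps sum_subtractf)+

lemma mm_mid: "msupp n A \<Longrightarrow> mm n (mid n) A = A" "msupp n A \<Longrightarrow> mm n A (mid n) = A"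
  by (intro ext; auto simp: mm_def mid_def msupp_def if_distrib[of "\<lambda>x. x * _"] if_distrib[of "\<lambda>x. _ * x"] cong: if_cong)+

lemma msupp_mm [simp]: "msupp n (mm n A B)" by (auto simp: msupp_def mm_def)
lemma msupp_mid [simp]: "msupp n (mid n)" by (auto simp: msupp_def mid_def)

lemma mtrace_mm: "mtrace n (mm n A B) = (\<Sum>i<n. \<Sum>k<n. A i k * B k i)"
  by (simp add: mtrace_def mm_def)

lemma mtrace_commute: "mtrace n (mm n A B) = mtrace n (mm n B A)"
  unfolding mtrace_mm by (subst sum.swap) (simp add: mult.commute)


lemma sum_neq_zeroE:
  fixes g :: "nat \<Rightarrow> 'e::comm_monoid_add"
  assumes "(\<Sum>k<n. g k) \<noteq> 0" obtains k where "k < n" "g k \<noteq> 0"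
  using assms by (meson lessThan_iff sum.neutral)

text \<open>For \<open>D\<close> the diagonal matrix with entries \<open>f (\<lambda> i)\<close>, the
  operator \<open>ad D\<close> acts on the generalized eigenspaces of \<open>ad J\<close> by \<open>f\<close> of the eigenvalue.\<close>

lemma jordan_bracket_trace:
  fixes J Z W :: "nat \<Rightarrow> nat \<Rightarrow> 'e::field" and lam :: "nat \<Rightarrow> 'e" and f :: "'e \<Rightarrow> 'e"
  assumes J: "\<And>i k. i < n \<Longrightarrow> k < n \<Longrightarrow> i \<noteq> k \<Longrightarrow> J i k \<noteq> 0 \<Longrightarrow> i < k \<and> lam i = lam k"
    and Jd: "\<And>i. i < n \<Longrightarrow> J i i = lam i"
    and f: "\<And>x y. f (x + y) = f x + f y"
    and Z: "msupp n Z"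
    and tr: "\<And>j. mtrace n (mm n (((\<lambda>Y. mm n J Y - mm n Y J) ^^ Suc j) Z) W) = 0"
  shows "(\<Sum>i<n. \<Sum>k<n. (f (lam i) - f (lam k)) * Z i k * W k i) = 0"
proof -
  define sc :: "'e \<Rightarrow> (nat \<Rightarrow> nat \<Rightarrow> 'e) \<Rightarrow> (nat \<Rightarrow> nat \<Rightarrow> 'e)" where "sc c Y = (\<lambda>i j. c * Y i j)" for c Y
  interpret V: vspace sc
    by unfold_locales (auto simp: sc_def fun_eq_iff algebra_simps)
  define T where "T = (\<lambda>Y. mm n J Y - mm n Y J)"
  have Tadd: "T (Y + Y') = T Y + T Y'" for Y Y'
    unfolding T_def mm_def by (auto simp: fun_eq_iff algebra_simps sum.distrib)
  have Tsc: "T (sc c Y) = sc c (T Y)" for c Y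
    unfolding T_def mm_def sc_def
    by (auto simp: fun_eq_iff algebra_simps sum_distrib_left)
  define \<theta> where "\<theta> Y = mtrace n (mm n Y W)" for Y
  have \<theta>add: "\<theta> (Y + Y') = \<theta> Y + \<theta> Y'" and \<theta>sc: "\<theta> (sc c Y) = c * \<theta> Y" for Y Y' c
    unfolding \<theta>_def mtrace_mm sc_def
    by (simp_all add: algebra_simps sum.distrib sum_distrib_left)
  have Tn: "(T ^^ m) (Y + Y') = (T ^^ m) Y + (T ^^ m) Y'" "(T ^^ m) (sc c Y) = sc c ((T ^^ m) Y)" for m Y Y' c
    by (induction m) (auto simp: Tadd Tsc)
  have Tn0: "(T ^^ m) 0 = 0" for m using Tn(1)[of m 0 0] by simp
  have \<theta>0: "\<theta> 0 = 0" using \<theta>sc[of 0 0] by (simp add: sc_def zero_fun_def)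
  \<comment> \<open>\<open>U0\<close> is the largest \<open>T\<close>-invariant subspace on which
    the trace against \<open>W\<close> vanishes, and \<open>U1\<close> is its preimage under
    \<open>T\<close>. The trace hypothesis says that \<open>Z\<close> is in
    \<open>U1\<close>.\<close>
  define U0 where "U0 = {Y. \<forall>j. \<theta> ((T ^^ j) Y) = 0}"
  define U1 where "U1 = {Y. \<forall>j. \<theta> ((T ^^ Suc j) Y) = 0}"
  have U0: "V.subspace U0"
    unfolding U0_def by (rule V.subspaceI) (auto simp: Tn Tn0 \<theta>add \<theta>sc \<theta>0)
  have U1: "V.subspace U1"
    unfolding U1_def by (rule V.subspaceI) (auto simp: Tn Tn0 Tadd Tsc \<theta>add \<theta>sc \<theta>0 simp flip: funpow.simps(2))
  have inv0: "Y \<in> U0 \<Longrightarrow> T Y \<in> U0" for Y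
    unfolding U0_def mem_Collect_eq by (metis funpow_swap1 funpow.simps(2) o_apply)
  have inv1: "Y \<in> U1 \<Longrightarrow> T Y \<in> U1" for Y
    unfolding U1_def mem_Collect_eq by (metis funpow_swap1 funpow.simps(2) o_apply)
  have U10: "Y \<in> U1 \<Longrightarrow> T Y \<in> U0" for Y
    unfolding U1_def U0_def mem_Collect_eq by (metis funpow_swap1 funpow.simps(2) o_apply)
  define S where "S = (\<lambda>(i,k). lam i - lam k) ` ({..<n} \<times> {..<n})"
  \<comment> \<open>The component of \<open>Z\<close> in the generalized eigenspace of
    \<open>ad J\<close> for the eigenvalue \<mu>.\<close>
  define Zc where "Zc \<mu> = (\<lambda>i k. if i < n \<and> k < n \<and> lam i - lam k = \<mu> then Z i k else 0)" for \<mu>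
  have finS: "finite S" unfolding S_def by simp
  have ZS: "(\<Sum>\<mu>\<in>S. Zc \<mu>) = Z"
  proof (intro ext)
    fix i k
    have "(\<Sum>\<mu>\<in>S. Zc \<mu>) i k = (\<Sum>\<mu>\<in>S. Zc \<mu> i k)"
      by (induction S rule: infinite_finite_induct) auto
    also have "\<dots> = Z i k"
    proof (cases "i < n \<and> k < n")
      case True
      then have "lam i - lam k \<in> S" by (auto simp: S_def)
      then show ?thesis using True finS by (simp add: Zc_def)
    qed (use Z in \<open>auto simp: Zc_def msupp_def\<close>)
    finally show "(\<Sum>\<mu>\<in>S. Zc \<mu>) i k = Z i k" .
  qed
  \<comment> \<open>each application of \<open>T - \<mu>\<close> moves the support one diagonal up\<close>
  have deg: "\<forall>i k. ((\<lambda>Y. T Y - sc \<mu> Y) ^^ d) (Zc \<mu>) i k \<noteq> 0 \<longrightarrow>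
      i < n \<and> k < n \<and> lam i - lam k = \<mu> \<and> i + d \<le> k + n" for d \<mu>
  proof (induction d)
    case 0
    then show ?case by (auto simp: Zc_def)
  next
    case (Suc d)
    define Y where "Y = ((\<lambda>Y. T Y - sc \<mu> Y) ^^ d) (Zc \<mu>)"
    have IH: "Y i k \<noteq> 0 \<Longrightarrow> i < n \<and> k < n \<and> lam i - lam k = \<mu> \<and> i + d \<le> k + n" for i k
      using Suc.IH unfolding Y_def by blast
    have "i < n \<and> k < n \<and> lam i - lam k = \<mu> \<and> i + Suc d \<le> k + n"
      if nz: "(T Y - sc \<mu> Y) i k \<noteq> 0" for i k
    proof -
      have ik: "i < n" "k < n"
        using nz IH[of i k] by (auto simp: T_def mm_def sc_def split: if_splits)
      have 1: "(\<Sum>l<n. J i l * Y l k) = lam i * Y i k + (\<Sum>l<n. (if l = i then 0 else J i l * Y l k))"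
      proof -
        have "(\<Sum>l<n. J i l * Y l k) = (\<Sum>l<n. (if l = i then J i l * Y l k else 0) + (if l = i then 0 else J i l * Y l k))"
          by (intro sum.cong) auto
        then show ?thesis using ik Jd[of i] by (simp add: sum.distrib)
      qed
      have 2: "(\<Sum>l<n. Y i l * J l k) = lam k * Y i k + (\<Sum>l<n. (if l = k then 0 else Y i l * J l k))"
      proof -
        have "(\<Sum>l<n. Y i l * J l k) = (\<Sum>l<n. (if l = k then Y i l * J l k else 0) + (if l = k then 0 else Y i l * J l k))"
          by (intro sum.cong) auto
        then show ?thesis using ik Jd[of k] by (simp add: sum.distrib mult.commute)
      qed
      have "(T Y - sc \<mu> Y) i k = (lam i - lam k - \<mu>) * Y i k + (\<Sum>l<n. (if l = i then 0 else J i l * Y l k))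
          - (\<Sum>l<n. (if l = k then 0 else Y i l * J l k))"
        using ik 1 2 by (simp add: T_def mm_def sc_def algebra_simps)
      also have "(lam i - lam k - \<mu>) * Y i k = 0" using IH[of i k] by auto
      finally have "(\<Sum>l<n. (if l = i then 0 else J i l * Y l k)) \<noteq> 0 \<or>
          (\<Sum>l<n. (if l = k then 0 else Y i l * J l k)) \<noteq> 0" using nz by auto
      then show ?thesis
      proof
        assume "(\<Sum>l<n. (if l = i then 0 else J i l * Y l k)) \<noteq> 0"
        then obtain l where l: "l < n" "(if l = i then 0 else J i l * Y l k) \<noteq> 0" by (rule sum_neq_zeroE)
        then have "l \<noteq> i" "J i l \<noteq> 0" "Y l k \<noteq> 0" by (auto split: if_splits)
        then show ?thesis using J[of i l] IH[of l k] ik l by auto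
      next
        assume "(\<Sum>l<n. (if l = k then 0 else Y i l * J l k)) \<noteq> 0"
        then obtain l where l: "l < n" "(if l = k then 0 else Y i l * J l k) \<noteq> 0" by (rule sum_neq_zeroE)
        then have "l \<noteq> k" "J l k \<noteq> 0" "Y i l \<noteq> 0" by (auto split: if_splits)
        then show ?thesis using J[of l k] IH[of i l] ik l by auto
      qed
    qed
    then show ?case unfolding funpow.simps(2) comp_apply Y_def by blast
  qed
  \<comment> \<open>By \<open>deg\<close> an entry that survives \<open>d\<close> applications has
    \<open>i + d \<le> k + n < 2 * n\<close>, so \<open>2 * n\<close> applications leave
    nothing.\<close>
  have nil: "((\<lambda>Y. T Y - sc \<mu> Y) ^^ (2 * n)) (Zc \<mu>) = 0" for \<mu>
  proof (intro ext)
    fix i k show "((\<lambda>Y. T Y - sc \<mu> Y) ^^ (2 * n)) (Zc \<mu>) i k = 0 i k"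
      using deg[of "2 * n" \<mu>, rule_format, of i k] unfolding zero_fun_apply by linarith
  qed
  have "Z \<in> U1" using tr unfolding U1_def \<theta>_def T_def by blast
  then have "(\<Sum>\<mu>\<in>S. Zc \<mu>) \<in> U1" by (simp add: ZS)
  then have Zc1: "Zc \<mu> \<in> U1" if "\<mu> \<in> S" for \<mu>
    using V.components_mem[OF U1 inv1 Tadd Tsc finS nil] that by blast
  \<comment> \<open>For nonzero \<mu>, \<open>shift_mem\<close> with eigenvalue 0 lifts
    \<open>T (Zc \<mu>)\<close> in \<open>U0\<close> to \<open>Zc \<mu>\<close> in
    \<open>U0\<close>.\<close>
  have \<theta>Zc: "\<theta> (Zc \<mu>) = 0" if "\<mu> \<in> S" "\<mu> \<noteq> 0" for \<mu>
  proof -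
    have "T (Zc \<mu>) - sc 0 (Zc \<mu>) \<in> U0" using U10[OF Zc1[OF that(1)]] by simp
    then have "Zc \<mu> \<in> U0" using V.shift_mem[OF U0 inv0 Tadd Tsc that(2) nil] by blast
    then have "\<theta> ((T ^^ 0) (Zc \<mu>)) = 0" unfolding U0_def by blast
    then show ?thesis by simp
  qed
  have f0: "f 0 = 0" using f[of 0 0] by (metis add_cancel_left_left)
  have fdiff: "f (x - y) = f x - f y" for x y using f[of "x - y" y] by (simp add: eq_diff_eq)
  have pt: "(f (lam i) - f (lam k)) * Z i k * W k i = (\<Sum>\<mu>\<in>S. f \<mu> * (Zc \<mu> i k * W k i))"
    if "i < n" "k < n" for i k
  proof -
    have "lam i - lam k \<in> S" using that by (auto simp: S_def)
    moreover have "(\<Sum>\<mu>\<in>S. f \<mu> * (Zc \<mu> i k * W k i)) = (\<Sum>\<mu>\<in>S. if \<mu> = lam i - lam k then f \<mu> * (Z i k * W k i) else 0)"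
      using that by (intro sum.cong) (auto simp: Zc_def)
    ultimately show ?thesis using finS by (simp add: fdiff)
  qed
  have "(\<Sum>i<n. \<Sum>k<n. (f (lam i) - f (lam k)) * Z i k * W k i)
      = (\<Sum>i<n. \<Sum>k<n. \<Sum>\<mu>\<in>S. f \<mu> * (Zc \<mu> i k * W k i))"
    by (intro sum.cong) (auto simp: pt)
  also have "\<dots> = (\<Sum>i<n. \<Sum>\<mu>\<in>S. \<Sum>k<n. f \<mu> * (Zc \<mu> i k * W k i))"
    by (intro sum.cong refl sum.swap)
  also have "\<dots> = (\<Sum>\<mu>\<in>S. \<Sum>i<n. \<Sum>k<n. f \<mu> * (Zc \<mu> i k * W k i))" by (rule sum.swap)
  also have "\<dots> = (\<Sum>\<mu>\<in>S. f \<mu> * \<theta> (Zc \<mu>))"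
    by (simp add: \<theta>_def mtrace_mm sum_distrib_left)
  \<comment> \<open>The component for \<mu> = 0 may have nonzero trace against \<open>W\<close>, but
    its weight \<open>f 0\<close> is zero.\<close>
  also have "\<dots> = 0" using \<theta>Zc f0 by (intro sum.neutral) auto
  finally show ?thesis .
qed

section \<open>Jordan normal form over an algebraically closed field\<close>

lemma jordan_matrix_offdiag:
  assumes "i < sum_list (map fst n_as)" "j < sum_list (map fst n_as)" "i \<noteq> j"
    and "jordan_matrix n_as $$ (i, j) \<noteq> 0"
  shows "i < j \<and> jordan_matrix n_as $$ (i, i) = jordan_matrix n_as $$ (j, j)"
  using assms
proof (induction n_as arbitrary: i j)
  case Nil
  then show ?case by simp
next
  case (Cons na n_as)
  obtain m a where na: "na = (m, a)" by force
  let ?s = "sum_list (map fst n_as)"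
  have ent: "jordan_matrix ((m, a) # n_as) $$ (i, j) =
     (if i < m then if j < m then jordan_block m a $$ (i, j) else 0
      else if j < m then 0 else jordan_matrix n_as $$ (i - m, j - m))"
    if "i < m + ?s" "j < m + ?s" for i j
    unfolding jordan_matrix_Cons using that
    by (subst index_mat_four_block) auto
  show ?case
  proof (cases "i < m \<and> j < m")
    case True
    then show ?thesis using Cons.prems ent unfolding na by (auto split: if_splits)
  next
    case False
    then have ge: "m \<le> i" "m \<le> j" using Cons.prems ent unfolding na by (auto split: if_splits)
    have "i - m < ?s" "j - m < ?s" "i - m \<noteq> j - m" "jordan_matrix n_as $$ (i - m, j - m) \<noteq> 0"
      using ge Cons.prems ent[of i j] unfolding na by auto
    from Cons.IH[OF this] show ?thesis using ge Cons.prems ent[of i i] ent[of j j] unfolding na by auto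
  qed
qed

text \<open>Deflation: an eigenvector becomes the first basis vector, which makes the matrix block
  triangular, and the lower right block is treated by induction.\<close>

lemma triangularization_exists:
  fixes A :: "'e::alg_closed_field mat"
  assumes "A \<in> carrier_mat n n"
  shows "\<exists>B. B \<in> carrier_mat n n \<and> upper_triangular B \<and> similar_mat A B"
  using assms
proof (induction n arbitrary: A)
  case 0
  then have "upper_triangular A" by (simp add: upper_triangular_def)
  then show ?case using similar_mat_refl[OF 0] 0 by blast
next
  case (Suc n)
  note A = Suc.prems
  have "degree (char_poly A) > 0" using degree_monic_char_poly[OF A] by simp
  then obtain e where "poly (char_poly A) e = 0" using alg_closed_imp_poly_has_root by blast
  then have "eigenvalue A e" using eigenvalue_root_char_poly[OF A] by blast
  then obtain v where v: "v \<in> carrier_vec (Suc n)" "v \<noteq> 0\<^sub>v (Suc n)" "A *\<^sub>v v = e \<cdot>\<^sub>v v"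
    unfolding eigenvalue_def eigenvector_def using A by auto
  have "\<exists>p<Suc n. v $ p \<noteq> 0" using v(1,2) by (metis carrier_vecD eq_vecI index_zero_vec)
  then obtain p where p: "p < Suc n" "v $ p \<noteq> 0" by blast
  \<comment> \<open>Column 0 is the eigenvector and the other columns are unit vectors. As entry
    \<open>p\<close> of \<open>v\<close> is nonzero, the unit vector with index \<open>p\<close> is
    the one left out; if \<open>p\<close> is not 0, column \<open>p\<close> holds the one with index
    0 instead.\<close>
  define P where "P = mat (Suc n) (Suc n) (\<lambda>(i, j). if j = 0 then v $ i else if i = (if j = p then 0 else j) then 1 else 0)"
  have P: "P \<in> carrier_mat (Suc n) (Suc n)" by (simp add: P_def)
  have "det P \<noteq> 0"
  proof
    assume "det P = 0"
    then obtain x where x: "x \<in> carrier_vec (Suc n)" "x \<noteq> 0\<^sub>v (Suc n)" "P *\<^sub>v x = 0\<^sub>v (Suc n)"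
      using det_0_iff_vec_prod_zero_field[OF P] by blast
    have row: "v $ i * x $ 0 + (\<Sum>j=1..n. (if i = (if j = p then 0 else j) then 1 else 0) * x $ j) = 0" if "i < Suc n" for i
    proof -
      have "(P *\<^sub>v x) $ i = (\<Sum>j<Suc n. P $$ (i, j) * x $ j)"
        using that x(1) P by (simp add: scalar_prod_def atLeast0LessThan)
      also have "\<dots> = P $$ (i, 0) * x $ 0 + (\<Sum>j=1..n. P $$ (i, j) * x $ j)"
        by (simp add: lessThan_Suc_atMost atMost_atLeast0 sum.atLeast_Suc_atMost)
      also have "(\<Sum>j=1..n. P $$ (i, j) * x $ j) = (\<Sum>j=1..n. (if i = (if j = p then 0 else j) then 1 else 0) * x $ j)"
        using that by (intro sum.cong) (auto simp: P_def)
      also have "P $$ (i, 0) = v $ i" using that by (simp add: P_def)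
      finally show ?thesis using x(3) that by simp
    qed
    have "(\<Sum>j=1..n. (if p = (if j = p then 0 else j) then 1 else 0) * x $ j) = 0"
      by (intro sum.neutral) auto
    then have x0: "x $ 0 = 0" using row[OF p(1)] p(2) by simp
    have xk: "x $ k = 0" if k: "1 \<le> k" "k \<le> n" for k
    proof -
      define i where "i = (if k = p then 0 else k)"
      have "(\<Sum>j=1..n. (if i = (if j = p then 0 else j) then 1 else 0) * x $ j) = (\<Sum>j=1..n. if j = k then x $ j else 0)"
        using k by (intro sum.cong) (auto simp: i_def split: if_splits)
      then show ?thesis using row[of i] k x0 by (simp add: i_def split: if_splits)
    qed
    have "x = 0\<^sub>v (Suc n)"
    proof (rule eq_vecI)
      fix k assume "k < dim_vec (0\<^sub>v (Suc n) :: 'e vec)"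
      then show "x $ k = 0\<^sub>v (Suc n) $ k" using x0 xk[of k] by (cases "k = 0") auto
    qed (use x in auto)
    with x(2) show False by simp
  qed
  from det_non_zero_imp_unit[OF P this, of undefined]
  obtain Q where Q: "Q \<in> carrier_mat (Suc n) (Suc n)" "P * Q = 1\<^sub>m (Suc n)" "Q * P = 1\<^sub>m (Suc n)"
    unfolding Units_def ring_mat_def by auto
  define B where "B = Q * A * P"
  have B: "B \<in> carrier_mat (Suc n) (Suc n)" using P Q A by (simp add: B_def)
  have AB: "A = P * B * Q"
  proof -
    have "P * B * Q = P * (Q * A * P) * Q" by (simp add: B_def)
    also have "\<dots> = P * (Q * A) * (P * Q)"
      using P Q A by (simp add: assoc_mult_mat[of _ "Suc n" "Suc n" _ "Suc n" _ "Suc n"])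
    also have "P * (Q * A) = A"
      using P Q A by (metis assoc_mult_mat left_mult_one_mat)
    finally show ?thesis using Q A by simp
  qed
  have simAB: "similar_mat A B" by (rule similar_matI[OF _ Q(2,3) AB]) (use A B P Q in auto)
  have colB: "B $$ (i, 0) = (if i = 0 then e else 0)" if "i < Suc n" for i
  proof -
    have Pv: "P *\<^sub>v unit_vec (Suc n) 0 = v"
      using P v by (intro eq_vecI) (auto simp: P_def)
    have "B *\<^sub>v unit_vec (Suc n) 0 = Q *\<^sub>v (A *\<^sub>v (P *\<^sub>v unit_vec (Suc n) 0))"
      using P Q A unfolding B_def by (simp add: assoc_mult_mat_vec[of _ "Suc n" "Suc n" _ "Suc n"])
    also have "\<dots> = e \<cdot>\<^sub>v (Q *\<^sub>v (P *\<^sub>v unit_vec (Suc n) 0))"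
      unfolding Pv v(3) using Q v by (simp add: mult_mat_vec[of _ "Suc n" "Suc n"])
    also have "Q *\<^sub>v (P *\<^sub>v unit_vec (Suc n) 0) = (Q * P) *\<^sub>v unit_vec (Suc n) 0"
      using P Q by (metis assoc_mult_mat_vec unit_vec_carrier)
    also have "\<dots> = unit_vec (Suc n) 0" unfolding Q(3) by simp
    finally have "(B *\<^sub>v unit_vec (Suc n) 0) $ i = (e \<cdot>\<^sub>v unit_vec (Suc n) 0) $ i" by simp
    then show ?thesis using that B by (simp add: scalar_prod_right_unit split: if_splits)
  qed
  define D where "D = mat n n (\<lambda>(i, j). B $$ (Suc i, Suc j))"
  define r where "r = mat 1 n (\<lambda>(i, j). B $$ (0, Suc j))"
  define a where "a = mat 1 1 (\<lambda>(i, j). e)"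
  have car: "D \<in> carrier_mat n n" "r \<in> carrier_mat 1 n" "a \<in> carrier_mat 1 1"
    by (auto simp: D_def r_def a_def)
  have Bblock: "B = four_block_mat a r (0\<^sub>m n 1) D"
    using B by (intro eq_matI) (auto simp: colB D_def r_def a_def)
  obtain B4 where B4: "B4 \<in> carrier_mat n n" "upper_triangular B4" "similar_mat D B4"
    using Suc.IH[OF car(1)] by blast
  then obtain P4 Q4 where w: "similar_mat_wit D B4 P4 Q4" unfolding similar_mat_def by blast
  note PQ4 = similar_mat_witD2(6,7,1,2,3)[OF car(1) w]
  let ?E = "four_block_mat a (r * P4) (0\<^sub>m n 1) B4"
  let ?P = "four_block_mat (1\<^sub>m 1) (0\<^sub>m 1 n) (0\<^sub>m n 1) P4"
  let ?Q = "four_block_mat (1\<^sub>m 1) (0\<^sub>m 1 n) (0\<^sub>m n 1) Q4"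
  have rP: "r * P4 \<in> carrier_mat 1 n" using car PQ4 by simp
  have 1: "?P * ?Q = 1\<^sub>m (Suc n)" "?Q * ?P = 1\<^sub>m (Suc n)"
    using PQ4(1-4) by (subst mult_four_block_mat[of _ 1 1 _ n _ n _ _ 1 _ n]; simp)+
  have "?P * ?E = four_block_mat a (r * P4) (0\<^sub>m n 1) (P4 * B4)"
    using PQ4(1-4) B4(1) car rP
    by (subst mult_four_block_mat[of _ 1 1 _ n _ n _ _ 1 _ n]; simp)
  also have "\<dots> * ?Q = four_block_mat a (r * P4 * Q4) (0\<^sub>m n 1) (P4 * B4 * Q4)"
    using PQ4(1-4) B4(1) car rP
    by (subst mult_four_block_mat[of _ 1 1 _ n _ n _ _ 1 _ n]; simp)
  also have "r * P4 * Q4 = r" using car PQ4(1-3) by (metis assoc_mult_mat right_mult_one_mat)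
  finally have "B = ?P * ?E * ?Q" unfolding Bblock PQ4(5)[symmetric] by simp
  then have "similar_mat B ?E"
    by (intro similar_matI[OF _ 1]) (use B B4 PQ4 car rP in auto)
  then have "similar_mat A ?E" using simAB similar_mat_trans by blast
  moreover have "upper_triangular ?E"
    by (rule upper_triangular_four_block) (use car B4 in \<open>auto simp: upper_triangular_def\<close>)
  moreover have "?E \<in> carrier_mat (Suc n) (Suc n)" using car B4 by auto
  ultimately show ?case by blast
qed

text \<open>Of the Jordan form only the shape used below is kept: off-diagonal entries of
  \<open>J\<close> lie above the diagonal and join equal eigenvalues.\<close>

lemma jordan_form_exists:
  fixes A :: "nat \<Rightarrow> nat \<Rightarrow> 'e::alg_closed_field"
  assumes A: "msupp n A"
  obtains P Q J where "msupp n P" "msupp n Q" "msupp n J" "mm n P Q = mid n" "mm n Q P = mid n"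
    "A = mm n P (mm n J Q)"
    "\<And>i k. i < n \<Longrightarrow> k < n \<Longrightarrow> i \<noteq> k \<Longrightarrow> J i k \<noteq> 0 \<Longrightarrow> i < k \<and> J i i = J k k"
proof -
  define M where "M = mat n n (\<lambda>(i, j). A i j)"
  have M: "M \<in> carrier_mat n n" by (simp add: M_def)
  obtain B where "B \<in> carrier_mat n n" "upper_triangular B" "similar_mat M B"
    using triangularization_exists[OF M] by blast
  then obtain n_as where "similar_mat M (jordan_matrix n_as)"
    using triangular_to_jnf_vector similar_mat_trans unfolding jordan_nf_def by blast
  then obtain P Q where PQ: "similar_mat_wit M (jordan_matrix n_as) P Q"
    unfolding similar_mat_def by blast
  let ?J = "jordan_matrix n_as"
  have c: "P \<in> carrier_mat n n" "Q \<in> carrier_mat n n" "?J \<in> carrier_mat n n"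
    and e: "P * Q = 1\<^sub>m n" "Q * P = 1\<^sub>m n" "M = P * ?J * Q"
    using PQ M unfolding similar_mat_wit_def Let_def by auto
  have s: "sum_list (map fst n_as) = n" using carrier_matD(1)[OF c(3)] by simp
  define F where "F B = (\<lambda>i j. if i < n \<and> j < n then B $$ (i, j) else 0)" for B :: "'e mat"
  have supp: "msupp n (F B)" for B by (auto simp: F_def msupp_def)
  have Fm: "F (B * C) = mm n (F B) (F C)" if "B \<in> carrier_mat n n" "C \<in> carrier_mat n n" for B C
    using that by (auto simp: F_def mm_def fun_eq_iff scalar_prod_def atLeast0LessThan intro!: sum.cong)
  have F1: "F (1\<^sub>m n) = mid n" by (auto simp: F_def mid_def fun_eq_iff)
  have FM: "F M = A" using A by (auto simp: F_def M_def msupp_def fun_eq_iff)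
  show ?thesis
  proof (rule that[of "F P" "F Q" "F ?J"])
    show "A = mm n (F P) (mm n (F ?J) (F Q))"
      using FM[unfolded e(3) Fm[OF mult_carrier_mat[OF c(1,3)] c(2)] Fm[OF c(1,3)] mm_assoc] by (rule sym)
    show "mm n (F P) (F Q) = mid n" by (simp only: Fm[OF c(1,2), symmetric] e(1) F1)
    show "mm n (F Q) (F P) = mid n" by (simp only: Fm[OF c(2,1), symmetric] e(2) F1)
    show "i < k \<and> F ?J i i = F ?J k k" if "i < n" "k < n" "i \<noteq> k" "F ?J i k \<noteq> 0" for i k
      using jordan_matrix_offdiag[of i n_as k] that s by (auto simp: F_def)
  qed (rule supp)+
qed


section \<open>Lie algebras in characteristic zero and Cartan's nilpotency criterion\<close>

locale lie_alg =
  fixes sc :: "'f::field_char_0 \<Rightarrow> 'v::ab_group_add \<Rightarrow> 'v" and br :: "'v \<Rightarrow> 'v \<Rightarrow> 'v"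
  assumes lie: "lie_algebra sc br" and fin: "fin_dim sc"

sublocale lie_alg \<subseteq> vspace sc
  using lie unfolding lie_algebra_def vspace_def by blast

context lie_alg
begin

lemma br_add_left: "br (x + y) z = br x z + br y z"
  and br_add_right: "br x (y + z) = br x y + br x z"
  and br_scale_left: "br (sc c x) y = sc c (br x y)"
  and br_scale_right: "br x (sc c y) = sc c (br x y)"
  and br_self [simp]: "br x x = 0"
  and jacobi_cyclic: "br x (br y z) + br y (br z x) + br z (br x y) = 0"
  using lie unfolding lie_algebra_def by blast+

lemma br_anti: "br x y = - br y x"
proof -
  have "br (x + y) (x + y) = br x y + br y x"
    by (simp only: br_add_left br_add_right) simp
  then show ?thesis by (simp add: eq_neg_iff_add_eq_0)
qed

lemma br_zero [simp]: "br 0 x = 0" "br x 0 = 0"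
  using br_scale_left[of 0 x x] br_scale_right[of x 0 x] by simp_all

lemma br_neg: "br (- x) y = - br x y" "br x (- y) = - br x y"
  using br_scale_left[of "-1" x y] br_scale_right[of x "-1" y] by simp_all

lemma br_diff_left: "br (x - y) z = br x z - br y z"
  and br_diff_right: "br x (y - z) = br x y - br x z"
  by (simp_all add: diff_conv_add_uminus br_add_left br_add_right br_neg del: add_uminus_conv_diff)

lemma jacobi: "br (br x y) z = br x (br y z) - br y (br x z)"
proof -
  have "br (br x y) z = - br z (br x y)" by (rule br_anti)
  moreover have "br y (br z x) = - br y (br x z)" by (subst br_anti[of z x]) (simp add: br_neg)
  ultimately show ?thesis using jacobi_cyclic[of x y z] by (simp add: add_eq_0_iff algebra_simps)
qed

lemma jacobi': "br x (br y z) = br (br x y) z + br y (br x z)"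
  by (simp add: jacobi)

lemma fdim_UNIV: "fdim UNIV"
  using fin unfolding fin_dim_def fdim_def by auto

lemma fdim_all [simp]: "fdim M"
  using fdim_mono[OF fdim_UNIV] by blast

end

text \<open>Eigenvalues are shown to vanish by a sum of squares, which needs an ordered field; this
  functional carries them to the rationals. It comes from extending \<open>{e}\<close> to a basis
  over the rationals.\<close>

lemma rational_functional:
  fixes e :: "'e::field_char_0"
  assumes "e \<noteq> 0"
  obtains g :: "'e \<Rightarrow> rat" where "\<And>x y. g (x + y) = g x + g y" "\<And>q x. g (of_rat q * x) = q * g x" "g e = 1"
proof -
  interpret vector_space_pair "\<lambda>(q::rat) (x::'e). of_rat q * x" "(*) :: rat \<Rightarrow> rat \<Rightarrow> rat"
    by unfold_locales (auto simp: algebra_simps of_rat_add of_rat_mult)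
  have "\<not> vs1.dependent {e}" using assms by simp
  then obtain g where g: "Vector_Spaces.linear (\<lambda>(q::rat) (x::'e). of_rat q * x) (*) g" "\<forall>x\<in>{e}. g x = 1"
    using linear_independent_extend[of "{e}" "\<lambda>_. 1"] by auto
  show ?thesis
    by (rule that[of g]) (use g linear_add[OF g(1)] linear_scale[OF g(1)] in auto)
qed

lemma mpow_conj:
  assumes "A = mm n P (mm n J Q)" "mm n Q P = mid n" "mm n P Q = mid n" "msupp n Q"
  shows "mpow n A m = mm n P (mm n (mpow n J m) Q)"
proof (induction m)
  case 0
  then show ?case using assms by (simp add: mm_mid)
next
  case (Suc m)
  have "mpow n A (Suc m) = mm n (mm n P (mm n J Q)) (mm n P (mm n (mpow n J m) Q))"
    unfolding mpow.simps Suc using assms(1) by simp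
  also have "\<dots> = mm n P (mm n J (mm n (mm n Q P) (mm n (mpow n J m) Q)))"
    by (simp only: mm_assoc)
  finally have "mpow n A (Suc m) = mm n P (mm n J (mm n (mm n Q P) (mm n (mpow n J m) Q)))" .
  then show ?case using assms by (simp add: mm_mid mm_assoc)
qed

lemma mpow_strictly_upper:
  assumes "\<And>i k. i < n \<Longrightarrow> k < n \<Longrightarrow> J i k \<noteq> 0 \<Longrightarrow> i < k"
  shows "mpow n J m i k \<noteq> 0 \<Longrightarrow> i < n \<and> k < n \<and> i + m \<le> k"
proof (induction m arbitrary: i k)
  case 0
  then show ?case by (auto simp: mid_def split: if_splits)
next
  case (Suc m)
  then have ik: "i < n" "k < n" "(\<Sum>l<n. J i l * mpow n J m l k) \<noteq> 0"
    by (auto simp: mm_def split: if_splits)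
  then obtain l where l: "l < n" "J i l * mpow n J m l k \<noteq> 0" by (blast elim: sum_neq_zeroE)
  then have "J i l \<noteq> 0" "mpow n J m l k \<noteq> 0" by auto
  then show ?case using Suc.IH[of l k] assms[of i l] ik l by auto
qed

context lie_alg
begin

text \<open>Over the algebraic closure, let D be diagonal with entries \<open>f (lam i)\<close> in a
  Jordan basis for \<open>r x\<close>, where \<open>f\<close> is additive. Invariance of the trace
  turns tr(D [l, k]) into tr([D, l] k), which is zero by \<open>jordan_bracket_trace\<close>. As
  \<open>x\<close> is a combination of such brackets, the sum of \<open>f (lam i) * lam i\<close>
  vanishes for every additive \<open>f\<close>, and this forces all eigenvalues to be zero.\<close>

lemma cartan_nilpotent:
  fixes r :: "'v \<Rightarrow> nat \<Rightarrow> nat \<Rightarrow> 'f"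
  assumes radd: "\<And>x y i j. r (x + y) i j = r x i j + r y i j"
    and rsc: "\<And>c x i j. r (sc c x) i j = c * r x i j"
    and rhom: "\<And>x y i j. i < n \<Longrightarrow> j < n \<Longrightarrow>
        r (br x y) i j = (\<Sum>k<n. r x i k * r y k j) - (\<Sum>k<n. r y i k * r x k j)"
    and K: "subspace K" "\<And>l k. k \<in> K \<Longrightarrow> br l k \<in> K"
    and tr: "\<And>k k'. k \<in> K \<Longrightarrow> k' \<in> K \<Longrightarrow> (\<Sum>i<n. \<Sum>j<n. r k i j * r k' j i) = 0"
    and x: "x \<in> span {br l k |l k. k \<in> K}"
  shows "mpow n (\<lambda>i j. if i < n \<and> j < n then r x i j else 0) n = 0"
proof -
  define R :: "'v \<Rightarrow> nat \<Rightarrow> nat \<Rightarrow> 'f alg_closure"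
    where "R y = (\<lambda>i j. if i < n \<and> j < n then to_ac (r y i j) else 0)" for y
  have Rs: "msupp n (R y)" for y by (auto simp: msupp_def R_def)
  have Rbr: "R (br y z) = mm n (R y) (R z) - mm n (R z) (R y)" for y z
    by (auto simp: R_def mm_def fun_eq_iff rhom to_ac_sum)
  have xK: "x \<in> K"
    using x span_minimal[of "{br l k |l k. k \<in> K}" K] K by blast
  obtain P Q J where s: "msupp n P" "msupp n Q" "msupp n J" and PQ: "mm n P Q = mid n" "mm n Q P = mid n"
    and RJ: "R x = mm n P (mm n J Q)"
    and J: "\<And>i k. i < n \<Longrightarrow> k < n \<Longrightarrow> i \<noteq> k \<Longrightarrow> J i k \<noteq> 0 \<Longrightarrow> i < k \<and> J i i = J k k"
    by (rule jordan_form_exists[OF Rs[of x]]) blast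
  define Z where "Z y = mm n Q (mm n (R y) P)" for y
  have Zs: "msupp n (Z y)" for y by (simp add: Z_def)
  have collapse: "mm n P (mm n Q B) = B" "mm n Q (mm n P B) = B" if "msupp n B" for B
    using that by (simp_all add: PQ mm_mid flip: mm_assoc)
  have Zx: "Z x = J"
    unfolding Z_def RJ by (simp add: mm_assoc PQ collapse mm_mid s)
  have Zbr: "Z (br y z) = mm n (Z y) (Z z) - mm n (Z z) (Z y)" for y z
    unfolding Z_def Rbr by (simp add: mm_diff mm_assoc collapse)
  have Zadd: "Z (y + z) i j = Z y i j + Z z i j" for y z i j
    by (auto simp: Z_def mm_def R_def radd algebra_simps sum.distrib)
  have Zsc: "Z (sc c y) i j = to_ac c * Z y i j" for c y i j
    by (auto simp: Z_def mm_def R_def rsc algebra_simps sum_distrib_left)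
  define T where "T = (\<lambda>Y. mm n J Y - mm n Y J)"
  have TZ: "(T ^^ m) (Z y) = Z ((br x ^^ m) y)" for m y
    by (induction m) (auto simp: T_def Zbr Zx)
  \<comment> \<open>The form is assumed to vanish only on \<open>K\<close>, but \<open>x\<close>
    lies in \<open>K\<close>, so every positive power of \<open>ad x\<close> maps \<open>L\<close>
    into \<open>K\<close>.\<close>
  have "br x y \<in> K" for y
    using subspace_neg[OF K(1) K(2)[OF xK, of y]] br_anti[of x y] by simp
  then have powK: "(br x ^^ Suc m) y \<in> K" for m y by simp
  have trZ: "mtrace n (mm n (Z y) (Z z)) = to_ac (\<Sum>i<n. \<Sum>j<n. r y i j * r z j i)" for y z
  proof -
    have "mtrace n (mm n (Z y) (Z z)) = mtrace n (mm n Q (mm n (R y) (mm n (R z) P)))"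
      unfolding Z_def by (simp add: mm_assoc collapse)
    also have "\<dots> = mtrace n (mm n (R y) (R z))"
      by (subst mtrace_commute) (simp add: mm_assoc PQ mm_mid Rs)
    finally show ?thesis by (simp add: mtrace_mm R_def to_ac_sum)
  qed
  define lam where "lam i = J i i" for i
  have key: "(\<Sum>i<n. f (lam i) * lam i) = 0"
    if f: "\<And>u v. f (u + v) = f u + f v" for f :: "'f alg_closure \<Rightarrow> 'f alg_closure"
  proof -
    \<comment> \<open>The trace of \<open>Z y\<close> against the diagonal matrix of the
      \<open>f (lam i)\<close>. It is linear over the base field, so it vanishes at \<open>x\<close>
      once it vanishes on the brackets.\<close>
    define G where "G y = (\<Sum>i<n. f (lam i) * Z y i i)" for y
    have Gadd: "G (y + z) = G y + G z" and Gsc: "G (sc c y) = to_ac c * G y" for y z c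
      by (simp_all add: G_def Zadd Zsc algebra_simps sum.distrib sum_distrib_left)
    have "G (br l k) = 0" if k: "k \<in> K" for l k
    proof -
      have "mtrace n (mm n (((\<lambda>Y. mm n J Y - mm n Y J) ^^ Suc j) (Z l)) (Z k)) = 0" for j
        using tr[OF powK[of j l] k] unfolding T_def[symmetric] TZ trZ by simp
      then have 0: "(\<Sum>i<n. \<Sum>j<n. (f (lam i) - f (lam j)) * Z l i j * Z k j i) = 0"
        by (intro jordan_bracket_trace[where J = J]) (use J f Zs in \<open>auto simp: lam_def\<close>)
      have "G (br l k) = (\<Sum>i<n. f (lam i) * (mm n (Z l) (Z k) i i - mm n (Z k) (Z l) i i))"
        unfolding G_def Zbr by simp
      also have "\<dots> = (\<Sum>i<n. \<Sum>j<n. f (lam i) * (Z l i j * Z k j i)) - (\<Sum>i<n. \<Sum>j<n. f (lam i) * (Z k i j * Z l j i))"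
        by (simp add: mm_def algebra_simps sum_subtractf sum_distrib_left)
      also have "(\<Sum>i<n. \<Sum>j<n. f (lam i) * (Z k i j * Z l j i)) = (\<Sum>i<n. \<Sum>j<n. f (lam j) * (Z l i j * Z k j i))"
        by (subst sum.swap) (simp add: mult.commute)
      finally show ?thesis using 0 by (simp add: algebra_simps sum_subtractf)
    qed
    moreover have "subspace {y. G y = 0}"
      using Gsc[of 0 0] by (intro subspaceI) (auto simp: Gadd Gsc)
    ultimately have "span {br l k |l k. k \<in> K} \<subseteq> {y. G y = 0}" by (intro span_minimal) auto
    then have "G x = 0" using x by auto
    then show ?thesis by (simp add: G_def Zx lam_def)
  qed
  have lam0: "lam i = 0" if i: "i < n" for i
  proof (rule ccontr)
    assume "lam i \<noteq> 0"
    then obtain g :: "'f alg_closure \<Rightarrow> rat" where g: "\<And>x y. g (x + y) = g x + g y"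
        "\<And>q x. g (of_rat q * x) = q * g x" "g (lam i) = 1"
      by (rule rational_functional) blast
    have g0: "g 0 = 0" using g(2)[of 0 0] by simp
    have gsum: "g (\<Sum>j\<in>A. h j) = (\<Sum>j\<in>A. g (h j))" for A and h :: "nat \<Rightarrow> 'f alg_closure"
      by (induction A rule: infinite_finite_induct) (auto simp: g g0)
    \<comment> \<open>With \<open>f\<close> rational valued, applying \<open>g\<close> once more
      turns the identity into a sum of rational squares.\<close>
    have "(\<Sum>j<n. of_rat (g (lam j)) * lam j) = 0"
      by (rule key) (simp add: g of_rat_add)
    then have "g (\<Sum>j<n. of_rat (g (lam j)) * lam j) = 0" using g0 by simp
    then have "(\<Sum>j<n. g (lam j) * g (lam j)) = 0" by (simp add: gsum g)
    then have "\<forall>j\<in>{..<n}. g (lam j) * g (lam j) = 0"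
      by (subst (asm) sum_nonneg_eq_0_iff) auto
    then have "g (lam i) = 0" using i by simp
    with g(3) show False by simp
  qed
  have upper: "i < k" if "i < n" "k < n" "J i k \<noteq> 0" for i k
    using J[of i k] lam0[of i] that by (cases "i = k") (auto simp: lam_def)
  have Jn: "mpow n J n = 0"
  proof (intro ext)
    fix i k show "mpow n J n i k = 0 i k"
      using mpow_strictly_upper[of n J n i k] upper by fastforce
  qed
  have "mpow n (R x) n = 0"
    unfolding mpow_conj[OF RJ PQ(2,1) s(2)] Jn by (auto simp: mm_def fun_eq_iff)
  moreover have "mpow n (R x) m i j = to_ac (mpow n (\<lambda>i j. if i < n \<and> j < n then r x i j else 0) m i j)" for m i j
    by (induction m arbitrary: i j) (auto simp: mid_def mm_def R_def to_ac_sum)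
  ultimately show ?thesis by (simp add: fun_eq_iff)
qed

end


section \<open>Engel's theorem\<close>

context lie_alg
begin

definition lsub :: "'v set \<Rightarrow> bool" where
  "lsub U \<longleftrightarrow> subspace U \<and> (\<forall>x\<in>U. \<forall>y\<in>U. br x y \<in> U)"

definition lideal :: "'v set \<Rightarrow> bool" where
  "lideal I \<longleftrightarrow> subspace I \<and> (\<forall>x. \<forall>y\<in>I. br x y \<in> I)"

lemma lidealD: "lideal I \<Longrightarrow> subspace I" "lideal I \<Longrightarrow> y \<in> I \<Longrightarrow> br x y \<in> I"
  "lideal I \<Longrightarrow> y \<in> I \<Longrightarrow> br y x \<in> I"
  unfolding lideal_def using br_anti[of y x] subspace_neg[of I "br x y"] by auto

lemma lsubD: "lsub U \<Longrightarrow> subspace U" "lsub U \<Longrightarrow> x \<in> U \<Longrightarrow> y \<in> U \<Longrightarrow> br x y \<in> U"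
  by (auto simp: lsub_def)

lemma lideal_lsub: "lideal I \<Longrightarrow> lsub I"
  by (auto simp: lideal_def lsub_def)

text \<open>The normalizer condition of nilpotent algebras, for \<open>N / C\<close>. It is what
  makes maximal subalgebras have codimension one.\<close>

definition has_normalizers :: "'v set \<Rightarrow> 'v set \<Rightarrow> bool" where
  "has_normalizers N C \<longleftrightarrow> (\<forall>U U'. lsub U \<and> lsub U' \<and> C \<subseteq> U' \<and> U' \<subset> U \<and> U \<subseteq> N \<longrightarrow>
     (\<exists>y\<in>U - U'. \<forall>u\<in>U'. br u y \<in> U'))"

text \<open>A maximal proper subalgebra \<open>V\<close> of \<open>U\<close> above \<open>C\<close>
  is normalized by some \<open>y\<close> outside it, so \<open>U = V + Fy\<close>. The vectors that
  \<open>V\<close> sends into \<open>P\<close> are stable under \<open>y\<close>, and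
  \<open>y\<close> is nilpotent modulo \<open>P\<close>; the last iterate of such a vector that
  stays outside \<open>P\<close> is sent into \<open>P\<close> by all of \<open>U\<close>.\<close>

lemma engel_aux:
  fixes act :: "'v \<Rightarrow> 'w::ab_group_add \<Rightarrow> 'w" and sw :: "'f \<Rightarrow> 'w \<Rightarrow> 'w"
  assumes W: "vspace sw"
    and N: "lsub N" "has_normalizers N C" "C \<subseteq> N" "lsub C"
    and act: "\<And>x u v. x \<in> N \<Longrightarrow> u \<in> M \<Longrightarrow> v \<in> M \<Longrightarrow> act x (u + v) = act x u + act x v"
      "\<And>x y m. x \<in> N \<Longrightarrow> y \<in> N \<Longrightarrow> m \<in> M \<Longrightarrow> act (x + y) m = act x m + act y m"
      "\<And>k x m. x \<in> N \<Longrightarrow> m \<in> M \<Longrightarrow> act (sc k x) m = sw k (act x m)"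
      "\<And>x y m. x \<in> N \<Longrightarrow> y \<in> N \<Longrightarrow> m \<in> M \<Longrightarrow> act (br x y) m = act x (act y m) - act y (act x m)"
    and M: "\<And>x m. x \<in> N \<Longrightarrow> m \<in> M \<Longrightarrow> act x m \<in> M"
    and P: "module.subspace sw P" "P \<subset> M" "\<And>x m. x \<in> N \<Longrightarrow> m \<in> P \<Longrightarrow> act x m \<in> P"
    and nil: "\<And>x. x \<in> N \<Longrightarrow> \<exists>k. \<forall>m\<in>M. (act x ^^ k) m \<in> P"
    and C: "\<And>x m. x \<in> C \<Longrightarrow> m \<in> M \<Longrightarrow> act x m \<in> P"
  shows "lsub U \<Longrightarrow> C \<subseteq> U \<Longrightarrow> U \<subseteq> N \<Longrightarrow> \<exists>m\<in>M - P. \<forall>x\<in>U. act x m \<in> P"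
proof (induction "dim U" arbitrary: U rule: less_induct)
  case less
  interpret W: vspace sw by (rule W)
  show ?case
  proof (cases "U = C")
    case True
    then show ?thesis using P(2) C by blast
  next
    case False
    define S where "S V \<longleftrightarrow> lsub V \<and> C \<subseteq> V \<and> V \<subset> U" for V
    have "S C" using False less.prems N unfolding S_def by blast
    then obtain V where V: "S V" "\<And>V'. S V' \<Longrightarrow> V \<subseteq> V' \<Longrightarrow> V' = V"
      by (rule maximal_subspace[where M = U]) (auto simp: S_def lsub_def)
    note v = V(1)[unfolded S_def]
    have "\<exists>y\<in>U - V. \<forall>u\<in>V. br u y \<in> V"
      using N(2)[unfolded has_normalizers_def, rule_format, of U V] v less.prems by simp
    then obtain y where y: "y \<in> U" "y \<notin> V" "\<And>u. u \<in> V \<Longrightarrow> br u y \<in> V" by blast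
    let ?Y = "V \<boxplus> span {y}"
    have subY: "subspace ?Y" using v by (intro subspace_ssum) (auto simp: lsub_def)
    have VY: "V \<subseteq> ?Y" by (rule ssum_left) simp
    have yY: "y \<in> ?Y" using ssum_right[of V "span {y}"] v span_base[of y "{y}"] unfolding lsub_def by blast
    have YU: "?Y \<subseteq> U"
      using v less.prems(1) y(1) span_minimal[of "{y}" U] by (intro ssum_least) (auto simp: lsub_def)
    have "br a b \<in> ?Y" if ab: "a \<in> ?Y" "b \<in> ?Y" for a b
    proof -
      obtain u k where a: "u \<in> V" "a = u + sc k y" using ab(1) by (auto elim!: ssumE simp: span_singleton)
      obtain u' k' where b: "u' \<in> V" "b = u' + sc k' y" using ab(2) by (auto elim!: ssumE simp: span_singleton)
      have "br a b = br u u' + sc k' (br u y) - sc k (br u' y)"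
        unfolding a(2) b(2) using br_anti[of y u'] by (simp add: br_add_left br_add_right br_scale_left br_scale_right)
      moreover have "\<dots> \<in> V" using v a b y(3) unfolding lsub_def
        by (intro subspace_diff subspace_add subspace_scale) auto
      ultimately show ?thesis using VY by auto
    qed
    then have "lsub ?Y" using subY by (auto simp: lsub_def)
    then have YeqU: "?Y = U" using V(2)[of ?Y] VY YU yY y(2) v unfolding S_def by blast
    have "dim V < dim U" using v less.prems(1) by (intro dim_strict_mono) (auto simp: lsub_def)
    then obtain m0 where m0: "m0 \<in> M" "m0 \<notin> P" "\<forall>x\<in>V. act x m0 \<in> P"
      using less.hyps[of V] v less.prems by blast
    have yN: "y \<in> N" using y less.prems by blast
    obtain k where k: "\<forall>m\<in>M. (act y ^^ k) m \<in> P" using nil[OF yN] by blast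
    have powM: "(act y ^^ j) m0 \<in> M" for j by (induction j) (auto simp: m0 M yN)
    have powV: "\<forall>u\<in>V. act u ((act y ^^ j) m0) \<in> P" for j
    proof (induction j)
      case 0
      then show ?case using m0 by simp
    next
      case (Suc j)
      show ?case
      proof
        fix u assume u: "u \<in> V"
        then have uN: "u \<in> N" using v less.prems by blast
        let ?m = "(act y ^^ j) m0"
        have "act u (act y ?m) = act (br u y) ?m + act y (act u ?m)"
          using act(4)[OF uN yN powM[of j]] by simp
        moreover have "act (br u y) ?m \<in> P" "act y (act u ?m) \<in> P"
          using Suc y(3)[OF u] u P(3)[OF yN] by auto
        ultimately show "act u ((act y ^^ Suc j) m0) \<in> P" using W.subspace_add[OF P(1)] by simp
      qed
    qed
    define j where "j = (LEAST j. (act y ^^ j) m0 \<in> P)"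
    have jP: "(act y ^^ j) m0 \<in> P" unfolding j_def by (rule LeastI[of _ k]) (use k m0 in blast)
    then have "j \<noteq> 0" using m0(2) by (cases j) auto
    then obtain i where i: "j = Suc i" by (cases j) auto
    have "(act y ^^ i) m0 \<notin> P" using not_less_Least[of i "\<lambda>j. (act y ^^ j) m0 \<in> P"] i j_def by auto
    moreover have "act x ((act y ^^ i) m0) \<in> P" if x: "x \<in> U" for x
    proof -
      obtain u k where a: "u \<in> V" "x = u + sc k y"
        using x unfolding YeqU[symmetric] by (auto elim!: ssumE simp: span_singleton)
      have "u \<in> N" "sc k y \<in> N" using a v less.prems yN N(1) subspace_scale by (auto simp: lsub_def)
      then have "act x ((act y ^^ i) m0) = act u ((act y ^^ i) m0) + sw k (act y ((act y ^^ i) m0))"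
        unfolding a(2) using act(2,3) powM[of i] yN by simp
      then show ?thesis
        using powV[of i] a(1) jP i W.subspace_add[OF P(1)] W.subspace_scale[OF P(1)] by simp
    qed
    ultimately show ?thesis using powM[of i] by blast
  qed
qed

text \<open>The two halves of Engel's theorem feed each other: \<open>U'\<close> acts on
  \<open>U / U'\<close>, where \<open>engel_aux\<close> finds the normalizing \<open>y\<close>, and
  the normalizer condition it needs inside \<open>U'\<close> concerns subalgebras of smaller
  dimension.\<close>

lemma has_normalizersI:
  assumes N: "lsub N" and C: "lsub C" "C \<subseteq> N" "\<And>x c. x \<in> N \<Longrightarrow> c \<in> C \<Longrightarrow> br x c \<in> C"
    and nil: "\<And>x. x \<in> N \<Longrightarrow> \<exists>k. \<forall>y\<in>N. (br x ^^ k) y \<in> C"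
  shows "has_normalizers N C"
proof -
  have "\<exists>y\<in>U - U'. \<forall>u\<in>U'. br u y \<in> U'"
    if "lsub U" "lsub U'" "C \<subseteq> U'" "U' \<subset> U" "U \<subseteq> N" for U U'
    using that
  proof (induction "dim U'" arbitrary: U U' rule: less_induct)
    case less
    have "has_normalizers U' C" unfolding has_normalizers_def
    proof (intro allI impI)
      fix V V' assume a: "lsub V \<and> lsub V' \<and> C \<subseteq> V' \<and> V' \<subset> V \<and> V \<subseteq> U'"
      then have "dim V' < dim U'" using less.prems by (intro dim_strict_mono) (auto simp: lsub_def)
      then show "\<exists>y\<in>V - V'. \<forall>u\<in>V'. br u y \<in> V'" using less.hyps[of V' V] a less.prems by blast
    qed
    then show ?case
    proof (rule engel_aux[OF vspace_axioms less.prems(2), where M = U and U = U'])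
      show "subspace U'" using less.prems by (simp add: lsub_def)
      show "\<exists>k. \<forall>m\<in>U. (br x ^^ k) m \<in> U'" if "x \<in> U'" for x
        using nil[of x] that less.prems by blast
      show "br c m \<in> U'" if "c \<in> C" "m \<in> U" for c m
      proof -
        have "br m c \<in> C" using C(3) that less.prems by blast
        then have "- br m c \<in> C" using C(1) subspace_neg by (auto simp: lsub_def)
        then show ?thesis using less.prems br_anti[of c m] by auto
      qed
    qed (use less.prems C in \<open>auto simp: lsub_def br_add_left br_add_right br_scale_left jacobi\<close>)
  qed
  then show ?thesis unfolding has_normalizers_def by blast
qed

theorem engel:
  fixes act :: "'v \<Rightarrow> 'w::ab_group_add \<Rightarrow> 'w" and sw :: "'f \<Rightarrow> 'w \<Rightarrow> 'w"
  assumes W: "vspace sw"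
    and N: "lsub N"
    and act: "\<And>x u v. x \<in> N \<Longrightarrow> u \<in> M \<Longrightarrow> v \<in> M \<Longrightarrow> act x (u + v) = act x u + act x v"
      "\<And>x y m. x \<in> N \<Longrightarrow> y \<in> N \<Longrightarrow> m \<in> M \<Longrightarrow> act (x + y) m = act x m + act y m"
      "\<And>k x m. x \<in> N \<Longrightarrow> m \<in> M \<Longrightarrow> act (sc k x) m = sw k (act x m)"
      "\<And>x y m. x \<in> N \<Longrightarrow> y \<in> N \<Longrightarrow> m \<in> M \<Longrightarrow> act (br x y) m = act x (act y m) - act y (act x m)"
    and M: "module.subspace sw M" "\<And>x m. x \<in> N \<Longrightarrow> m \<in> M \<Longrightarrow> act x m \<in> M"
    and P: "module.subspace sw P" "P \<subset> M" "\<And>x m. x \<in> N \<Longrightarrow> m \<in> P \<Longrightarrow> act x m \<in> P"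
    and nil: "\<And>x. x \<in> N \<Longrightarrow> \<exists>k. \<forall>m\<in>M. (act x ^^ k) m \<in> P"
  shows "\<exists>m\<in>M - P. \<forall>x\<in>N. act x m \<in> P"
proof -
  interpret W: vspace sw by (rule W)
  \<comment> \<open>The kernel of the action on \<open>M / P\<close>. Nilpotency of
    \<open>act x\<close> passes to \<open>ad x\<close> only modulo this kernel.\<close>
  define C where "C = {x \<in> N. \<forall>m\<in>M. act x m \<in> P}"
  have diff: "act x (u - v) = act x u - act x v" if "x \<in> N" "u \<in> M" "v \<in> M" for x u v
    using act(1)[OF that(1), of "u - v" v] W.subspace_diff[OF M(1)] that by (simp add: eq_diff_eq)
  have CN: "br x c \<in> C" if "x \<in> N" "c \<in> C" for x c
    using that act(4) M(2) P(3) W.subspace_diff[OF P(1)] lsubD(2)[OF N] unfolding C_def by auto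
  have C: "lsub C" unfolding lsub_def
  proof (intro conjI ballI)
    have "act 0 m = 0" if "m \<in> M" for m using act(3)[of 0 m 0] subspace_0[OF lsubD(1)[OF N]] that by simp
    then show "subspace C"
      using lsubD(1)[OF N] act(2,3) W.subspace_add[OF P(1)] W.subspace_scale[OF P(1)] W.subspace_0[OF P(1)]
      by (intro subspaceI) (auto simp: C_def subspace_0 subspace_add subspace_scale)
  qed (use CN in \<open>auto simp: C_def\<close>)
  have nilC: "\<exists>k. \<forall>y\<in>N. (br x ^^ k) y \<in> C" if x: "x \<in> N" for x
  proof -
    obtain s where s: "\<And>m. m \<in> M \<Longrightarrow> (act x ^^ s) m \<in> P" using nil[OF x] by blast
    have powM: "m \<in> M \<Longrightarrow> (act x ^^ j) m \<in> M" for j m by (induction j) (auto simp: M x)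
    have powP: "m \<in> P \<Longrightarrow> (act x ^^ j) m \<in> P" for j m by (induction j) (auto simp: P x)
    have s': "(act x ^^ j) m \<in> P" if "m \<in> M" "j \<ge> s" for j m
      using powP[OF s[OF that(1)], of "j - s"] that(2) by (simp flip: funpow_add[THEN fun_cong, unfolded comp_apply])
    have powdiff: "(act x ^^ j) (u - v) = (act x ^^ j) u - (act x ^^ j) v" if "u \<in> M" "v \<in> M" for j u v
      using that by (induction j) (auto simp: diff x powM)
    have powN: "y \<in> N \<Longrightarrow> (br x ^^ k) y \<in> N" for k y by (induction k) (auto simp: x lsubD(2)[OF N])
    \<comment> \<open>By the derivation rule \<open>(ad x)^k y\<close> acts as a combination of
      \<open>x^a y x^b\<close> with \<open>a + b = k\<close>. Once \<open>a + b\<close> reaches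
      \<open>2 * s\<close>, one of the outer powers sends \<open>M\<close> into \<open>P\<close>.
      The exponents \<open>a\<close> and \<open>b\<close> are there for the induction.\<close>
    have "(act x ^^ a) (act ((br x ^^ k) y) ((act x ^^ b) m)) \<in> P"
      if "y \<in> N" "m \<in> M" "2 * s \<le> a + b + k" for k a b y m
      using that
    proof (induction k arbitrary: a b)
      case 0
      show ?case
      proof (cases "s \<le> b")
        case True
        then show ?thesis using s'[OF 0(2) True] P(3)[OF 0(1)] powP by simp
      next
        case False
        then have "s \<le> a" using 0 by simp
        then show ?thesis using s' M(2)[OF 0(1) powM[OF 0(2)]] by simp
      qed
    next
      case (Suc k)
      let ?z = "(br x ^^ k) y" and ?m = "(act x ^^ b) m"
      note zN = powN[OF Suc.prems(1), of k] and mM = powM[OF Suc.prems(2), of b]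
      have "act ((br x ^^ Suc k) y) ?m = act x (act ?z ?m) - act ?z (act x ?m)"
        using act(4)[OF x zN mM] by simp
      then have "(act x ^^ a) (act ((br x ^^ Suc k) y) ?m)
          = (act x ^^ Suc a) (act ?z ?m) - (act x ^^ a) (act ?z ((act x ^^ Suc b) m))"
        using powdiff M(2)[OF x M(2)[OF zN mM]] M(2)[OF zN M(2)[OF x mM]] by (simp add: funpow_swap1)
      moreover have "(act x ^^ Suc a) (act ?z ?m) \<in> P" by (rule Suc.IH) (use Suc.prems in auto)
      moreover have "(act x ^^ a) (act ?z ((act x ^^ Suc b) m)) \<in> P" by (rule Suc.IH) (use Suc.prems in auto)
      ultimately show ?case using W.subspace_diff[OF P(1)] by simp
    qed
    from this[of _ _ 0 0 "2 * s"] have "\<forall>y\<in>N. (br x ^^ (2 * s)) y \<in> C"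
      using powN unfolding C_def by simp
    then show ?thesis by blast
  qed
  have CsubN: "C \<subseteq> N" by (auto simp: C_def)
  have hn: "has_normalizers N C" by (rule has_normalizersI[OF N C CsubN CN nilC])
  show ?thesis
    by (rule engel_aux[OF W N hn CsubN C act M(2) P nil _ N CsubN order_refl]) (auto simp: C_def)
qed

end


section \<open>Modules and trace forms\<close>

text \<open>A Lie algebra acting on the quotient \<open>M / P\<close>.  The action is only required to be linear in
  the algebra on \<open>M\<close>, since the modules of linear maps below live in a full function type.\<close>

locale lie_mod = lie_alg sc br + W: vspace sw
  for sc :: "'f::field_char_0 \<Rightarrow> 'v::ab_group_add \<Rightarrow> 'v" and br :: "'v \<Rightarrow> 'v \<Rightarrow> 'v"
    and sw :: "'f \<Rightarrow> 'w::ab_group_add \<Rightarrow> 'w" +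
  fixes act :: "'v \<Rightarrow> 'w \<Rightarrow> 'w" and M P :: "'w set"
  assumes act_add: "act x (u + v) = act x u + act x v"
    and act_scale: "act x (sw k u) = sw k (act x u)"
    and act_add_left: "m \<in> M \<Longrightarrow> act (x + y) m = act x m + act y m"
    and act_scale_left: "m \<in> M \<Longrightarrow> act (sc k x) m = sw k (act x m)"
    and act_br: "m \<in> M \<Longrightarrow> act (br x y) m = act x (act y m) - act y (act x m)"
    and M: "W.subspace M" "W.fdim M" "m \<in> M \<Longrightarrow> act x m \<in> M"
    and P: "W.subspace P" "P \<subseteq> M" "m \<in> P \<Longrightarrow> act x m \<in> P"
begin

lemma act_zero: "act x 0 = 0"
  using act_scale[of x 0 0] by simp

lemma act_diff: "act x (u - v) = act x u - act x v"
  using act_add[of x "u - v" v] by (simp add: eq_diff_eq)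

lemma act_sum: "act x (\<Sum>i\<in>A. h i) = (\<Sum>i\<in>A. act x (h i))"
  by (induction A rule: infinite_finite_induct) (auto simp: act_zero act_add)

lemma act_zero_left: "m \<in> M \<Longrightarrow> act 0 m = 0"
  using act_scale_left[of m 0 0] by simp

lemma act_diff_left: "m \<in> M \<Longrightarrow> act (x - y) m = act x m - act y m"
  using act_add_left[of m "x - y" y] by (simp add: eq_diff_eq)

definition irreducible :: bool where
  "irreducible \<longleftrightarrow> P \<noteq> M \<and> (\<forall>N. W.subspace N \<and> P \<subseteq> N \<and> N \<subseteq> M \<and> (\<forall>x. \<forall>m\<in>N. act x m \<in> N) \<longrightarrow> N = P \<or> N = M)"

lemma irreducibleD:
  assumes irreducible "W.subspace N" "P \<subseteq> N" "N \<subseteq> M" "\<And>x m. m \<in> N \<Longrightarrow> act x m \<in> N"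
  shows "N = P \<or> N = M"
  using assms unfolding irreducible_def by blast

text \<open>By Engel's theorem some vector outside \<open>P\<close> is sent into \<open>P\<close> by
  all of \<open>N\<close>. Since \<open>N\<close> is an ideal, the vectors with that property form a
  submodule, and irreducibility leaves only \<open>M\<close>.\<close>

lemma nilpotent_ideal_trivial:
  assumes irr: irreducible and N: "lideal N"
    and nil: "\<And>x. x \<in> N \<Longrightarrow> \<exists>k. \<forall>m\<in>M. (act x ^^ k) m \<in> P"
    and x: "x \<in> N" and m: "m \<in> M"
  shows "act x m \<in> P"
proof -
  define Q where "Q = {m \<in> M. \<forall>x\<in>N. act x m \<in> P}"
  have PM: "P \<subset> M" using irr P(2) unfolding irreducible_def by blast
  have "\<exists>m\<in>M - P. \<forall>x\<in>N. act x m \<in> P"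
    by (rule engel[OF W.vspace_axioms lideal_lsub[OF N]])
       (use act_add act_add_left act_scale_left act_br M P PM nil in auto)
  then have "Q \<noteq> P" unfolding Q_def by blast
  moreover have "Q = P \<or> Q = M"
  proof (rule irreducibleD[OF irr])
    show "W.subspace Q"
      using M P unfolding Q_def
      by (intro W.subspaceI) (auto simp: act_zero act_add act_scale W.subspace_0 W.subspace_add W.subspace_scale)
    show "P \<subseteq> Q" using P by (auto simp: Q_def)
    show "Q \<subseteq> M" by (auto simp: Q_def)
    show "act y m \<in> Q" if m: "m \<in> Q" for y m
    proof -
      have "act x (act y m) \<in> P" if x: "x \<in> N" for x
      proof -
        have "act x (act y m) = act (br x y) m + act y (act x m)" using m act_br by (simp add: Q_def)
        then show ?thesis using m x lidealD(3)[OF N x, of y] P W.subspace_add[OF P(1)] by (simp add: Q_def)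
      qed
      then show ?thesis using m M(3) by (auto simp: Q_def)
    qed
  qed
  ultimately show ?thesis using x m by (auto simp: Q_def)
qed

end

section \<open>The trace form of a module in coordinates\<close>

locale lie_mod_coord = lie_mod sc br sw act M P
  for sc :: "'f::field_char_0 \<Rightarrow> 'v::ab_group_add \<Rightarrow> 'v" and br :: "'v \<Rightarrow> 'v \<Rightarrow> 'v"
    and sw :: "'f \<Rightarrow> 'w::ab_group_add \<Rightarrow> 'w" and act :: "'v \<Rightarrow> 'w \<Rightarrow> 'w" and M P :: "'w set" +
  fixes n :: nat and b :: "nat \<Rightarrow> 'w" and c :: "nat \<Rightarrow> 'w \<Rightarrow> 'f"
  assumes b: "i < n \<Longrightarrow> b i \<in> M"
    and c_add: "c i (u + v) = c i u + c i v"
    and c_scale: "c i (sw k v) = k * c i v"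
    and c_P: "i < n \<Longrightarrow> p \<in> P \<Longrightarrow> c i p = 0"
    and c_b: "i < n \<Longrightarrow> j < n \<Longrightarrow> c i (b j) = (if i = j then 1 else 0)"
    and c_decomp: "v \<in> M \<Longrightarrow> v - (\<Sum>i<n. sw (c i v) (b i)) \<in> P"
begin

definition rep :: "'v \<Rightarrow> nat \<Rightarrow> nat \<Rightarrow> 'f" where
  "rep x = (\<lambda>i j. if i < n \<and> j < n then c i (act x (b j)) else 0)"

definition tform :: "'v \<Rightarrow> 'v \<Rightarrow> 'f" where
  "tform x y = mtrace n (mm n (rep x) (rep y))"

definition trad :: "'v set" where
  "trad = {k. \<forall>l. tform k l = 0}"

lemma c_zero: "c i 0 = 0"
  using c_scale[of i 0 0] by simp

lemma c_diff: "c i (u - v) = c i u - c i v"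
  using c_add[of i "u - v" v] by (simp add: eq_diff_eq)

lemma c_sum: "c i (\<Sum>j\<in>A. h j) = (\<Sum>j\<in>A. c i (h j))"
  by (induction A rule: infinite_finite_induct) (auto simp: c_zero c_add)

lemma c_eq_zeroD:
  assumes "v \<in> M" "\<And>i. i < n \<Longrightarrow> c i v = 0"
  shows "v \<in> P"
  using c_decomp[OF assms(1)] assms(2) by simp

lemma c_act:
  assumes i: "i < n" and m: "m \<in> M"
  shows "c i (act x m) = (\<Sum>k<n. rep x i k * c k m)"
proof -
  let ?s = "\<Sum>k<n. sw (c k m) (b k)"
  have "c i (act x (m - ?s)) = 0" using c_decomp[OF m] P(3) c_P[OF i] by blast
  then have "c i (act x m) = c i (act x ?s)" by (simp add: act_diff c_diff)
  also have "\<dots> = (\<Sum>k<n. c k m * c i (act x (b k)))"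
    by (simp add: act_sum act_scale c_sum c_scale)
  also have "\<dots> = (\<Sum>k<n. rep x i k * c k m)" using i by (intro sum.cong) (auto simp: rep_def)
  finally show ?thesis .
qed

lemma rep_add: "rep (x + y) i j = rep x i j + rep y i j"
  by (auto simp: rep_def act_add_left b c_add)

lemma rep_scale: "rep (sc k x) i j = k * rep x i j"
  by (auto simp: rep_def act_scale_left b c_scale)

lemma rep_br: "rep (br x y) = mm n (rep x) (rep y) - mm n (rep y) (rep x)"
proof (intro ext)
  fix i j
  show "rep (br x y) i j = (mm n (rep x) (rep y) - mm n (rep y) (rep x)) i j"
  proof (cases "i < n \<and> j < n")
    case True
    have "c i (act x (act y (b j))) = mm n (rep x) (rep y) i j" for x y
      using True c_act[of i "act y (b j)" x] b M(3) by (simp add: mm_def) (auto simp: rep_def)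
    then show ?thesis using True by (simp add: rep_def[of "br x y"] act_br b c_diff)
  qed (auto simp: rep_def mm_def)
qed

lemma tform_sum: "tform x y = (\<Sum>i<n. \<Sum>k<n. rep x i k * rep y k i)"
  by (simp add: tform_def mtrace_mm)

lemma tform_commute: "tform x y = tform y x"
  unfolding tform_def by (rule mtrace_commute)

lemma tform_add: "tform (x + y) z = tform x z + tform y z" "tform z (x + y) = tform z x + tform z y"
  by (simp_all add: tform_sum rep_add algebra_simps sum.distrib)

lemma tform_scale: "tform (sc k x) z = k * tform x z" "tform z (sc k x) = k * tform z x"
  by (simp_all add: tform_sum rep_scale algebra_simps sum_distrib_left)

lemma tform_zero: "tform 0 z = 0" "tform z 0 = 0"
  using tform_scale(1)[of 0 0 z] tform_scale(2)[of z 0 0] by simp_all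

lemma mtrace_diff: "mtrace n (A - B) = mtrace n A - mtrace n B"
  by (simp add: mtrace_def sum_subtractf)

lemma tform_invariant: "tform (br x y) z = tform x (br y z)"
proof -
  have "mtrace n (mm n (rep y) (mm n (rep x) (rep z))) = mtrace n (mm n (rep x) (mm n (rep z) (rep y)))"
    by (subst mtrace_commute) (simp add: mm_assoc)
  then show ?thesis
    unfolding tform_def rep_br by (simp add: mm_diff mtrace_diff mm_assoc)
qed

lemma trad_ideal: "lideal trad"
proof -
  have "subspace trad"
    unfolding trad_def by (rule subspaceI) (auto simp: tform_add tform_scale tform_zero)
  moreover have "br l k \<in> trad" if "k \<in> trad" for l k
    using that unfolding trad_def mem_Collect_eq
    by (subst br_anti) (simp add: tform_invariant tform_scale(1)[of "-1", simplified])
  ultimately show ?thesis by (simp add: lideal_def)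
qed

lemma trad_trivial_action:
  assumes "\<And>m. m \<in> M \<Longrightarrow> act x m \<in> P"
  shows "x \<in> trad"
proof -
  have "rep x = (\<lambda>i j. 0)" using assms b c_P by (auto simp: rep_def fun_eq_iff)
  then show ?thesis unfolding trad_def tform_sum by simp
qed

text \<open>The trace form vanishes on its radical, so Cartan's criterion applies to brackets with
  it. The exponent \<open>n\<close> is the dimension of \<open>M / P\<close>.\<close>

lemma trad_nilpotent:
  assumes x: "x \<in> span {br l k |l k. k \<in> trad}" and m: "m \<in> M"
  shows "(act x ^^ n) m \<in> P"
proof -
  have "mpow n (\<lambda>i j. if i < n \<and> j < n then rep x i j else 0) n = 0"
  proof (rule cartan_nilpotent)
    show "rep (br x y) i j = (\<Sum>k<n. rep x i k * rep y k j) - (\<Sum>k<n. rep y i k * rep x k j)"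
      if "i < n" "j < n" for x y i j
      using that by (simp add: rep_br mm_def)
    show "subspace trad" "k \<in> trad \<Longrightarrow> br l k \<in> trad" for l k using trad_ideal lidealD by blast+
    show "(\<Sum>i<n. \<Sum>j<n. rep k i j * rep k' j i) = 0" if "k \<in> trad" "k' \<in> trad" for k k'
      using that unfolding trad_def tform_sum by blast
  qed (use rep_add rep_scale x in auto)
  moreover have "(\<lambda>i j. if i < n \<and> j < n then rep x i j else 0) = rep x"
    by (auto simp: rep_def fun_eq_iff)
  ultimately have z: "mpow n (rep x) n = 0" by simp
  have powM: "(act x ^^ k) m \<in> M" for k using m by (induction k) (auto simp: M)
  have "c i ((act x ^^ k) m) = (\<Sum>j<n. mpow n (rep x) k i j * c j m)" if "i < n" for i k
    using that
  proof (induction k arbitrary: i)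
    case 0
    have "(\<Sum>j<n. mid n i j * c j m) = (\<Sum>j<n. if j = i then c j m else 0)"
      using 0 by (intro sum.cong) (auto simp: mid_def)
    then show ?case using 0 by simp
  next
    case (Suc k)
    have "c i ((act x ^^ Suc k) m) = (\<Sum>l<n. rep x i l * c l ((act x ^^ k) m))"
      using c_act[OF Suc.prems powM[of k]] by simp
    also have "\<dots> = (\<Sum>l<n. \<Sum>j<n. rep x i l * mpow n (rep x) k l j * c j m)"
      by (intro sum.cong) (auto simp: Suc.IH sum_distrib_left mult.assoc)
    also have "\<dots> = (\<Sum>j<n. mpow n (rep x) (Suc k) i j * c j m)"
      by (subst sum.swap) (use Suc.prems in \<open>simp add: mm_def sum_distrib_right\<close>)
    finally show ?case .
  qed
  then show ?thesis using c_eq_zeroD[OF powM[of n]] z by simp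
qed

end

context lie_mod
begin

lemma coordinates_exist:
  obtains n b c where "lie_mod_coord sc br sw act M P n b c"
proof -
  obtain n :: nat and b c where
    "\<And>i. i < n \<Longrightarrow> b i \<in> M" "\<And>i u v. c i (u + v) = c i u + c i v"
    "\<And>i k v. c i (sw k v) = k * c i v" "\<And>i p. i < n \<Longrightarrow> p \<in> P \<Longrightarrow> c i p = 0"
    "\<And>i j. i < n \<Longrightarrow> j < n \<Longrightarrow> c i (b j) = (if i = j then 1 else 0)"
    "\<And>v. v \<in> M \<Longrightarrow> v - (\<Sum>i<n. sw (c i v) (b i)) \<in> P"
    by (rule W.quotient_coordinates[OF P(1,2) M(1,2)]) blast
  then have "lie_mod_coord sc br sw act M P n b c"
    by unfold_locales auto
  then show ?thesis by (rule that)
qed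

end

context lie_alg
begin

lemma span_brackets_ideal:
  assumes "lideal K" shows "lideal (span {br l k |l k. k \<in> K})"
proof -
  let ?S = "{br l k |l k. k \<in> K}"
  have "br x y \<in> span ?S" if y: "y \<in> span ?S" for x y
  proof -
    have "?S \<subseteq> {y. br x y \<in> span ?S}"
      using lidealD(2)[OF assms] by (auto intro!: span_base)
    moreover have "subspace {y. br x y \<in> span ?S}"
      by (intro subspaceI) (auto simp: br_add_right br_scale_right span_zero span_add span_scale)
    ultimately show ?thesis using span_minimal y by blast
  qed
  then show ?thesis by (simp add: lideal_def)
qed

lemma lideal_ssum: "lideal I \<Longrightarrow> lideal J \<Longrightarrow> lideal (I \<boxplus> J)"
  unfolding lideal_def by (auto simp: subspace_ssum br_add_right elim!: ssumE intro!: ssumI)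

lemma lideal_UNIV: "lideal UNIV"
  by (auto simp: lideal_def)

lemma adjoint_module:
  assumes "lideal I" "lideal B" "B \<subseteq> I"
  shows "lie_mod sc br sc br I B"
  using assms by unfold_locales
    (auto simp: lideal_def br_add_left br_add_right br_scale_left br_scale_right jacobi)

end


section \<open>Splitting by Casimir operators\<close>

context lie_mod_coord
begin

lemma tform_alt: "tform x y = (\<Sum>i<n. c i (act x (act y (b i))))"
proof -
  have "c i (act x (act y (b i))) = (\<Sum>k<n. rep x i k * rep y k i)" if "i < n" for i
    using that c_act[OF that, of "act y (b i)" x] b M(3) by simp (auto simp: rep_def)
  then show ?thesis by (simp add: tform_sum)
qed

text \<open>The common kernel of the functionals \<open>tform s\<close>, for \<open>s\<close> in a
  finite spanning set, is the radical, where \<open>f\<close> vanishes;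
  \<open>functional_in_span\<close> then expresses \<open>f\<close> through them.\<close>

lemma tform_represents:
  assumes f: "\<And>u v. f (u + v) = f u + f v" "\<And>k u. f (sc k u) = k * f u"
    and "\<And>k. k \<in> trad \<Longrightarrow> f k = 0"
  obtains y where "\<And>v. f v = tform y v"
proof -
  obtain S where S: "finite S" "span S = UNIV" using fin unfolding fin_dim_def by blast
  have "f v = 0" if v: "\<And>s. s \<in> S \<Longrightarrow> tform s v = 0" for v
  proof -
    have "subspace {s. tform s v = 0}"
      by (rule subspaceI) (auto simp: tform_add tform_scale tform_zero)
    then have "span S \<subseteq> {s. tform s v = 0}" using v by (intro span_minimal) auto
    then have "v \<in> trad" using S tform_commute by (auto simp: trad_def)
    then show ?thesis by (rule assms(3))
  qed
  then have "\<exists>a. \<forall>v. f v = (\<Sum>s\<in>S. a s * tform s v)"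
    by (intro functional_in_span[where sc = sc] S f) (auto simp: tform_add tform_scale)
  then obtain a where a: "\<And>v. f v = (\<Sum>s\<in>S. a s * tform s v)" by blast
  have "tform (\<Sum>s\<in>T. sc (a s) s) v = (\<Sum>s\<in>T. a s * tform s v)" for T v
    by (induction T rule: infinite_finite_induct) (auto simp: tform_add tform_scale tform_zero)
  then show ?thesis using that[of "\<Sum>s\<in>S. sc (a s) s"] a by simp
qed

end

context lie_alg
begin

definition semisimple_mod :: "'v set \<Rightarrow> bool" where
  "semisimple_mod B \<longleftrightarrow> (\<forall>I. lideal I \<and> B \<subseteq> I \<and> (\<forall>x\<in>I. \<forall>y\<in>I. br x y \<in> B) \<longrightarrow> I = B)"

lemma semisimple_modD:
  assumes "semisimple_mod B" "lideal I" "B \<subseteq> I" "\<And>x y. x \<in> I \<Longrightarrow> y \<in> I \<Longrightarrow> br x y \<in> B"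
  shows "I = B"
  using assms(1)[unfolded semisimple_mod_def, rule_format, of I] assms(2-4) by simp

text \<open>Nondegeneracy of the Killing form of \<open>L / B\<close>. By Cartan's criterion
  \<open>[L, K]\<close> acts nilpotently on \<open>L / B\<close>. If it were not inside
  \<open>B\<close>, an ideal minimal among those strictly above \<open>B\<close> and inside
  \<open>B + [L, K]\<close> would be sent into \<open>B\<close> by \<open>[L, K]\<close>, hence be
  abelian modulo \<open>B\<close>. So \<open>[L, K]\<close> lies in \<open>B\<close>, and
  \<open>K\<close> itself is abelian modulo \<open>B\<close>.\<close>

lemma killing_radical:
  assumes B: "lideal B" "semisimple_mod B" and co: "lie_mod_coord sc br sc br UNIV B n b c"
  shows "lie_mod_coord.trad br n b c = B"
proof -
  interpret A: lie_mod_coord sc br sc br UNIV B n b c by (rule co)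
  define K where "K = A.trad"
  have K: "lideal K" unfolding K_def by (rule A.trad_ideal)
  have BK: "B \<subseteq> K"
    unfolding K_def using lidealD(3)[OF B(1)] by (blast intro: A.trad_trivial_action)
  let ?D = "span {br l k |l k. k \<in> K}"
  have D: "lideal ?D" using span_brackets_ideal[OF K] .
  have brD: "br l k \<in> ?D" if "k \<in> K" for l k using that by (auto intro!: span_base)
  have I: "lideal (B \<boxplus> ?D)" using lideal_ssum B(1) D by blast
  have BI: "B \<subseteq> B \<boxplus> ?D" by (rule ssum_left) simp
  have DI: "?D \<subseteq> B \<boxplus> ?D" using ssum_right lidealD(1)[OF B(1)] by blast
  have "B \<boxplus> ?D = B"
  proof (rule ccontr)
    assume ne: "B \<boxplus> ?D \<noteq> B"
    define Q where "Q N \<longleftrightarrow> lideal N \<and> B \<subset> N \<and> N \<subseteq> B \<boxplus> ?D" for N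
    have "Q (B \<boxplus> ?D)" using I BI ne by (auto simp: Q_def)
    then obtain N where N: "Q N" "\<And>N'. Q N' \<Longrightarrow> N' \<subseteq> N \<Longrightarrow> N' = N"
      by (rule minimal_subspace) (auto simp: Q_def lideal_def)
    note n = N(1)[unfolded Q_def]
    interpret NB: lie_mod sc br sc br N B
      using n B by (intro adjoint_module) auto
    have irr: "NB.irreducible"
      unfolding NB.irreducible_def
    proof (intro conjI allI impI)
      show "B \<noteq> N" using n by blast
      fix N' assume h: "subspace N' \<and> B \<subseteq> N' \<and> N' \<subseteq> N \<and> (\<forall>x. \<forall>m\<in>N'. br x m \<in> N')"
      then have "Q N'" if "N' \<noteq> B" using that n unfolding Q_def lideal_def by blast
      then show "N' = B \<or> N' = N" using N(2) h by blast
    qed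
    have tr: "br x m \<in> B" if "x \<in> ?D" "m \<in> N" for x m
    proof (rule NB.nilpotent_ideal_trivial[OF irr D _ that])
      show "\<exists>k. \<forall>m\<in>N. (br x ^^ k) m \<in> B" if "x \<in> ?D" for x
        using A.trad_nilpotent that unfolding K_def by blast
    qed
    have "br x y \<in> B" if xy: "x \<in> N" "y \<in> N" for x y
    proof -
      obtain b0 d where "b0 \<in> B" "d \<in> ?D" "x = b0 + d" using n xy(1) by (blast elim: ssumE)
      then show ?thesis
        using tr[of d y] xy lidealD[OF B(1)] by (simp add: br_add_left subspace_add)
    qed
    then have "N = B" using n by (intro semisimple_modD[OF B(2)]) auto
    with n show False by blast
  qed
  then have "br x y \<in> B" if "x \<in> K" "y \<in> K" for x y
    using subsetD[OF DI brD[OF that(2), of x]] by simp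
  then have "K = B" by (intro semisimple_modD[OF B(2) K BK])
  then show ?thesis by (simp add: K_def)
qed

text \<open>In other words, \<open>K = [K, K] + B\<close>.\<close>

lemma functional_zero_on_ideal:
  fixes f :: "'v \<Rightarrow> 'f"
  assumes B: "lideal B" "semisimple_mod B" and K: "lideal K" "B \<subseteq> K"
    and f: "\<And>u v. f (u + v) = f u + f v" "\<And>k u. f (sc k u) = k * f u"
    and fB: "\<And>x. x \<in> B \<Longrightarrow> f x = 0"
    and fK: "\<And>x y. x \<in> K \<Longrightarrow> y \<in> K \<Longrightarrow> f (br x y) = 0"
    and k: "k \<in> K"
  shows "f k = 0"
proof -
  interpret A0: lie_mod sc br sc br UNIV B
    using adjoint_module[OF lideal_UNIV B(1)] by simp
  obtain n b c where co: "lie_mod_coord sc br sc br UNIV B n b c"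
    by (rule A0.coordinates_exist)
  interpret A: lie_mod_coord sc br sc br UNIV B n b c by (rule co)
  have tradB: "A.trad = B" by (rule killing_radical[OF B co])
  obtain x0 where x0: "\<And>v. f v = A.tform x0 v"
    by (rule A.tform_represents[of f]) (use f fB tradB in auto)
  \<comment> \<open>The part of \<open>K\<close> orthogonal to \<open>K\<close> under the Killing
    form of \<open>L / B\<close>. Invariance of the form makes it abelian modulo \<open>B\<close>,
    hence equal to \<open>B\<close>.\<close>
  define J where "J = {u \<in> K. \<forall>k'\<in>K. A.tform u k' = 0}"
  have J: "lideal J" unfolding lideal_def
  proof (intro conjI allI ballI)
    show "subspace J"
      using lidealD(1)[OF K(1)] unfolding J_def
      by (intro subspaceI) (auto simp: A.tform_add A.tform_scale A.tform_zero subspace_0 subspace_add subspace_scale)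
    show "br l u \<in> J" if u: "u \<in> J" for l u
    proof -
      have "A.tform (br l u) k' = 0" if "k' \<in> K" for k'
        using u lidealD(2)[OF K(1) that, of l]
        by (subst br_anti) (simp add: J_def A.tform_invariant A.tform_scale(1)[of "-1", simplified])
      then show ?thesis using u lidealD(2)[OF K(1)] by (simp add: J_def)
    qed
  qed
  have BJ: "B \<subseteq> J" using K(2) tradB by (auto simp: J_def A.trad_def)
  have "br u v \<in> B" if uv: "u \<in> J" "v \<in> J" for u v
  proof -
    have "A.tform (br u v) l = 0" for l
      using uv lidealD(3)[OF K(1), of v l] by (simp add: J_def A.tform_invariant)
    then show ?thesis using tradB by (auto simp: A.trad_def)
  qed
  then have JB: "J = B" by (intro semisimple_modD[OF B(2) J BJ])
  \<comment> \<open>The representing element \<open>x0\<close> commutes with \<open>K\<close> modulo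
    \<open>B\<close>, so the composition of \<open>ad x0\<close> and \<open>ad k\<close> maps
    \<open>L\<close> into \<open>B\<close> and has trace zero on \<open>L / B\<close>.\<close>
  have comm: "br x0 k \<in> B" if "k \<in> K" for k
  proof -
    have "A.tform (br x0 k) k' = 0" if "k' \<in> K" for k'
      using fK[OF \<open>k \<in> K\<close> that] by (simp add: A.tform_invariant x0)
    then show ?thesis using JB lidealD(2)[OF K(1) that] by (auto simp: J_def)
  qed
  have "c i (br x0 (br k (b i))) = 0" if "i < n" for i
    using A.c_P[OF that] comm lidealD(3)[OF K(1) k] by blast
  then have "A.tform x0 k = 0" by (simp add: A.tform_alt)
  then show ?thesis by (simp add: x0)
qed

end


context lie_mod
begin

lemma submodule:
  assumes "W.subspace M'" "M' \<subseteq> M" "\<And>x m. m \<in> M' \<Longrightarrow> act x m \<in> M'"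
    and "W.subspace P'" "P' \<subseteq> M'" "\<And>x m. m \<in> P' \<Longrightarrow> act x m \<in> P'"
  shows "lie_mod sc br sw act M' P'"
  using assms M(2) W.fdim_mono
  by unfold_locales (auto simp: act_add act_scale act_add_left act_scale_left act_br)

text \<open>Let \<open>Om\<close> be the Casimir operator of the trace form on \<open>M1 / P\<close>.  It is invertible there and
  commutes with the action modulo \<open>P\<close>, even on \<open>m\<close>.  Hence if \<open>Om m1\<close> agrees with \<open>Om m\<close> modulo \<open>P\<close>,
  then every \<open>act x (m - m1)\<close> lies in the kernel of \<open>Om\<close>.\<close>

lemma casimir_step:
  assumes M1: "W.subspace M1" "P \<subseteq> M1" "M1 \<subseteq> M" "\<And>x m. m \<in> M1 \<Longrightarrow> act x m \<in> M1"
    and irr: "lie_mod.irreducible sw act M1 P"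
    and B: "lideal B" "semisimple_mod B" "\<And>x w. x \<in> B \<Longrightarrow> w \<in> M \<Longrightarrow> act x w \<in> P"
    and m: "m \<in> M" "\<And>x. act x m \<in> M1"
  shows "\<exists>m1\<in>M1. \<forall>x. act x (m - m1) \<in> P"
proof -
  have N0: "lie_mod sc br sw act M1 P" using M1 P by (intro submodule) auto
  interpret N0: lie_mod sc br sw act M1 P by (rule N0)
  obtain n b c where co: "lie_mod_coord sc br sw act M1 P n b c" by (rule N0.coordinates_exist)
  interpret N: lie_mod_coord sc br sw act M1 P n b c by (rule co)
  have actM1: "w \<in> M1 \<Longrightarrow> act x w \<in> M1" for x w by (rule M1(4))
  \<comment> \<open>because \<open>K = [K, K] + B\<close>\<close>
  have perfect: "act k w \<in> P"
    if K: "lideal K" "B \<subseteq> K" and w: "w \<in> M" "\<And>x. act x w \<in> M1"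
      and comm: "\<And>x y. x \<in> K \<Longrightarrow> y \<in> K \<Longrightarrow> act (br x y) w \<in> P" and k: "k \<in> K" for K w k
  proof (rule N.c_eq_zeroD[OF w(2)])
    fix i assume i: "i < n"
    show "c i (act k w) = 0"
    proof (rule functional_zero_on_ideal[OF B(1,2) K _ _ _ _ k])
      show "c i (act (u + v) w) = c i (act u w) + c i (act v w)" for u v
        using w(1) by (simp add: act_add_left N.c_add)
      show "c i (act (sc k u) w) = k * c i (act u w)" for k u
        using w(1) by (simp add: act_scale_left N.c_scale)
    qed (use N.c_P[OF i] B(3) w comm in auto)
  qed
  show ?thesis
  proof (cases "\<forall>x. \<forall>w\<in>M1. act x w \<in> P")
    \<comment> \<open>A trivial action has zero trace form and yields no Casimir operator. Here
      \<open>x \<mapsto> act x m\<close> kills brackets modulo \<open>P\<close>, and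
      \<open>L = [L, L] + B\<close>.\<close>
    case True
    have "act (br x y) m \<in> P" for x y
      using True act_br[OF m(1)] m(2) W.subspace_diff[OF P(1)] by simp
    then have "act x m \<in> P" for x
      using perfect[OF lideal_UNIV _ m] by simp
    then show ?thesis using W.subspace_0[OF M1(1)] by (intro bexI[of _ 0]) auto
  next
    case False
    define K where "K = N.trad"
    have K: "lideal K" unfolding K_def by (rule N.trad_ideal)
    have BK: "B \<subseteq> K" unfolding K_def using B(3) M1(3) by (blast intro: N.trad_trivial_action)
    let ?D = "span {br l k |l k. k \<in> K}"
    have Dtriv: "act x w \<in> P" if "x \<in> ?D" "w \<in> M1" for x w
    proof (rule N0.nilpotent_ideal_trivial[OF irr span_brackets_ideal[OF K] _ that])
      show "\<exists>k. \<forall>m\<in>M1. (act x ^^ k) m \<in> P" if "x \<in> ?D" for x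
        using N.trad_nilpotent that unfolding K_def by blast
    qed
    have Ktriv: "act k w \<in> P" if k: "k \<in> K" and w: "w \<in> M1" for k w
    proof (rule perfect[OF K BK _ _ _ k])
      show "act (br x y) w \<in> P" if "x \<in> K" "y \<in> K" for x y
        by (rule Dtriv[OF _ w]) (use that in \<open>auto intro!: span_base\<close>)
    qed (use w M1 in auto)
    have Km: "act k m \<in> P" if k: "k \<in> K" for k
    proof (rule perfect[OF K BK m _ k])
      show "act (br x y) m \<in> P" if "x \<in> K" "y \<in> K" for x y
        using that Ktriv m(2) act_br[OF m(1)] W.subspace_diff[OF P(1)] by simp
    qed
    obtain nL :: nat and e g where
      eUNIV: "\<And>i. i < nL \<Longrightarrow> e i \<in> UNIV" and eg: "\<And>i u v. g i (u + v) = g i u + g i v" "\<And>i k v. g i (sc k v) = k * g i v"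
        "\<And>i p. i < nL \<Longrightarrow> p \<in> K \<Longrightarrow> g i p = 0"
        "\<And>i j. i < nL \<Longrightarrow> j < nL \<Longrightarrow> g i (e j) = (if i = j then 1 else 0)"
        "\<And>v. v \<in> UNIV \<Longrightarrow> v - (\<Sum>i<nL. sc (g i v) (e i)) \<in> K"
      by (rule quotient_coordinates[OF lidealD(1)[OF K] subset_UNIV subspace_UNIV fdim_UNIV]) blast
    have nL: "nL \<noteq> 0"
    proof
      assume "nL = 0"
      then have "v \<in> K" for v using eg(5)[OF UNIV_I, of v] by simp
      then show False using False Ktriv by blast
    qed
    \<comment> \<open>The elements dual to the \<open>e i\<close> under the trace form, which is
      nondegenerate on \<open>L / K\<close>.\<close>
    have "\<exists>y. \<forall>v. g i v = N.tform y v" if "i < nL" for i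
      by (rule N.tform_represents[of "g i"]) (use eg that K_def in auto)
    then obtain e' where e': "\<And>i v. i < nL \<Longrightarrow> g i v = N.tform (e' i) v" by metis
    have dual: "N.tform (e' i) (e j) = (if i = j then 1 else 0)" if "i < nL" "j < nL" for i j
      using eg(4)[OF that] e'[OF that(1)] by simp
    have tfsum: "N.tform (\<Sum>i\<in>A. h i) v = (\<Sum>i\<in>A. N.tform (h i) v)" for A v and h :: "nat \<Rightarrow> 'v"
      by (induction A rule: infinite_finite_induct) (auto simp: N.tform_add N.tform_zero)
    have tfneg: "N.tform (- u) v = - N.tform u v" for u v
      using N.tform_scale(1)[of "-1" u v] by simp
    have tfdiff: "N.tform (u - v) w = N.tform u w - N.tform v w" for u v w
      using N.tform_add(1)[of "u - v" v w] by simp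
    have dec1: "y - (\<Sum>i<nL. sc (N.tform (e' i) y) (e i)) \<in> K" for y
      using eg(5)[OF UNIV_I, of y] e' by simp
    have dec2: "y - (\<Sum>i<nL. sc (N.tform (e i) y) (e' i)) \<in> K" for y
    proof -
      define u where "u = y - (\<Sum>i<nL. sc (N.tform (e i) y) (e' i))"
      have uz: "N.tform u (e j) = 0" if "j < nL" for j
      proof -
        have "N.tform u (e j) = N.tform y (e j) - (\<Sum>i<nL. N.tform (e i) y * N.tform (e' i) (e j))"
          unfolding u_def by (simp add: tfdiff tfsum N.tform_scale)
        also have "(\<Sum>i<nL. N.tform (e i) y * N.tform (e' i) (e j)) = (\<Sum>i<nL. if i = j then N.tform (e i) y else 0)"
          using dual that by (intro sum.cong) auto
        finally show ?thesis using that N.tform_commute[of y "e j"] by simp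
      qed
      have "N.tform u l = 0" for l
      proof -
        let ?s = "\<Sum>i<nL. sc (g i l) (e i)"
        have "N.tform (l - ?s) u = 0" using eg(5)[OF UNIV_I, of l] by (auto simp: K_def N.trad_def)
        then have "N.tform u l = N.tform ?s u" using N.tform_commute[of u l] by (simp add: tfdiff)
        also have "\<dots> = 0"
          unfolding tfsum by (intro sum.neutral) (use uz N.tform_commute[of u] in \<open>auto simp: N.tform_scale\<close>)
        finally show ?thesis .
      qed
      then show ?thesis unfolding u_def[symmetric] K_def N.trad_def by blast
    qed
    define Om where "Om w = (\<Sum>i<nL. act (e i) (act (e' i) w))" for w
    have Om_add: "Om (u + v) = Om u + Om v" and Om_scale: "Om (sw k u) = sw k (Om u)" for u v k
      by (simp_all add: Om_def act_add act_scale sum.distrib W.scale_sum_right)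
    have Om_diff: "Om (u - v) = Om u - Om v" for u v using Om_add[of "u - v" v] by (simp add: eq_diff_eq)
    have Om_zero: "Om 0 = 0" using Om_scale[of 0 0] by simp
    have Om_P: "w \<in> P \<Longrightarrow> Om w \<in> P" for w
      unfolding Om_def using P by (intro W.subspace_sum) auto
    have Om_M1: "Om w \<in> M1" if "\<And>v. act v w \<in> M1" for w
      unfolding Om_def using that M1 by (intro W.subspace_sum) auto
    have commute: "act x (Om w) - Om (act x w) \<in> P"
      if w: "w \<in> M" "\<And>v. act v w \<in> M1" "\<And>k. k \<in> K \<Longrightarrow> act k w \<in> P" for x w
    proof (rule N.c_eq_zeroD)
      have "Om w \<in> M1" "Om (act x w) \<in> M1" using Om_M1 w(2) actM1 by auto
      then show "act x (Om w) - Om (act x w) \<in> M1" using actM1 W.subspace_diff[OF M1(1)] by blast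
      fix q assume q: "q < n"
      \<comment> \<open>One coordinate at a time, invariance of the tensor of the dual bases becomes
        an identity between bilinear forms on \<open>L\<close>. The conditions on \<open>w\<close>
        are weaker than membership in \<open>M1\<close>, so that the identity also reaches
        \<open>m - m1\<close>.\<close>
      define \<beta> where "\<beta> u v = c q (act u (act v w))" for u v
      have wM: "act v w \<in> M" for v using M(3) w(1) by blast
      have \<beta>add: "\<beta> (u + u') v = \<beta> u v + \<beta> u' v" "\<beta> u (v + v') = \<beta> u v + \<beta> u v'" for u u' v v'
        using w(1) wM by (simp_all add: \<beta>_def act_add_left act_add N.c_add)
      have \<beta>sc: "\<beta> (sc k u) v = k * \<beta> u v" "\<beta> u (sc k v) = k * \<beta> u v" for k u v
        using w(1) wM by (simp_all add: \<beta>_def act_scale_left act_scale N.c_scale)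
      have \<beta>K: "\<beta> k v = 0" "\<beta> v k = 0" if "k \<in> K" for k v
        unfolding \<beta>_def using Ktriv[OF that w(2)] w(3)[OF that] P(3) N.c_P[OF q] by auto
      have \<beta>0: "\<beta> 0 v = 0" "\<beta> v 0 = 0" for v using \<beta>sc(1)[of 0 0 v] \<beta>sc(2)[of v 0 0] by simp_all
      have \<beta>sum: "\<beta> (\<Sum>i\<in>A. h i) v = (\<Sum>i\<in>A. \<beta> (h i) v)" "\<beta> v (\<Sum>i\<in>A. h i) = (\<Sum>i\<in>A. \<beta> v (h i))" for A v and h :: "nat \<Rightarrow> 'v"
        by (induction A rule: infinite_finite_induct) (auto simp: \<beta>add \<beta>0)
      have \<beta>cong: "\<beta> u v = \<beta> u' v" "\<beta> v u = \<beta> v u'" if "u - u' \<in> K" for u u' v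
        using \<beta>K[OF that, of v] \<beta>add(1)[of "u - u'" u' v] \<beta>add(2)[of v "u - u'" u'] by simp_all
      have 1: "\<beta> (br x (e i)) (e' i) = (\<Sum>j<nL. N.tform (e' j) (br x (e i)) * \<beta> (e j) (e' i))" for i
        unfolding \<beta>cong(1)[OF dec1[of "br x (e i)"]] by (simp add: \<beta>sum \<beta>sc)
      have 2: "\<beta> (e i) (br x (e' i)) = (\<Sum>j<nL. N.tform (e j) (br x (e' i)) * \<beta> (e i) (e' j))" for i
        unfolding \<beta>cong(2)[OF dec2[of "br x (e' i)"]] by (simp add: \<beta>sum \<beta>sc)
      have inv: "N.tform (e' j) (br x (e i)) = - N.tform (e i) (br x (e' j))" for i j
      proof -
        have "N.tform (e' j) (br x (e i)) = N.tform (br (e' j) x) (e i)" by (simp add: N.tform_invariant)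
        also have "\<dots> = - N.tform (br x (e' j)) (e i)" by (subst br_anti) (simp add: tfneg)
        finally show ?thesis by (simp add: N.tform_commute)
      qed
      have "c q (act x (Om w) - Om (act x w)) = (\<Sum>i<nL. c q (act x (act (e i) (act (e' i) w))) - c q (act (e i) (act (e' i) (act x w))))"
        by (simp add: Om_def act_sum N.c_diff N.c_sum sum_subtractf)
      also have "\<dots> = (\<Sum>i<nL. \<beta> (br x (e i)) (e' i) + \<beta> (e i) (br x (e' i)))"
        using w(1) wM by (intro sum.cong) (auto simp: \<beta>_def act_br act_diff N.c_diff)
      also have "\<dots> = (\<Sum>i<nL. \<Sum>j<nL. N.tform (e' j) (br x (e i)) * \<beta> (e j) (e' i))
          + (\<Sum>i<nL. \<Sum>j<nL. N.tform (e j) (br x (e' i)) * \<beta> (e i) (e' j))"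
        by (simp add: 1 2 sum.distrib)
      also have "(\<Sum>i<nL. \<Sum>j<nL. N.tform (e j) (br x (e' i)) * \<beta> (e i) (e' j))
          = (\<Sum>i<nL. \<Sum>j<nL. N.tform (e i) (br x (e' j)) * \<beta> (e j) (e' i))" by (rule sum.swap)
      finally show "c q (act x (Om w) - Om (act x w)) = 0" by (simp add: inv sum_negf)
    qed
    have commM1: "act x (Om w) - Om (act x w) \<in> P" if "w \<in> M1" for x w
      using that M1 Ktriv by (intro commute) auto
    \<comment> \<open>The trace of \<open>Om\<close> on \<open>M1 / P\<close> is the number of dual
      pairs, which is nonzero in characteristic zero, so \<open>Om\<close> does not act there as
      zero.\<close>
    have "(\<Sum>q<n. c q (Om (b q))) = (\<Sum>i<nL. N.tform (e i) (e' i))"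
      unfolding Om_def N.c_sum N.tform_alt by (rule sum.swap)
    also have "\<dots> = (\<Sum>i<nL. 1)"
      using dual N.tform_commute[of "e _"] by (intro sum.cong) auto
    finally have "(\<Sum>q<n. c q (Om (b q))) \<noteq> 0" using nL by simp
    then obtain q where q: "q < n" "c q (Om (b q)) \<noteq> 0" by (rule sum_neq_zeroE)
    then have OmbP: "Om (b q) \<notin> P" using N.c_P by blast
    have bM1: "b q \<in> M1" using N.b q by blast
    have OmM1: "w \<in> M1 \<Longrightarrow> Om w \<in> M1" for w by (intro Om_M1 actM1)
    \<comment> \<open>Schur's lemma for \<open>Om\<close> on the irreducible \<open>M1 / P\<close>:
      the image here, the kernel below.\<close>
    define I where "I = {u \<in> M1. \<exists>w\<in>M1. u - Om w \<in> P}"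
    have "I = P \<or> I = M1"
    proof (rule N0.irreducibleD[OF irr])
      show "W.subspace I"
      proof (rule W.subspaceI)
        show "0 \<in> I" unfolding I_def
          using W.subspace_0[OF M1(1)] W.subspace_0[OF P(1)] by (auto intro!: bexI[of _ 0] simp: Om_zero)
        show "u + v \<in> I" if uv: "u \<in> I" "v \<in> I" for u v
        proof -
          obtain w w' where h: "w \<in> M1" "w' \<in> M1" "u - Om w \<in> P" "v - Om w' \<in> P"
            using uv by (auto simp: I_def)
          have eq: "u + v - Om (w + w') = (u - Om w) + (v - Om w')" by (simp add: Om_add)
          have "u + v - Om (w + w') \<in> P" unfolding eq by (rule W.subspace_add[OF P(1) h(3,4)])
          then show ?thesis using uv W.subspace_add[OF M1(1)] h(1,2) by (auto simp: I_def)
        qed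
        show "sw k u \<in> I" if u: "u \<in> I" for k u
        proof -
          obtain w where h: "w \<in> M1" "u - Om w \<in> P" using u by (auto simp: I_def)
          have "sw k u - Om (sw k w) \<in> P"
            using W.subspace_scale[OF P(1) h(2), of k] by (simp add: Om_scale W.scale_right_diff_distrib)
          then show ?thesis using u W.subspace_scale[OF M1(1)] h(1) by (auto simp: I_def)
        qed
      qed
      show "P \<subseteq> I" unfolding I_def
        using M1(2) W.subspace_0[OF M1(1)] by (auto intro!: bexI[of _ 0] simp: Om_zero)
      show "I \<subseteq> M1" by (auto simp: I_def)
      show "act x u \<in> I" if u: "u \<in> I" for x u
      proof -
        obtain w where h: "w \<in> M1" "u - Om w \<in> P" using u by (auto simp: I_def)
        have eq: "act x u - Om (act x w) = act x (u - Om w) + (act x (Om w) - Om (act x w))"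
          by (simp add: act_diff)
        have "act x u - Om (act x w) \<in> P"
          unfolding eq by (rule W.subspace_add[OF P(1) P(3)[OF h(2)] commM1[OF h(1)]])
        then show ?thesis using u actM1 h(1) by (auto simp: I_def)
      qed
    qed
    moreover have "Om (b q) \<in> I"
      unfolding I_def using bM1 OmM1 W.subspace_0[OF P(1)] by (auto intro!: bexI[of _ "b q"])
    ultimately have I: "I = M1" using OmbP by blast
    define Kr where "Kr = {w \<in> M1. Om w \<in> P}"
    have "Kr = P \<or> Kr = M1"
    proof (rule N0.irreducibleD[OF irr])
      show "W.subspace Kr"
        using W.subspace_0[OF M1(1)] W.subspace_0[OF P(1)] W.subspace_add[OF M1(1)] W.subspace_add[OF P(1)]
          W.subspace_scale[OF M1(1)] W.subspace_scale[OF P(1)]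
        by (intro W.subspaceI) (auto simp: Kr_def Om_zero Om_add Om_scale)
      show "P \<subseteq> Kr" using M1(2) Om_P by (auto simp: Kr_def)
      show "Kr \<subseteq> M1" by (auto simp: Kr_def)
      show "act x w \<in> Kr" if w: "w \<in> Kr" for x w
      proof -
        have h: "w \<in> M1" "Om w \<in> P" using w by (auto simp: Kr_def)
        have "act x (Om w) - (act x (Om w) - Om (act x w)) \<in> P"
          using W.subspace_diff[OF P(1) P(3)[OF h(2)] commM1[OF h(1)]] .
        then show ?thesis using actM1[OF h(1)] by (simp add: Kr_def)
      qed
    qed
    then have Kr: "Kr = P" using bM1 OmbP by (auto simp: Kr_def)
    have "Om m \<in> I" using I Om_M1 m(2) by blast
    then obtain m1 where m1: "m1 \<in> M1" "Om m - Om m1 \<in> P" by (auto simp: I_def)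
    have "act x (m - m1) \<in> P" for x
    proof -
      let ?u = "m - m1"
      have uM: "?u \<in> M" using m m1 M1(3) W.subspace_diff[OF M(1)] by blast
      have uM1: "act v ?u \<in> M1" for v
        using m(2) actM1[OF m1(1)] W.subspace_diff[OF M1(1)] by (simp add: act_diff)
      have uK: "act k ?u \<in> P" if "k \<in> K" for k
        using Km[OF that] Ktriv[OF that m1(1)] W.subspace_diff[OF P(1)] by (simp add: act_diff)
      have "act x (Om ?u) \<in> P" using P(3) m1(2) by (simp add: Om_diff)
      then have "act x (Om ?u) - (act x (Om ?u) - Om (act x ?u)) \<in> P"
        using W.subspace_diff[OF P(1) _ commute[OF uM uM1 uK]] by blast
      then have "act x ?u \<in> Kr" using uM1 by (simp add: Kr_def)
      then show ?thesis using Kr by simp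
    qed
    with m1(1) show ?thesis by blast
  qed
qed

text \<open>The vector \<open>m\<close> stands for the cocycle \<open>x \<mapsto> act x m\<close> with values in \<open>M0 / P\<close>; this is the
  first Whitehead lemma, phrased so that no quotient modules are needed.\<close>

theorem cocycle_splits:
  assumes M0: "W.subspace M0" "P \<subseteq> M0" "M0 \<subseteq> M" "\<And>x m. m \<in> M \<Longrightarrow> act x m \<in> M0"
    and B: "lideal B" "semisimple_mod B" "\<And>x w. x \<in> B \<Longrightarrow> w \<in> M \<Longrightarrow> act x w \<in> P"
    and m: "m \<in> M"
  obtains m0 where "m0 \<in> M0" "\<And>x. act x (m - m0) \<in> P"
proof -
  define invt where "invt N \<longleftrightarrow> W.subspace N \<and> P \<subseteq> N \<and> N \<subseteq> M0 \<and> (\<forall>x. \<forall>w\<in>N. act x w \<in> N)" for N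
  define Q where "Q N \<longleftrightarrow> invt N \<and> (\<exists>m0\<in>M0. \<forall>x. act x (m - m0) \<in> N)" for N
  have fd: "N \<subseteq> M \<Longrightarrow> W.fdim N" for N using M(2) W.fdim_mono by blast
  have "Q M0" unfolding Q_def invt_def
    using M0 m W.subspace_0[OF M0(1)] by (auto intro!: bexI[of _ 0])
  then obtain N where N: "Q N" "\<And>N'. Q N' \<Longrightarrow> N' \<subseteq> N \<Longrightarrow> N' = N"
    by (rule W.minimal_subspace) (use fd M0 in \<open>auto simp: Q_def invt_def\<close>)
  obtain m0 where m0: "m0 \<in> M0" "\<And>x. act x (m - m0) \<in> N" using N(1) by (auto simp: Q_def)
  have invN: "invt N" using N(1) by (simp add: Q_def)
  have "N = P"
  proof (rule ccontr)
    assume ne: "N \<noteq> P"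
    \<comment> \<open>A submodule \<open>P'\<close> maximal below \<open>N\<close> makes
      \<open>N / P'\<close> irreducible, and \<open>casimir_step\<close> moves the values of the
      cocycle from \<open>N\<close> into \<open>P'\<close>, against the minimality of
      \<open>N\<close>.\<close>
    define R where "R N' \<longleftrightarrow> invt N' \<and> N' \<subset> N" for N'
    have "R P" using P M0(2) invN ne by (auto simp: R_def invt_def)
    then obtain P' where P': "R P'" "\<And>N'. R N' \<Longrightarrow> P' \<subseteq> N' \<Longrightarrow> N' = P'"
      by (rule W.maximal_subspace[where M = N]) (use invN fd M0 in \<open>auto simp: R_def invt_def\<close>)
    have p': "W.subspace P'" "P \<subseteq> P'" "P' \<subset> N" "\<And>x w. w \<in> P' \<Longrightarrow> act x w \<in> P'"
      using P'(1) by (auto simp: R_def invt_def)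
    have n: "W.subspace N" "N \<subseteq> M0" "\<And>x w. w \<in> N \<Longrightarrow> act x w \<in> N"
      using invN by (auto simp: invt_def)
    interpret MP': lie_mod sc br sw act M P'
      using p' n M0 M by (intro submodule) auto
    interpret NP': lie_mod sc br sw act N P'
      using p' n M0 by (intro submodule) auto
    have irr: "NP'.irreducible"
      unfolding NP'.irreducible_def
    proof (intro conjI allI impI)
      show "P' \<noteq> N" using p' by blast
      fix N' assume h: "W.subspace N' \<and> P' \<subseteq> N' \<and> N' \<subseteq> N \<and> (\<forall>x. \<forall>m\<in>N'. act x m \<in> N')"
      then have "R N'" if "N' \<noteq> N" using that p' n unfolding R_def invt_def by blast
      then show "N' = P' \<or> N' = N" using P'(2) h by blast
    qed
    have "\<exists>m1\<in>N. \<forall>x. act x (m - m0 - m1) \<in> P'"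
    proof (rule MP'.casimir_step[OF n(1) _ _ _ irr B(1,2)])
      show "m - m0 \<in> M" using m m0 M0 W.subspace_diff[OF M(1)] by blast
      show "act x w \<in> P'" if "x \<in> B" "w \<in> M" for x w using B(3)[OF that] p' by blast
    qed (use p' n M0 m0 in auto)
    then obtain m1 where m1: "m1 \<in> N" "\<And>x. act x (m - m0 - m1) \<in> P'" by blast
    have "m0 + m1 \<in> M0" using m0 m1 n W.subspace_add[OF M0(1)] by blast
    moreover have "act x (m - (m0 + m1)) \<in> P'" for x using m1(2)[of x] by (simp add: diff_diff_eq)
    ultimately have "Q P'" using P'(1) unfolding Q_def R_def by blast
    from N(2)[OF this] p' show False by blast
  qed
  with that m0 show ?thesis by blast
qed

end


section \<open>Frattini ideals and complements\<close>

context vspace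
begin

lemma modular_law:
  assumes "subspace V" "U \<subseteq> V"
  shows "V \<inter> (U \<boxplus> S) = U \<boxplus> (V \<inter> S)"
proof
  show "V \<inter> (U \<boxplus> S) \<subseteq> U \<boxplus> (V \<inter> S)"
  proof
    fix x assume x: "x \<in> V \<inter> (U \<boxplus> S)"
    then obtain u s where us: "u \<in> U" "s \<in> S" "x = u + s" by (blast elim: ssumE)
    then have "s = x - u" by simp
    then have "s \<in> V" using subspace_diff[OF assms(1)] x us assms(2) by blast
    then show "x \<in> U \<boxplus> (V \<inter> S)" using us by (auto intro: ssumI)
  qed
  show "U \<boxplus> (V \<inter> S) \<subseteq> V \<inter> (U \<boxplus> S)"
    using assms by (auto elim!: ssumE intro: ssumI subspace_add)
qed

end

context lie_alg
begin

lemma subalg_iff: "subalg sc br A S \<longleftrightarrow> S \<subseteq> A \<and> lsub S"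
  by (auto simp: subalg_def lsub_def)

lemma ideal_in_iff: "ideal_in sc br A I \<longleftrightarrow> I \<subseteq> A \<and> subspace I \<and> (\<forall>a\<in>A. \<forall>y\<in>I. br a y \<in> I)"
  by (simp add: ideal_in_def)

lemma ideal_in_UNIV: "ideal_in sc br UNIV I \<longleftrightarrow> lideal I"
  by (simp add: ideal_in_def lideal_def)

lemma ideal_inD:
  assumes "ideal_in sc br A I"
  shows "I \<subseteq> A" "subspace I" "a \<in> A \<Longrightarrow> y \<in> I \<Longrightarrow> br a y \<in> I" "a \<in> A \<Longrightarrow> y \<in> I \<Longrightarrow> br y a \<in> I"
  using assms unfolding ideal_in_def using br_anti[of y a] subspace_neg[of I "br a y"] by auto

lemma lsub_ssum:
  assumes "lsub C" "ideal_in sc br C A" "lsub S" "S \<subseteq> C"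
  shows "lsub (A \<boxplus> S)"
  unfolding lsub_def
proof (intro conjI ballI)
  note A = ideal_inD[OF assms(2)]
  show sub: "subspace (A \<boxplus> S)" using A(2) assms(3) by (intro subspace_ssum) (auto simp: lsub_def)
  fix x y assume "x \<in> A \<boxplus> S" "y \<in> A \<boxplus> S"
  then obtain a s a' s' where h: "a \<in> A" "s \<in> S" "x = a + s" "a' \<in> A" "s' \<in> S" "y = a' + s'"
    by (blast elim: ssumE)
  have "br x y = (br a y + br s a') + br s s'" unfolding h(3,6) by (simp add: br_add_left br_add_right)
  moreover have "y \<in> C"
    unfolding h(6) using subsetD[OF A(1) h(4)] subsetD[OF assms(4) h(5)] by (rule subspace_add[OF lsubD(1)[OF assms(1)]])
  then have "br a y \<in> A" by (rule A(4)[OF _ h(1)])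
  moreover have "br s a' \<in> A" by (rule A(3)[OF subsetD[OF assms(4) h(2)] h(4)])
  moreover have "br s s' \<in> S" using h assms(3) by (auto simp: lsub_def)
  ultimately show "br x y \<in> A \<boxplus> S" using subspace_add[OF A(2)] by (simp add: ssumI)
qed

lemma maximal_subalg_above:
  assumes "lsub C" "lsub S" "S \<subset> C"
  obtains M where "maximal_subalg sc br C M" "S \<subseteq> M"
proof -
  define Q where "Q N \<longleftrightarrow> lsub N \<and> S \<subseteq> N \<and> N \<subset> C" for N
  have "Q S" using assms by (simp add: Q_def)
  then obtain M where M: "Q M" "\<And>N'. Q N' \<Longrightarrow> M \<subseteq> N' \<Longrightarrow> N' = M"
    by (rule maximal_subspace[where M = C]) (auto simp: Q_def lsub_def)
  have "maximal_subalg sc br C M"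
    unfolding maximal_subalg_def subalg_iff
  proof (intro conjI allI impI)
    show "M \<subseteq> C" "lsub M" "M \<noteq> C" using M(1) by (auto simp: Q_def)
    fix N assume N: "(N \<subseteq> C \<and> lsub N) \<and> M \<subseteq> N"
    show "N = M \<or> N = C"
    proof (cases "N = C")
      case False
      then have "Q N" using N M(1) by (auto simp: Q_def)
      then show ?thesis using M(2) N by blast
    qed simp
  qed
  with that M(1) show ?thesis by (auto simp: Q_def)
qed

lemma frattini_ideal:
  assumes C: "lsub C"
  shows "ideal_in sc br C (frattini sc br C)"
    and "maximal_subalg sc br C M \<Longrightarrow> frattini sc br C \<subseteq> M"
proof -
  let ?S = "\<Union>{I. ideal_in sc br C I \<and> (\<forall>M. maximal_subalg sc br C M \<longrightarrow> I \<subseteq> M)}"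
  have e: "frattini sc br C = span ?S" by (simp add: frattini_def)
  show "frattini sc br C \<subseteq> M" if "maximal_subalg sc br C M" for M
    unfolding e using that by (intro span_minimal) (auto simp: maximal_subalg_def subalg_iff lsub_def)
  show "ideal_in sc br C (frattini sc br C)"
    unfolding ideal_in_iff
  proof (intro conjI ballI)
    show "frattini sc br C \<subseteq> C"
      unfolding e using C by (intro span_minimal) (auto simp: ideal_in_iff lsub_def)
    show "subspace (frattini sc br C)" unfolding e by simp
    fix a y assume a: "a \<in> C" and y: "y \<in> frattini sc br C"
    have "?S \<subseteq> {y. br a y \<in> span ?S}"
    proof
      fix z assume "z \<in> ?S"
      then obtain I where I: "ideal_in sc br C I" "\<forall>M. maximal_subalg sc br C M \<longrightarrow> I \<subseteq> M" "z \<in> I" by blast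
      then have "br a z \<in> ?S" using ideal_inD(3)[OF I(1) a I(3)] by blast
      then show "z \<in> {y. br a y \<in> span ?S}" by (simp add: span_base)
    qed
    moreover have "subspace {y. br a y \<in> span ?S}"
      by (intro subspaceI) (auto simp: br_add_right br_scale_right span_zero span_add span_scale)
    ultimately show "br a y \<in> frattini sc br C" using span_minimal y unfolding e by blast
  qed
qed

lemma frattini_greatest:
  assumes "ideal_in sc br C I" "\<And>M. maximal_subalg sc br C M \<Longrightarrow> I \<subseteq> M"
  shows "I \<subseteq> frattini sc br C"
proof -
  have "I \<subseteq> \<Union>{I. ideal_in sc br C I \<and> (\<forall>M. maximal_subalg sc br C M \<longrightarrow> I \<subseteq> M)}"
    using assms by blast
  then show ?thesis unfolding frattini_def using span_superset by blast
qed

text \<open>A proper \<open>S\<close> lies in a maximal subalgebra, which contains \<open>J\<close>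
  as well and therefore all of \<open>C\<close>.\<close>

lemma frattini_supplement:
  assumes C: "lsub C" and J: "J \<subseteq> frattini sc br C" and S: "lsub S" "S \<subseteq> C" "J \<boxplus> S = C"
  shows "S = C"
proof (rule ccontr)
  assume "S \<noteq> C"
  then obtain M where M: "maximal_subalg sc br C M" "S \<subseteq> M"
    using maximal_subalg_above[of C S] C S by blast
  have "J \<subseteq> M" using J frattini_ideal(2)[OF C M(1)] by blast
  moreover have "subspace M" "M \<subseteq> C" "M \<noteq> C" using M(1) by (auto simp: maximal_subalg_def subalg_iff lsub_def)
  ultimately show False using ssum_least[of M J S] M(2) S(3) by blast
qed

lemma frattini_complement_zero:
  assumes C: "lsub C" and J: "J \<subseteq> frattini sc br C" "subspace J"
    and S: "lsub S" "S \<subseteq> C" "J \<boxplus> S = C" "J \<inter> S = {0}"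
  shows "J = {0}"
proof -
  have "S = C" by (rule frattini_supplement[OF C J(1) S(1-3)])
  moreover have "J \<subseteq> C" using J(1) frattini_ideal(1)[OF C] ideal_inD(1) by blast
  ultimately show ?thesis using S(4) by blast
qed

text \<open>Take a minimal supplement \<open>S\<close>. As \<open>A\<close> is abelian,
  \<open>A \<inter> S\<close> is an ideal of \<open>C\<close>. If it is nonzero, some maximal
  subalgebra \<open>M\<close> does not contain it, and the modular law makes
  \<open>S \<inter> M\<close> a smaller supplement.\<close>

lemma abelian_ideal_complement:
  assumes C: "lsub C" and phi: "frattini sc br C = {0}"
    and A: "ideal_in sc br C A" "abelian br A"
  obtains S where "lsub S" "S \<subseteq> C" "A \<inter> S = {0}" "A \<boxplus> S = C"
proof -
  note a = ideal_inD[OF A(1)]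
  define Q where "Q S \<longleftrightarrow> lsub S \<and> S \<subseteq> C \<and> A \<boxplus> S = C" for S
  have "A \<boxplus> C = C"
    using ssum_least[of C A C] ssum_right[OF a(2)] C a(1) by (auto simp: lsub_def)
  then have "Q C" using C by (simp add: Q_def)
  then obtain S where S: "Q S" "\<And>N'. Q N' \<Longrightarrow> N' \<subseteq> S \<Longrightarrow> N' = S"
    by (rule minimal_subspace) (auto simp: Q_def lsub_def)
  have s: "lsub S" "S \<subseteq> C" "A \<boxplus> S = C" using S(1) by (auto simp: Q_def)
  let ?I = "A \<inter> S"
  have subI: "subspace ?I" using a(2) lsubD(1)[OF s(1)] by (rule subspace_inter)
  have I: "ideal_in sc br C ?I"
    unfolding ideal_in_iff
  proof (intro conjI ballI)
    show "?I \<subseteq> C" using a by blast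
    fix c y assume c: "c \<in> C" and y: "y \<in> ?I"
    obtain u t where ut: "u \<in> A" "t \<in> S" "c = u + t" using c s(3) by (blast elim: ssumE)
    have "br u y = 0" using A(2) ut y by (auto simp: abelian_def)
    then have "br c y = br t y" by (simp add: ut br_add_left)
    moreover have "br t y \<in> S" using s ut y by (auto simp: lsub_def)
    ultimately show "br c y \<in> ?I" using a(3)[OF c, of y] y by auto
  qed (rule subI)
  have "?I = {0}"
  proof (rule ccontr)
    assume ne: "?I \<noteq> {0}"
    have "\<not> ?I \<subseteq> frattini sc br C"
      using ne phi subspace_0[OF subI] by auto
    then obtain M where M: "maximal_subalg sc br C M" "\<not> ?I \<subseteq> M"
      using frattini_greatest[OF I] by blast
    have m: "lsub M" "M \<subseteq> C" using M(1) by (auto simp: maximal_subalg_def subalg_iff)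
    have "lsub (?I \<boxplus> M)" by (rule lsub_ssum[OF C I m])
    moreover have "?I \<boxplus> M \<subseteq> C" using ssum_least[of C ?I M] C a m by (auto simp: lsub_def)
    moreover have "M \<subseteq> ?I \<boxplus> M" by (rule ssum_right[OF subI])
    moreover have "?I \<subseteq> ?I \<boxplus> M" by (rule ssum_left[OF lsubD(1)[OF m(1)]])
    moreover have "\<And>N. N \<subseteq> C \<Longrightarrow> lsub N \<Longrightarrow> M \<subseteq> N \<Longrightarrow> N = M \<or> N = C"
      using M(1) unfolding maximal_subalg_def subalg_iff by blast
    ultimately have IM: "?I \<boxplus> M = C" using M(2) by metis
    have "S = S \<inter> (?I \<boxplus> M)" using IM s by blast
    also have "\<dots> = ?I \<boxplus> (S \<inter> M)" using lsubD(1)[OF s(1)] by (intro modular_law) auto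
    finally have SM: "S = ?I \<boxplus> (S \<inter> M)" .
    have "C = A \<boxplus> (?I \<boxplus> (S \<inter> M))" using s(3) SM by simp
    also have "\<dots> \<subseteq> A \<boxplus> (S \<inter> M)"
    proof
      fix x assume "x \<in> A \<boxplus> (?I \<boxplus> (S \<inter> M))"
      then obtain u i t where h: "u \<in> A" "i \<in> ?I" "t \<in> S \<inter> M" "x = u + (i + t)" by (blast elim: ssumE)
      have "(u + i) + t \<in> A \<boxplus> (S \<inter> M)" using h subspace_add[OF a(2)] by (intro ssumI) auto
      then show "x \<in> A \<boxplus> (S \<inter> M)" by (simp add: h add.assoc)
    qed
    finally have "C \<subseteq> A \<boxplus> (S \<inter> M)" .
    moreover have "lsub (S \<inter> M)" using s m by (auto simp: lsub_def subspace_inter)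
    moreover have "A \<boxplus> (S \<inter> M) \<subseteq> C" using C a s by (intro ssum_least) (auto simp: lsub_def)
    ultimately have "Q (S \<inter> M)" using s by (auto simp: Q_def)
    then have "S \<inter> M = S" by (rule S(2)) auto
    then show False using M(2) by blast
  qed
  with that s show ?thesis by blast
qed

text \<open>A complement of \<open>U\<close> in \<open>C\<close>, cut down to \<open>B\<close>. It
  is an ideal because \<open>U\<close> acts as zero on \<open>B\<close>.\<close>

lemma ideal_complement:
  assumes C: "lsub C" and phi: "frattini sc br C = {0}"
    and U: "ideal_in sc br C U" and B: "ideal_in sc br C B" "abelian br B" "U \<subseteq> B"
  obtains D where "ideal_in sc br C D" "D \<subseteq> B" "U \<inter> D = {0}" "U \<boxplus> D = B"
proof -
  have "abelian br U" using B(2,3) by (auto simp: abelian_def)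
  then obtain S where S: "lsub S" "S \<subseteq> C" "U \<inter> S = {0}" "U \<boxplus> S = C"
    by (rule abelian_ideal_complement[OF C phi U])
  note b = ideal_inD[OF B(1)]
  have "U \<boxplus> (B \<inter> S) = B" using modular_law[OF b(2) B(3), of S] S(4) b(1) by blast
  moreover have "ideal_in sc br C (B \<inter> S)"
    unfolding ideal_in_iff
  proof (intro conjI ballI)
    show "B \<inter> S \<subseteq> C" using b by blast
    show "subspace (B \<inter> S)" using b(2) lsubD(1)[OF S(1)] by (rule subspace_inter)
    fix c y assume c: "c \<in> C" and y: "y \<in> B \<inter> S"
    obtain u t where ut: "u \<in> U" "t \<in> S" "c = u + t" using c S(4) by (blast elim: ssumE)
    have "br u y = 0" using B ut y by (auto simp: abelian_def)
    then have "br c y = br t y" by (simp add: ut br_add_left)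
    moreover have "br t y \<in> S" using S ut y by (auto simp: lsub_def)
    ultimately show "br c y \<in> B \<inter> S" using b(3)[OF c, of y] y by auto
  qed
  moreover have "U \<inter> (B \<inter> S) = {0}" using S(3) B(3) by blast
  ultimately show ?thesis using that by blast
qed

text \<open>The trace of \<open>r g - g r\<close> is zero, that of the identity is the dimension.\<close>

lemma commutator_not_identity:
  assumes D: "subspace D"
    and r: "\<And>u v. r (u + v) = r u + r v" "\<And>k u. r (sc k u) = sc k (r u)" "\<And>u. u \<in> D \<Longrightarrow> r u \<in> D"
    and g: "\<And>u v. u \<in> D \<Longrightarrow> v \<in> D \<Longrightarrow> g (u + v) = g u + g v"
      "\<And>k u. u \<in> D \<Longrightarrow> g (sc k u) = sc k (g u)" "\<And>u. u \<in> D \<Longrightarrow> g u \<in> D"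
    and id: "\<And>u. u \<in> D \<Longrightarrow> r (g u) - g (r u) = u"
  shows "D = {0}"
proof -
  have P0: "subspace {0}" "{0} \<subseteq> D" using subspace_0[OF D] by auto
  obtain n :: nat and b c where
    b: "\<And>i. i < n \<Longrightarrow> b i \<in> D" and c: "\<And>i u v. c i (u + v) = c i u + c i v"
      "\<And>i k v. c i (sc k v) = k * c i v"
      "\<And>i p. i < n \<Longrightarrow> p \<in> {0} \<Longrightarrow> c i p = 0"
      "\<And>i j. i < n \<Longrightarrow> j < n \<Longrightarrow> c i (b j) = (if i = j then 1 else 0)"
      "\<And>v. v \<in> D \<Longrightarrow> v - (\<Sum>i<n. sc (c i v) (b i)) \<in> {0}"
    by (rule quotient_coordinates[OF P0 D fdim_all]) blast
  have dec: "v = (\<Sum>i<n. sc (c i v) (b i))" if "v \<in> D" for v using c(5)[OF that] by simp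
  have c0: "c i 0 = 0" for i using c(2)[of i 0 0] by simp
  have csum: "c i (\<Sum>j\<in>A. h j) = (\<Sum>j\<in>A. c i (h j))" for A i and h :: "nat \<Rightarrow> 'v"
    by (induction A rule: infinite_finite_induct) (auto simp: c0 c)
  have cdiff: "c i (u - v) = c i u - c i v" for i u v using c(1)[of i "u - v" v] by (simp add: eq_diff_eq)
  have key: "c i (h u) = (\<Sum>k<n. c i (h (b k)) * c k u)"
    if h: "\<And>u v. u \<in> D \<Longrightarrow> v \<in> D \<Longrightarrow> h (u + v) = h u + h v" "\<And>k u. u \<in> D \<Longrightarrow> h (sc k u) = sc k (h u)"
      and u: "u \<in> D" for h i u
  proof -
    have h0: "h 0 = 0" using h(2)[of 0 0] subspace_0[OF D] by simp
    have sumD: "(\<Sum>k\<in>A. sc (c k u) (b k)) \<in> D" if "A \<subseteq> {..<n}" for A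
      using that b by (intro subspace_sum[OF D] subspace_scale[OF D]) auto
    have "finite A \<Longrightarrow> A \<subseteq> {..<n} \<Longrightarrow> h (\<Sum>k\<in>A. sc (c k u) (b k)) = (\<Sum>k\<in>A. sc (c k u) (h (b k)))" for A
    proof (induction A rule: finite_induct)
      case (insert x F)
      then have "h (sc (c x u) (b x) + (\<Sum>k\<in>F. sc (c k u) (b k))) = h (sc (c x u) (b x)) + h (\<Sum>k\<in>F. sc (c k u) (b k))"
        using b subspace_scale[OF D] sumD by (intro h(1)) auto
      then show ?case using insert b by (simp add: h(2))
    qed (simp add: h0)
    from this[of "{..<n}"] have "h u = (\<Sum>k<n. sc (c k u) (h (b k)))" using dec[OF u] by simp
    then show ?thesis by (simp add: csum c mult.commute)
  qed
  have "(\<Sum>i<n. c i (r (g (b i)))) = (\<Sum>i<n. \<Sum>k<n. c i (r (b k)) * c k (g (b i)))"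
    using b g(3) by (intro sum.cong key refl) (auto simp: r)
  also have "\<dots> = (\<Sum>k<n. \<Sum>i<n. c i (r (b k)) * c k (g (b i)))" by (rule sum.swap)
  also have "\<dots> = (\<Sum>k<n. c k (g (r (b k))))"
  proof (intro sum.cong refl)
    fix k assume "k \<in> {..<n}"
    then have "c k (g (r (b k))) = (\<Sum>i<n. c k (g (b i)) * c i (r (b k)))"
      using b r(3) g by (intro key) auto
    then show "(\<Sum>i<n. c i (r (b k)) * c k (g (b i))) = c k (g (r (b k)))" by (simp add: mult.commute)
  qed
  finally have "(\<Sum>i<n. c i (r (g (b i)) - g (r (b i)))) = 0" by (simp add: cdiff sum_subtractf)
  moreover have "(\<Sum>i<n. c i (r (g (b i)) - g (r (b i)))) = (\<Sum>i<n. 1)"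
    using b id c(4) by (intro sum.cong) auto
  ultimately have "n = 0" by simp
  then have "v = 0" if "v \<in> D" for v using dec[OF that] by simp
  then show ?thesis using subspace_0[OF D] by blast
qed

text \<open>The commutator \<open>\<delta> = [T, \<psi>]\<close> is injective on an invariant complement \<open>D\<close> of its kernel.
  Composing \<open>\<psi>\<close> with a \<open>T\<close>-equivariant projection onto \<open>\<delta> D\<close> and the inverse of \<open>\<delta>\<close> gives
  \<open>g\<close> on \<open>D\<close> with \<open>T g - g T = 1\<close>, so \<open>D = {0}\<close>.\<close>

lemma commuting_derivation_zero:
  assumes B: "subspace B"
    and T: "\<And>u v. T (u + v) = T u + T v" "\<And>k u. T (sc k u) = sc k (T u)" "\<And>u. u \<in> B \<Longrightarrow> T u \<in> B"
    and cr: "\<And>U. subspace U \<Longrightarrow> U \<subseteq> B \<Longrightarrow> (\<And>u. u \<in> U \<Longrightarrow> T u \<in> U) \<Longrightarrow>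
        \<exists>D. subspace D \<and> D \<subseteq> B \<and> (\<forall>u\<in>D. T u \<in> D) \<and> U \<inter> D = {0} \<and> U \<boxplus> D = B"
    and psi: "\<And>u v. \<psi> (u + v) = \<psi> u + \<psi> v" "\<And>k u. \<psi> (sc k u) = sc k (\<psi> u)" "\<And>u. u \<in> B \<Longrightarrow> \<psi> u \<in> B"
    and comm: "\<And>v. v \<in> B \<Longrightarrow> T (T (\<psi> v) - \<psi> (T v)) = T (\<psi> (T v)) - \<psi> (T (T v))"
    and v: "v \<in> B"
  shows "T (\<psi> v) = \<psi> (T v)"
proof -
  define \<delta> where "\<delta> v = T (\<psi> v) - \<psi> (T v)" for v
  have \<delta>add: "\<delta> (u + v) = \<delta> u + \<delta> v" and \<delta>sc: "\<delta> (sc k u) = sc k (\<delta> u)" for u v k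
    by (simp_all add: \<delta>_def T psi scale_right_diff_distrib)
  have \<delta>diff: "\<delta> (u - v) = \<delta> u - \<delta> v" for u v using \<delta>add[of "u - v" v] by (simp add: eq_diff_eq)
  have Tdiff: "T (u - v) = T u - T v" for u v using T(1)[of "u - v" v] by (simp add: eq_diff_eq)
  have \<delta>0: "\<delta> 0 = 0" using \<delta>sc[of 0 0] by simp
  have T\<delta>: "T (\<delta> v) = \<delta> (T v)" if "v \<in> B" for v using comm[OF that] by (simp add: \<delta>_def)
  have \<delta>B: "\<delta> v \<in> B" if "v \<in> B" for v
    unfolding \<delta>_def using subspace_diff[OF B] T psi that by blast
  define K where "K = {v \<in> B. \<delta> v = 0}"
  have subK: "subspace K"
    using B unfolding K_def by (intro subspaceI) (auto simp: \<delta>0 \<delta>add \<delta>sc subspace_0 subspace_add subspace_scale)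
  have T0: "T 0 = 0" using T(2)[of 0 0] by simp
  have TK: "T u \<in> K" if "u \<in> K" for u using that T\<delta>[of u] T(3) by (simp add: K_def T0)
  obtain D where D: "subspace D" "D \<subseteq> B" "\<And>u. u \<in> D \<Longrightarrow> T u \<in> D" "K \<inter> D = {0}" "K \<boxplus> D = B"
    using cr[OF subK _ TK] by (auto simp: K_def)
  define W where "W = \<delta> ` D"
  have subW: "subspace W"
  proof (rule subspaceI)
    show "0 \<in> W" unfolding W_def using subspace_0[OF D(1)] \<delta>0 by (metis imageI)
    show "x + y \<in> W" if "x \<in> W" "y \<in> W" for x y
      using that subspace_add[OF D(1)] by (force simp: W_def simp flip: \<delta>add)
    show "sc k x \<in> W" if "x \<in> W" for k x
      using that subspace_scale[OF D(1)] by (force simp: W_def simp flip: \<delta>sc)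
  qed
  have TW: "T w \<in> W" if w: "w \<in> W" for w
  proof -
    obtain d where d: "w = \<delta> d" "d \<in> D" using w unfolding W_def by blast
    then have "T w = \<delta> (T d)" using T\<delta> D(2) by auto
    then show ?thesis using D(3)[OF d(2)] by (auto simp: W_def)
  qed
  have WB: "W \<subseteq> B" using \<delta>B D(2) by (auto simp: W_def)
  obtain W' where W': "subspace W'" "W' \<subseteq> B" "\<And>u. u \<in> W' \<Longrightarrow> T u \<in> W'" "W \<inter> W' = {0}" "W \<boxplus> W' = B"
    using cr[OF subW WB TW] by auto
  \<comment> \<open>\<open>g u\<close> will be the preimage under \<delta>, unique in
    \<open>D\<close>, of the component of \<open>\<psi> u\<close> in \<open>W\<close>.\<close>
  have "\<exists>u'\<in>D. \<psi> u - \<delta> u' \<in> W'" if "u \<in> D" for u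
  proof -
    have "\<psi> u \<in> W \<boxplus> W'" using W'(5) psi(3) D(2) that by blast
    then obtain w w' where w: "w \<in> W" "w' \<in> W'" "\<psi> u = w + w'" by (rule ssumE)
    obtain d where d: "w = \<delta> d" "d \<in> D" using w(1) unfolding W_def by blast
    have "\<psi> u - \<delta> d = w'" using w(3) d(1) by simp
    then show ?thesis using w(2) d(2) by metis
  qed
  then obtain g where g: "\<And>u. u \<in> D \<Longrightarrow> g u \<in> D" "\<And>u. u \<in> D \<Longrightarrow> \<psi> u - \<delta> (g u) \<in> W'" by metis
  have uniq: "g u = u'" if "u \<in> D" "u' \<in> D" "\<psi> u - \<delta> u' \<in> W'" for u u'
  proof -
    have "\<delta> (g u - u') = (\<psi> u - \<delta> u') - (\<psi> u - \<delta> (g u))" by (simp add: \<delta>diff)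
    then have "\<delta> (g u - u') \<in> W'" using subspace_diff[OF W'(1) that(3) g(2)[OF that(1)]] by simp
    moreover have gu: "g u - u' \<in> D" using subspace_diff[OF D(1) g(1)[OF that(1)] that(2)] .
    ultimately have "\<delta> (g u - u') = 0" using W'(4) by (auto simp: W_def)
    then have "g u - u' \<in> K" using gu D(2) by (auto simp: K_def)
    then have "g u - u' = 0" using gu D(4) by blast
    then show ?thesis by simp
  qed
  have "D = {0}"
  proof (rule commutator_not_identity[OF D(1) T(1,2) D(3)])
    show "g (u + v) = g u + g v" if "u \<in> D" "v \<in> D" for u v
    proof (rule uniq)
      have "\<psi> (u + v) - \<delta> (g u + g v) = (\<psi> u - \<delta> (g u)) + (\<psi> v - \<delta> (g v))"
        by (simp add: psi \<delta>add)
      also have "\<dots> \<in> W'" by (rule subspace_add[OF W'(1) g(2)[OF that(1)] g(2)[OF that(2)]])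
      finally show "\<psi> (u + v) - \<delta> (g u + g v) \<in> W'" .
    qed (use that g subspace_add[OF D(1)] in auto)
    show "g (sc k u) = sc k (g u)" if "u \<in> D" for k u
    proof (rule uniq)
      have "\<psi> (sc k u) - \<delta> (sc k (g u)) = sc k (\<psi> u - \<delta> (g u))"
        by (simp add: psi \<delta>sc scale_right_diff_distrib)
      also have "\<dots> \<in> W'" by (rule subspace_scale[OF W'(1) g(2)[OF that]])
      finally show "\<psi> (sc k u) - \<delta> (sc k (g u)) \<in> W'" .
    qed (use that g subspace_scale[OF D(1)] in auto)
    show "T (g u) - g (T u) = u" if u: "u \<in> D" for u
    proof -
      have "g (T u) = T (g u) - u"
      proof (rule uniq)
        have "\<psi> (T u) - \<delta> (T (g u) - u) = T (\<psi> u) - T (\<delta> (g u))"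
          using T\<delta>[of "g u"] g(1)[OF u] D(2) by (auto simp: \<delta>diff \<delta>_def[of u])
        also have "\<dots> = T (\<psi> u - \<delta> (g u))" by (simp add: Tdiff)
        also have "\<dots> \<in> W'" by (rule W'(3)[OF g(2)[OF u]])
        finally show "\<psi> (T u) - \<delta> (T (g u) - u) \<in> W'" .
      qed (use u D g subspace_diff[OF D(1)] in auto)
      then show ?thesis by simp
    qed
  qed (use g(1) in auto)
  then have "B = K" using D(5) by (auto simp: ssum_def)
  with v have "v \<in> K" by simp
  then show ?thesis by (simp add: K_def \<delta>_def)
qed

end


section \<open>Linear maps as modules\<close>

context lie_alg
begin

definition scf :: "'f \<Rightarrow> ('v \<Rightarrow> 'v) \<Rightarrow> 'v \<Rightarrow> 'v" where
  "scf k \<phi> = (\<lambda>v. sc k (\<phi> v))"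

text \<open>The commutator of \<open>ad x\<close> with \<phi>, which is the standard action on
  Hom(L, L).\<close>

definition actf :: "'v \<Rightarrow> ('v \<Rightarrow> 'v) \<Rightarrow> 'v \<Rightarrow> 'v" where
  "actf x \<phi> = (\<lambda>v. br x (\<phi> v) - \<phi> (br x v))"

definition lin :: "('v \<Rightarrow> 'v) \<Rightarrow> bool" where
  "lin \<phi> \<longleftrightarrow> (\<forall>u v. \<phi> (u + v) = \<phi> u + \<phi> v) \<and> (\<forall>k u. \<phi> (sc k u) = sc k (\<phi> u))"

lemma linD: "lin \<phi> \<Longrightarrow> \<phi> (u + v) = \<phi> u + \<phi> v" "lin \<phi> \<Longrightarrow> \<phi> (sc k u) = sc k (\<phi> u)"
  by (auto simp: lin_def)

lemma lin_zero: "lin \<phi> \<Longrightarrow> \<phi> 0 = 0"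
  using linD(2)[of \<phi> 0 0] by simp

lemma lin_diff: "lin \<phi> \<Longrightarrow> \<phi> (u - v) = \<phi> u - \<phi> v"
  using linD(1)[of \<phi> "u - v" v] by (simp add: eq_diff_eq)

lemma lin_sum: "lin \<phi> \<Longrightarrow> \<phi> (\<Sum>i\<in>A. h i) = (\<Sum>i\<in>A. \<phi> (h i))"
  by (induction A rule: infinite_finite_induct) (auto simp: lin_zero linD)

lemma lin_actf: "lin \<phi> \<Longrightarrow> lin (actf x \<phi>)"
  by (auto simp: lin_def actf_def br_add_right br_scale_right scale_right_diff_distrib)

sublocale F: vspace scf
  by unfold_locales (auto simp: scf_def fun_eq_iff algebra_simps)

lemma projection_exists:
  assumes "subspace A"
  obtains \<pi> where "lin \<pi>" "\<And>v. \<pi> v \<in> A" "\<And>a. a \<in> A \<Longrightarrow> \<pi> a = a"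
proof -
  have P0: "subspace {0}" "{0} \<subseteq> A" using subspace_0[OF assms] by auto
  obtain n :: nat and b c where
    b: "\<And>i. i < n \<Longrightarrow> b i \<in> A" and c: "\<And>i u v. c i (u + v) = c i u + c i v"
      "\<And>i k v. c i (sc k v) = k * c i v"
      "\<And>i p. i < n \<Longrightarrow> p \<in> {0} \<Longrightarrow> c i p = 0"
      "\<And>i j. i < n \<Longrightarrow> j < n \<Longrightarrow> c i (b j) = (if i = j then 1 else 0)"
      "\<And>v. v \<in> A \<Longrightarrow> v - (\<Sum>i<n. sc (c i v) (b i)) \<in> {0}"
    by (rule quotient_coordinates[OF P0 assms fdim_all]) blast
  show ?thesis
  proof (rule that[of "\<lambda>v. \<Sum>i<n. sc (c i v) (b i)"])
    show "lin (\<lambda>v. \<Sum>i<n. sc (c i v) (b i))"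
      by (auto simp: lin_def c scale_left_distrib sum.distrib scale_sum_right)
    show "(\<Sum>i<n. sc (c i v) (b i)) \<in> A" for v
      using b by (intro subspace_sum[OF assms] subspace_scale[OF assms]) auto
    show "(\<Sum>i<n. sc (c i a) (b i)) = a" if "a \<in> A" for a using c(5)[OF that] by simp
  qed
qed

lemma fdim_lin: "F.fdim {\<phi>. lin \<phi>}"
proof -
  have P0: "subspace {0}" "{0} \<subseteq> (UNIV :: 'v set)" by auto
  obtain n :: nat and b c where
    b: "\<And>i. i < n \<Longrightarrow> b i \<in> (UNIV :: 'v set)" and c: "\<And>i u v. c i (u + v) = c i u + c i v"
      "\<And>i k v. c i (sc k v) = k * c i v"
      "\<And>i p. i < n \<Longrightarrow> p \<in> {0} \<Longrightarrow> c i p = 0"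
      "\<And>i j. i < n \<Longrightarrow> j < n \<Longrightarrow> c i (b j) = (if i = j then 1 else 0)"
      "\<And>v. v \<in> UNIV \<Longrightarrow> v - (\<Sum>i<n. sc (c i v) (b i)) \<in> {0}"
    by (rule quotient_coordinates[OF P0 subspace_UNIV fdim_all]) blast
  have dec: "v = (\<Sum>i<n. sc (c i v) (b i))" for v using c(5)[OF UNIV_I, of v] by simp
  define E where "E = (\<lambda>(i, j) v. sc (c i v) (b j))"
  have "\<phi> \<in> F.span (E ` ({..<n} \<times> {..<n}))" if "lin \<phi>" for \<phi>
  proof -
    have "\<phi> = (\<Sum>i<n. \<Sum>j<n. scf (c j (\<phi> (b i))) (E (i, j)))"
    proof
      fix v
      have "\<phi> v = \<phi> (\<Sum>i<n. sc (c i v) (b i))" using dec[of v] by simp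
      also have "\<dots> = (\<Sum>i<n. sc (c i v) (\<phi> (b i)))" by (simp add: lin_sum[OF that] linD(2)[OF that])
      also have "\<dots> = (\<Sum>i<n. sc (c i v) (\<Sum>j<n. sc (c j (\<phi> (b i))) (b j)))"
        using dec by simp
      also have "\<dots> = (\<Sum>i<n. \<Sum>j<n. scf (c j (\<phi> (b i))) (E (i, j)) v)"
        by (simp add: scf_def E_def scale_sum_right mult.commute)
      also have "\<dots> = (\<Sum>i<n. \<Sum>j<n. scf (c j (\<phi> (b i))) (E (i, j))) v"
      proof -
        have ap: "(\<Sum>i\<in>A. h i) v = (\<Sum>i\<in>A. h i v)" for A :: "nat set" and h :: "nat \<Rightarrow> 'v \<Rightarrow> 'v"
          by (induction A rule: infinite_finite_induct) auto
        show ?thesis by (simp add: ap)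
      qed
      finally show "\<phi> v = (\<Sum>i<n. \<Sum>j<n. scf (c j (\<phi> (b i))) (E (i, j))) v" .
    qed
    also have "\<dots> \<in> F.span (E ` ({..<n} \<times> {..<n}))"
      by (intro F.span_sum F.span_scale F.span_base) auto
    finally show ?thesis .
  qed
  then show ?thesis unfolding F.fdim_def by (intro exI[of _ "E ` ({..<n} \<times> {..<n})"]) auto
qed

lemma lin_module:
  assumes "F.subspace M" "\<And>\<phi>. \<phi> \<in> M \<Longrightarrow> lin \<phi>" "\<And>x \<phi>. \<phi> \<in> M \<Longrightarrow> actf x \<phi> \<in> M"
    and "F.subspace P" "P \<subseteq> M" "\<And>x \<phi>. \<phi> \<in> P \<Longrightarrow> actf x \<phi> \<in> P"
  shows "lie_mod sc br scf actf M P"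
proof unfold_locales
  show "actf x (u + v) = actf x u + actf x v" for x u v
    by (simp add: actf_def fun_eq_iff br_add_right)
  show "actf x (scf k u) = scf k (actf x u)" for x k u
    by (simp add: actf_def scf_def fun_eq_iff br_scale_right scale_right_diff_distrib)
  show "actf (x + y) m = actf x m + actf y m" if "m \<in> M" for m x y
    using linD[OF assms(2)[OF that]] by (simp add: actf_def fun_eq_iff br_add_left)
  show "actf (sc k x) m = scf k (actf x m)" if "m \<in> M" for m k x
    using linD[OF assms(2)[OF that]] by (simp add: actf_def scf_def fun_eq_iff br_scale_left scale_right_diff_distrib)
  show "actf (br x y) m = actf x (actf y m) - actf y (actf x m)" if "m \<in> M" for m x y
    using lin_diff[OF assms(2)[OF that]] by (simp add: actf_def fun_eq_iff br_diff_right jacobi)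
  show "F.fdim M" using F.fdim_mono[OF fdim_lin] assms(2) by blast
qed (use assms in auto)

text \<open>The cocycles come from a linear projection onto \<open>A\<close>, acted upon by \<open>L\<close>.  First it is made
  equivariant on \<open>B\<close>, and its kernel \<open>D\<close> in \<open>B\<close> is an ideal; then it is corrected so that each
  \<open>x\<close> moves it by some \<open>ad u\<close> with \<open>u \<in> A\<close>, and its stabilizer is the complement.\<close>

lemma semisimple_complement:
  assumes A: "lideal A" "\<And>J. lideal J \<Longrightarrow> J \<subseteq> A \<Longrightarrow> J \<noteq> {0} \<Longrightarrow> J = A"
    and B: "lideal B" "abelian br B" "A \<subseteq> B" and ss: "semisimple_mod B"
  obtains S where "lsub S" "A \<boxplus> S = UNIV" "A \<inter> S = {0}"
proof -
  note a = lidealD[OF A(1)] and b = lidealD[OF B(1)]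
  have ab: "br u v = 0" if "u \<in> B" "v \<in> B" for u v using B(2) that by (auto simp: abelian_def)
  obtain \<pi> where \<pi>: "lin \<pi>" "\<And>v. \<pi> v \<in> A" "\<And>a. a \<in> A \<Longrightarrow> \<pi> a = a"
    by (rule projection_exists[OF a(1)]) blast
  have Asub: "0 \<in> A" "\<And>u v. u \<in> A \<Longrightarrow> v \<in> A \<Longrightarrow> u + v \<in> A" "\<And>u v. u \<in> A \<Longrightarrow> v \<in> A \<Longrightarrow> u - v \<in> A"
      "\<And>k u. u \<in> A \<Longrightarrow> sc k u \<in> A"
    using a(1) subspace_0 subspace_add subspace_diff subspace_scale by blast+
  \<comment> \<open>Maps into \<open>A\<close> that are a scalar on \<open>A\<close>. The action
    sends \<open>M Z\<close> into \<open>M0 Z\<close>, because scalars commute with every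
    \<open>ad x\<close>. The set \<open>Z\<close> is empty at first and later the ideal
    \<open>D\<close>, so that the second correction preserves the kernel found by the first.\<close>
  define M where "M Z = {\<phi>. lin \<phi> \<and> (\<forall>v. \<phi> v \<in> A) \<and> (\<forall>z\<in>Z. \<phi> z = 0) \<and> (\<exists>k. \<forall>a\<in>A. \<phi> a = sc k a)}" for Z
  define M0 where "M0 Z = {\<phi>. lin \<phi> \<and> (\<forall>v. \<phi> v \<in> A) \<and> (\<forall>z\<in>Z. \<phi> z = 0) \<and> (\<forall>a\<in>A. \<phi> a = 0)}" for Z
  have subM: "F.subspace (M Z)" for Z
  proof (rule F.subspaceI)
    show "0 \<in> M Z" unfolding M_def using Asub by (auto simp: lin_def intro!: exI[of _ 0])
    show "u + v \<in> M Z" if uv: "u \<in> M Z" "v \<in> M Z" for u v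
    proof -
      obtain k k' where "\<forall>a\<in>A. u a = sc k a" "\<forall>a\<in>A. v a = sc k' a" using uv by (auto simp: M_def)
      then have "\<forall>a\<in>A. (u + v) a = sc (k + k') a" by (simp add: scale_left_distrib)
      then have "\<exists>k. \<forall>a\<in>A. (u + v) a = sc k a" by blast
      then show ?thesis using uv Asub by (auto simp: M_def lin_def algebra_simps)
    qed
    show "scf c u \<in> M Z" if u: "u \<in> M Z" for c u
    proof -
      obtain k where "\<forall>a\<in>A. u a = sc k a" using u by (auto simp: M_def)
      then have "\<forall>a\<in>A. (scf c u) a = sc (c * k) a" by (simp add: scf_def)
      then have "\<exists>k. \<forall>a\<in>A. (scf c u) a = sc k a" by blast
      then show ?thesis using u Asub by (auto simp: M_def lin_def scf_def algebra_simps)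
    qed
  qed
  have subM0: "F.subspace (M0 Z)" for Z
    using Asub unfolding M0_def
    by (intro F.subspaceI) (auto simp: lin_def scf_def algebra_simps)
  have MM0: "M0 Z \<subseteq> M Z" for Z
    unfolding M_def M0_def by (auto intro!: exI[of _ 0])
  have actM0: "actf x \<phi> \<in> M0 Z" if Z: "\<And>x z. z \<in> Z \<Longrightarrow> br x z \<in> Z" and \<phi>: "\<phi> \<in> M Z" for x \<phi> Z
  proof -
    obtain k where k: "\<forall>a\<in>A. \<phi> a = sc k a" using \<phi> by (auto simp: M_def)
    have l: "lin \<phi>" and r: "\<phi> v \<in> A" and z: "z \<in> Z \<Longrightarrow> \<phi> z = 0" for v z using \<phi> by (auto simp: M_def)
    have "actf x \<phi> v \<in> A" for v unfolding actf_def using a(2)[OF r] r Asub(3) by blast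
    moreover have "actf x \<phi> u = 0" if "u \<in> A" for u
      using k a(2)[OF that] that by (simp add: actf_def br_scale_right)
    moreover have "actf x \<phi> u = 0" if "u \<in> Z" for u
      using z[OF that] z[OF Z[OF that]] by (simp add: actf_def)
    ultimately show ?thesis using lin_actf[OF l] by (auto simp: M0_def)
  qed
  have Mlin: "\<phi> \<in> M Z \<Longrightarrow> lin \<phi>" for \<phi> Z by (simp add: M_def)
  \<comment> \<open>Dividing by the maps that vanish on \<open>B\<close> retains only restrictions
    to \<open>B\<close>, and on those \<open>B\<close> acts trivially because it is abelian.\<close>
  define P1 where "P1 = {\<phi>. lin \<phi> \<and> (\<forall>v. \<phi> v \<in> A) \<and> (\<forall>z\<in>B. \<phi> z = 0)}"
  have subP1: "F.subspace P1"
    using Asub unfolding P1_def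
    by (intro F.subspaceI) (auto simp: lin_def scf_def algebra_simps)
  have P1M0: "P1 \<subseteq> M0 {}" using B(3) by (auto simp: P1_def M0_def)
  have actP1: "actf x \<phi> \<in> P1" if "\<phi> \<in> P1" for x \<phi>
  proof -
    have r: "\<phi> v \<in> A" for v using that by (auto simp: P1_def)
    have "actf x \<phi> v \<in> A" for v unfolding actf_def using a(2)[OF r] r Asub(3) by blast
    then show ?thesis using that b(2) lin_actf by (auto simp: P1_def actf_def)
  qed
  interpret Q1: lie_mod sc br scf actf "M {}" P1
  proof (rule lin_module[OF subM Mlin _ subP1 _ actP1])
    show "actf x \<phi> \<in> M {}" if "\<phi> \<in> M {}" for x \<phi>
      using subsetD[OF MM0 actM0[OF _ that]] by blast
    show "P1 \<subseteq> M {}" using P1M0 MM0 by blast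
  qed
  have "\<pi> \<in> M {}" using \<pi> by (auto simp: M_def intro!: exI[of _ 1])
  moreover have "actf x \<phi> \<in> P1" if x: "x \<in> B" and \<phi>: "\<phi> \<in> M {}" for x \<phi>
  proof -
    have r: "\<phi> v \<in> A" and l: "lin \<phi>" for v using \<phi> by (auto simp: M_def)
    have "actf x \<phi> z = 0" if "z \<in> B" for z
      using ab[OF x that] ab[OF x, of "\<phi> z"] r B(3) lin_zero[OF l] by (auto simp: actf_def)
    moreover have "actf x \<phi> \<in> M0 {}" using actM0[of "{}"] \<phi> by blast
    ultimately show ?thesis by (auto simp: P1_def M0_def)
  qed
  ultimately obtain m0 where m0: "m0 \<in> M0 {}" "\<And>x. actf x (\<pi> - m0) \<in> P1"
    using Q1.cocycle_splits[OF subM0 P1M0 MM0 _ B(1) ss] actM0[of "{}"] by (metis empty_iff)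
  define \<phi> where "\<phi> = \<pi> - m0"
  have \<phi>: "lin \<phi>" "\<And>v. \<phi> v \<in> A" "\<And>a. a \<in> A \<Longrightarrow> \<phi> a = a"
    using \<pi> m0(1) Asub by (auto simp: \<phi>_def M0_def lin_def algebra_simps)
  have \<phi>hom: "\<phi> (br x z) = br x (\<phi> z)" if "z \<in> B" for x z
    using m0(2)[of x] that unfolding \<phi>_def[symmetric] by (simp add: P1_def actf_def)
  define D where "D = {z \<in> B. \<phi> z = 0}"
  have D: "lideal D"
    using b \<phi>hom \<phi>(1) unfolding D_def lideal_def
    by (auto intro!: subspaceI simp: lin_zero linD subspace_0 subspace_add subspace_scale)
  have BAD: "z - \<phi> z \<in> D" if "z \<in> B" for z
    using subspace_diff[OF b(1) that subsetD[OF B(3) \<phi>(2)]] \<phi>(3)[OF \<phi>(2)]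
    by (simp add: D_def lin_diff[OF \<phi>(1)])
  \<comment> \<open>The maps \<open>l \<mapsto> [l, u]\<close> with \<open>u\<close> in
    \<open>A\<close>. Modulo them \<open>B\<close> acts trivially on \<open>M D\<close>, since each
    element of \<open>B\<close> differs from its image under \<phi> by an element of the ideal
    \<open>D\<close>.\<close>
  define P2 where "P2 = (\<lambda>u l. br l u) ` A"
  have P2M0: "P2 \<subseteq> M0 D"
  proof
    fix \<psi> assume "\<psi> \<in> P2"
    then obtain u where u: "u \<in> A" "\<psi> = (\<lambda>l. br l u)" by (auto simp: P2_def)
    have "br z u = 0" if "z \<in> B" for z using ab that u B(3) by blast
    then show "\<psi> \<in> M0 D" using u a(2) B(3)
      by (auto simp: M0_def D_def lin_def br_add_left br_scale_left)
  qed
  have subP2: "F.subspace P2"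
  proof (rule F.subspaceI)
    show "0 \<in> P2" using Asub(1) by (auto simp: P2_def fun_eq_iff intro!: image_eqI[of _ _ 0])
    show "u + v \<in> P2" if uv: "u \<in> P2" "v \<in> P2" for u v
    proof -
      obtain p q where "p \<in> A" "q \<in> A" "u = (\<lambda>l. br l p)" "v = (\<lambda>l. br l q)"
        using uv unfolding P2_def by blast
      then show ?thesis unfolding P2_def using Asub(2)[of p q]
        by (intro image_eqI[of _ _ "p + q"]) (auto simp: fun_eq_iff br_add_right)
    qed
    show "scf k u \<in> P2" if u: "u \<in> P2" for k u
    proof -
      obtain p where "p \<in> A" "u = (\<lambda>l. br l p)" using u unfolding P2_def by blast
      then show ?thesis unfolding P2_def using Asub(4)[of p k]
        by (intro image_eqI[of _ _ "sc k p"]) (auto simp: fun_eq_iff scf_def br_scale_right)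
    qed
  qed
  have actP2: "actf x \<psi> \<in> P2" if \<psi>: "\<psi> \<in> P2" for x \<psi>
  proof -
    obtain p where "p \<in> A" "\<psi> = (\<lambda>l. br l p)" using \<psi> unfolding P2_def by blast
    then show ?thesis unfolding P2_def using a(2)[of p x]
      by (intro image_eqI[of _ _ "br x p"]) (auto simp: fun_eq_iff actf_def jacobi'[of x])
  qed
  have actD: "actf x \<psi> \<in> M0 D" if "\<psi> \<in> M D" for x \<psi>
    using actM0[OF lidealD(2)[OF D] that] .
  interpret Q2: lie_mod sc br scf actf "M D" P2
  proof (rule lin_module[OF subM Mlin _ subP2 _ actP2])
    show "actf x \<phi> \<in> M D" if "\<phi> \<in> M D" for x \<phi>
      using subsetD[OF MM0 actD[OF that]] .
    show "P2 \<subseteq> M D" using P2M0 MM0 by blast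
  qed
  have \<phi>M: "\<phi> \<in> M D" using \<phi> by (auto simp: M_def D_def intro!: exI[of _ 1])
  have BP2: "actf x \<psi> \<in> P2" if x: "x \<in> B" and \<psi>: "\<psi> \<in> M D" for x \<psi>
  proof -
    obtain k where k: "\<forall>a\<in>A. \<psi> a = sc k a" using \<psi> by (auto simp: M_def)
    have l: "lin \<psi>" and r: "\<psi> v \<in> A" and z: "z \<in> D \<Longrightarrow> \<psi> z = 0" for v z using \<psi> by (auto simp: M_def)
    have "actf x \<psi> l = br l (sc k (\<phi> x))" for l
    proof -
      have "br x l = br (\<phi> x) l + br (x - \<phi> x) l" by (simp flip: br_add_left)
      then have "\<psi> (br x l) = \<psi> (br (\<phi> x) l) + \<psi> (br (x - \<phi> x) l)" using linD(1)[OF \<open>lin \<psi>\<close>] by simp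
      also have "\<psi> (br (x - \<phi> x) l) = 0" by (rule z[OF lidealD(3)[OF D BAD[OF x]]])
      also have "\<psi> (br (\<phi> x) l) = sc k (br (\<phi> x) l)" using k a(3)[OF \<phi>(2)] by blast
      finally have "\<psi> (br x l) = sc k (br (\<phi> x) l)" by simp
      moreover have "br x (\<psi> l) = 0" using ab[OF x] r B(3) by blast
      ultimately show ?thesis using br_anti[of "\<phi> x" l] by (simp add: actf_def br_scale_right)
    qed
    then show ?thesis unfolding P2_def using Asub(4)[OF \<phi>(2)[of x], of k]
      by (intro image_eqI[of _ _ "sc k (\<phi> x)"]) (auto simp: fun_eq_iff)
  qed
  obtain n0 where n0: "n0 \<in> M0 D" "\<And>x. actf x (\<phi> - n0) \<in> P2"
    using Q2.cocycle_splits[OF subM0 P2M0 MM0 actD B(1) ss BP2 \<phi>M] by blast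
  define \<chi> where "\<chi> = \<phi> - n0"
  have \<chi>: "lin \<chi>" "\<And>v. \<chi> v \<in> A" "\<And>a. a \<in> A \<Longrightarrow> \<chi> a = a"
    using \<phi> n0(1) Asub by (auto simp: \<chi>_def M0_def lin_def algebra_simps)
  have "\<exists>u\<in>A. \<forall>l. actf x \<chi> l = br l u" for x
    using n0(2)[of x] unfolding \<chi>_def[symmetric] by (auto simp: P2_def)
  then obtain u where u: "\<And>x. u x \<in> A" "\<And>x l. actf x \<chi> l = br l (u x)" by metis
  have actA: "actf p \<chi> l = br l p" if "p \<in> A" for p l
  proof -
    have "br p (\<chi> l) = 0" using ab that \<chi>(2) B(3) by blast
    then show ?thesis using \<chi>(3)[OF a(3)[OF that], of l] br_anti[of l p] by (simp add: actf_def)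
  qed
  have \<chi>D: "\<chi> \<in> M D" using \<phi>M n0(1) MM0 F.subspace_diff[OF subM] unfolding \<chi>_def by blast
  \<comment> \<open>The stabilizer of \<chi> meets \<open>A\<close> in the elements that are central
    in \<open>L\<close>. By minimality of \<open>A\<close> these are 0 or all of \<open>A\<close>;
    in the second case \<chi> kills every bracket and its kernel is the complement.\<close>
  define Ce where "Ce = {p \<in> A. \<forall>l. br l p = 0}"
  have Ce: "lideal Ce"
    using Asub unfolding Ce_def lideal_def
    by (auto intro!: subspaceI simp: br_add_right br_scale_right)
  show ?thesis
  proof (cases "Ce = {0}")
    case True
    define S where "S = {x. actf x \<chi> = 0}"
    show ?thesis
    proof (rule that[of S])
      show "lsub S" unfolding lsub_def
      proof (intro conjI ballI)
        show "subspace S" unfolding S_def using \<chi>D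
          by (intro subspaceI) (auto simp: Q2.act_zero_left Q2.act_add_left Q2.act_scale_left)
        show "br x y \<in> S" if "x \<in> S" "y \<in> S" for x y
          using that \<chi>D by (simp add: S_def Q2.act_br Q2.act_zero)
      qed
      show "A \<boxplus> S = UNIV"
      proof -
        have "x \<in> A \<boxplus> S" for x
        proof -
          have "actf (x - u x) \<chi> = 0"
            using Q2.act_diff_left[OF \<chi>D] u(2)[of x] actA[OF u(1)] by (simp add: fun_eq_iff)
          then show ?thesis using ssumI[OF u(1)[of x], of "x - u x" S] by (simp add: S_def)
        qed
        then show ?thesis by blast
      qed
      have "p = 0" if "p \<in> A" "p \<in> S" for p
      proof -
        have "br l p = 0" for l using that(2) actA[OF that(1), of l] by (simp add: S_def)
        then have "p \<in> Ce" using that(1) by (simp add: Ce_def)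
        then show ?thesis using True by simp
      qed
      then show "A \<inter> S = {0}" using Asub(1) \<chi>D by (auto simp: S_def Q2.act_zero_left)
    qed
  next
    case False
    then have "Ce = A" using A(2)[OF Ce] by (auto simp: Ce_def)
    then have cen: "br l p = 0" if "p \<in> A" for p l using that by (auto simp: Ce_def)
    have \<chi>br: "\<chi> (br x l) = 0" for x l
      using u(2)[of x l] cen[OF u(1)] cen[OF \<chi>(2)] by (simp add: actf_def)
    show ?thesis
    proof (rule that[of "{x. \<chi> x = 0}"])
      show "lsub {x. \<chi> x = 0}"
        unfolding lsub_def using \<chi>br \<chi>(1)
        by (auto intro!: subspaceI simp: lin_zero linD)
      have "x \<in> A \<boxplus> {x. \<chi> x = 0}" for x
        using ssumI[OF \<chi>(2)[of x], of "x - \<chi> x" "{x. \<chi> x = 0}"] \<chi>(3)[OF \<chi>(2)[of x]]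
        by (simp add: lin_diff[OF \<chi>(1)])
      then show "A \<boxplus> {x. \<chi> x = 0} = UNIV" by blast
      show "A \<inter> {x. \<chi> x = 0} = {0}" using \<chi>(3) Asub(1) lin_zero[OF \<chi>(1)] by auto
    qed
  qed
qed

end


section \<open>An abelian ideal modulo a maximal abelian ideal\<close>

context vspace
begin

lemma ssum_assoc: "(U \<boxplus> V) \<boxplus> W = U \<boxplus> (V \<boxplus> W)"
proof
  show "(U \<boxplus> V) \<boxplus> W \<subseteq> U \<boxplus> (V \<boxplus> W)"
  proof
    fix x assume "x \<in> (U \<boxplus> V) \<boxplus> W"
    then obtain u v w where "u \<in> U" "v \<in> V" "w \<in> W" "x = u + v + w" by (blast elim: ssumE)
    then show "x \<in> U \<boxplus> (V \<boxplus> W)" using ssumI[of u U "v + w" "V \<boxplus> W"] ssumI[of v V w W] by (simp add: add.assoc)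
  qed
  show "U \<boxplus> (V \<boxplus> W) \<subseteq> (U \<boxplus> V) \<boxplus> W"
  proof
    fix x assume "x \<in> U \<boxplus> (V \<boxplus> W)"
    then obtain u v w where "u \<in> U" "v \<in> V" "w \<in> W" "x = u + (v + w)" by (blast elim: ssumE)
    then show "x \<in> (U \<boxplus> V) \<boxplus> W" using ssumI[of "u + v" "U \<boxplus> V" w W] ssumI[of u U v V] by (simp add: add.assoc)
  qed
qed

lemma ssum_commute: "U \<boxplus> V = V \<boxplus> U"
  unfolding ssum_def by (metis (no_types, opaque_lifting) add.commute)

end

context lie_alg
begin

lemma lsub_span_single: "lsub (span {x})"
proof -
  have "br u v = 0" if "u \<in> span {x}" "v \<in> span {x}" for u v
    using that by (auto simp: span_singleton br_scale_left br_scale_right)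
  then show ?thesis by (simp add: lsub_def span_zero)
qed

lemma lideal_ideal_in: "lideal I \<Longrightarrow> I \<subseteq> C \<Longrightarrow> ideal_in sc br C I"
  by (auto simp: ideal_in_iff lideal_def)

lemma lsub_UNIV: "lsub UNIV"
  by (simp add: lsub_def)

lemma projection_along:
  assumes A: "subspace A" and D: "subspace D" and AD: "A \<inter> D = {0}" "A \<boxplus> D = UNIV"
  obtains \<pi> where "lin \<pi>" "\<And>v. \<pi> v \<in> A" "\<And>a. a \<in> A \<Longrightarrow> \<pi> a = a" "\<And>d. d \<in> D \<Longrightarrow> \<pi> d = 0"
proof -
  have "\<exists>a\<in>A. v - a \<in> D" for v
  proof -
    have "v \<in> A \<boxplus> D" using AD by blast
    then obtain a d where "a \<in> A" "d \<in> D" "v = a + d" by (rule ssumE)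
    then have "v - a \<in> D" by simp
    with \<open>a \<in> A\<close> show ?thesis by (rule bexI[rotated])
  qed
  then obtain \<pi> where \<pi>: "\<And>v. \<pi> v \<in> A" "\<And>v. v - \<pi> v \<in> D" by metis
  have uniq: "\<pi> v = a" if "a \<in> A" "v - a \<in> D" for v a
  proof -
    have "\<pi> v - a = (v - a) - (v - \<pi> v)" by simp
    then have "\<pi> v - a \<in> D" using subspace_diff[OF D that(2) \<pi>(2)[of v]] by simp
    moreover have "\<pi> v - a \<in> A" using subspace_diff[OF A \<pi>(1) that(1)] .
    ultimately have "\<pi> v - a = 0" using AD by blast
    then show ?thesis by simp
  qed
  have "lin \<pi>"
    unfolding lin_def
  proof (intro conjI allI)
    show "\<pi> (u + v) = \<pi> u + \<pi> v" for u v
    proof (rule uniq)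
      show "u + v - (\<pi> u + \<pi> v) \<in> D"
        using subspace_add[OF D \<pi>(2)[of u] \<pi>(2)[of v]] by (simp add: algebra_simps)
    qed (rule subspace_add[OF A \<pi>(1) \<pi>(1)])
    show "\<pi> (sc k u) = sc k (\<pi> u)" for k u
    proof (rule uniq)
      show "sc k u - sc k (\<pi> u) \<in> D"
        using subspace_scale[OF D \<pi>(2)[of u], of k] by (simp add: scale_right_diff_distrib)
    qed (rule subspace_scale[OF A \<pi>(1)])
  qed
  moreover have "\<pi> a = a" if "a \<in> A" for a by (rule uniq[OF that]) (simp add: subspace_0[OF D])
  moreover have "\<pi> d = 0" if "d \<in> D" for d by (rule uniq[OF subspace_0[OF A]]) (simp add: that)
  ultimately show ?thesis using that \<pi>(1) by blast
qed

text \<open>\<open>B + Fx\<close> is a proper subalgebra, so its Frattini ideal is zero, and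
  \<open>U\<close>, an ideal of it inside the abelian ideal \<open>B\<close>, has a complement
  there.\<close>

lemma abelian_ideal_reducible:
  assumes proper: "\<And>C. lsub C \<Longrightarrow> C \<noteq> UNIV \<Longrightarrow> frattini sc br C = {0}"
    and B: "lideal B" "abelian br B" and big: "B \<boxplus> span {x} \<noteq> UNIV"
    and U: "subspace U" "U \<subseteq> B" "\<And>u. u \<in> U \<Longrightarrow> br x u \<in> U"
  shows "\<exists>D. subspace D \<and> D \<subseteq> B \<and> (\<forall>u\<in>D. br x u \<in> D) \<and> U \<inter> D = {0} \<and> U \<boxplus> D = B"
proof -
  let ?C = "B \<boxplus> span {x}"
  have C: "lsub ?C"
    by (rule lsub_ssum[OF lsub_UNIV _ lsub_span_single]) (use B in \<open>auto simp: ideal_in_UNIV\<close>)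
  have BC: "B \<subseteq> ?C" by (rule ssum_left) simp
  have xC: "x \<in> ?C" using ssum_right[OF lidealD(1)[OF B(1)], of "span {x}"] span_base[of x "{x}"] by blast
  have UC: "ideal_in sc br ?C U"
    unfolding ideal_in_iff
  proof (intro conjI ballI)
    fix c u assume c: "c \<in> ?C" and u: "u \<in> U"
    obtain b k where bk: "b \<in> B" "c = b + sc k x" using c by (auto elim!: ssumE simp: span_singleton)
    have "br b u = 0" using B(2) u U(2) bk(1) by (auto simp: abelian_def)
    then show "br c u \<in> U"
      using bk(2) subspace_scale[OF U(1) U(3)[OF u]] by (simp add: br_add_left br_scale_left)
  qed (use U BC in auto)
  obtain D where D: "ideal_in sc br ?C D" "D \<subseteq> B" "U \<inter> D = {0}" "U \<boxplus> D = B"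
    by (rule ideal_complement[OF C proper[OF C big] UC lideal_ideal_in[OF B(1) BC] B(2) U(2)])
  then show ?thesis using ideal_inD(2,3)[OF D(1)] xC by (intro exI[of _ D]) auto
qed

text \<open>An element \<open>r\<close> of \<open>I\<close> outside \<open>B\<close> commutes with the action of \<open>L\<close> on \<open>B\<close>, which splits into the
  ideals \<open>B0\<close> (kernel of \<open>ad r\<close>) and \<open>B1\<close> (image), and \<open>H\<close> is a proper complement of \<open>B1\<close>.  If \<open>A\<close> lies
  in \<open>B0\<close>, a complement in \<open>H\<close> does.  Otherwise \<open>L\<close> is \<open>B\<close> plus a subalgebra \<open>K\<close> in which \<open>r\<close> may be
  taken central; a projection equivariant under a complement \<open>K1\<close> of \<open>r\<close> in \<open>K\<close> is then
  corrected, by Fitting's lemma for \<open>ad r\<close>, to commute with \<open>r\<close> as well.\<close>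

lemma abelian_quotient_complement:
  assumes proper: "\<And>C. lsub C \<Longrightarrow> C \<noteq> UNIV \<Longrightarrow> frattini sc br C = {0}"
    and nh: "\<And>x y. br x (br x y) = 0 \<Longrightarrow> br y (br x y) = 0 \<Longrightarrow> br x y = 0"
    and A: "lideal A" "A \<noteq> {0}" "\<And>J. lideal J \<Longrightarrow> J \<subseteq> A \<Longrightarrow> J \<noteq> {0} \<Longrightarrow> J = A"
    and B: "lideal B" "abelian br B" "A \<subseteq> B"
      "\<And>J. lideal J \<Longrightarrow> abelian br J \<Longrightarrow> B \<subseteq> J \<Longrightarrow> J = B"
    and big: "\<And>x. B \<boxplus> span {x} \<noteq> UNIV"
    and I: "lideal I" "B \<subset> I" "\<And>x y. x \<in> I \<Longrightarrow> y \<in> I \<Longrightarrow> br x y \<in> B"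
  obtains S where "lsub S" "A \<boxplus> S = UNIV" "A \<inter> S = {0}"
proof -
  note a = lidealD[OF A(1)] and b = lidealD[OF B(1)] and i = lidealD[OF I(1)]
  have ab: "br u v = 0" if "u \<in> B" "v \<in> B" for u v using B(2) that by (auto simp: abelian_def)
  have cr: "\<exists>D. subspace D \<and> D \<subseteq> B \<and> (\<forall>u\<in>D. br x u \<in> D) \<and> U \<inter> D = {0} \<and> U \<boxplus> D = B"
    if "subspace U" "U \<subseteq> B" "\<And>u. u \<in> U \<Longrightarrow> br x u \<in> U" for U x
    by (rule abelian_ideal_reducible[OF _ B(1,2) big that]) (rule proper)
  \<comment> \<open>The centralizer of \<open>B\<close> in \<open>I\<close>. Its brackets lie in
    \<open>B\<close> and so commute with all of \<open>Z\<close>; without Heisenberg pairs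
    \<open>Z\<close> is abelian, and maximality of \<open>B\<close> gives
    \<open>Z = B\<close>.\<close>
  define Z where "Z = {x \<in> I. \<forall>v\<in>B. br x v = 0}"
  have Zid: "lideal Z"
    unfolding lideal_def
  proof (intro conjI allI ballI)
    show "subspace Z" unfolding Z_def using i(1)
      by (intro subspaceI) (auto simp: br_add_left br_scale_left subspace_0 subspace_add subspace_scale)
    show "br l z \<in> Z" if "z \<in> Z" for l z
      using that b(2) i(2) by (auto simp: Z_def jacobi)
  qed
  have BZ: "B \<subseteq> Z" using ab I(2) by (auto simp: Z_def)
  have "br x y = 0" if "x \<in> Z" "y \<in> Z" for x y
  proof (rule nh)
    have "br x y \<in> B" using I(3) that by (auto simp: Z_def)
    then show "br x (br x y) = 0" "br y (br x y) = 0" using that by (auto simp: Z_def)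
  qed
  then have "abelian br Z" by (auto simp: abelian_def)
  then have ZB: "Z = B" using B(4) Zid BZ by blast
  \<comment> \<open>On \<open>B\<close>, \<open>ad r\<close> commutes with its commutator with
    \<open>ad l\<close>, because \<open>[r, [r, l]]\<close> lies in the abelian ideal
    \<open>B\<close>. So \<open>commuting_derivation_zero\<close> applies and \<open>[r, l]\<close>
    centralizes \<open>B\<close>.\<close>
  have rl: "br r l \<in> B" if r: "r \<in> I" for r l
  proof -
    have "br (br r l) v = 0" if v: "v \<in> B" for v
    proof -
      have "br r (br l v) = br l (br r v)"
      proof (rule commuting_derivation_zero[where T = "br r" and \<psi> = "br l" and B = B, OF b(1) br_add_right br_scale_right b(2) cr br_add_right br_scale_right b(2) _ v])
        fix v assume v: "v \<in> B"
        have "br r (br r l) \<in> B" using I(3)[OF r i(3)[OF r]] .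
        then have "br (br r (br r l)) v = 0" using ab v by blast
        then have "br r (br (br r l) v) = br (br r l) (br r v)" by (simp add: jacobi[of r "br r l"])
        then show "br r (br r (br l v) - br l (br r v)) = br r (br l (br r v)) - br l (br r (br r v))"
          by (simp add: jacobi[of r l])
      qed
      then show ?thesis by (simp add: jacobi)
    qed
    then have "br r l \<in> Z" using i(3)[OF r] by (auto simp: Z_def)
    then show ?thesis using ZB by simp
  qed
  obtain r where r: "r \<in> I" "r \<notin> B" using I(2) by blast
  have rcomm: "br r (br l v) = br l (br r v)" if "v \<in> B" for l v
    using ab[OF rl[OF r(1), of l] that] by (simp add: jacobi)
  define B0 where "B0 = {v \<in> B. br r v = 0}"
  define B1 where "B1 = br r ` B"
  have B0: "lideal B0" unfolding lideal_def
  proof (intro conjI allI ballI)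
    show "subspace B0" unfolding B0_def using b(1)
      by (intro subspaceI) (auto simp: br_add_right br_scale_right subspace_0 subspace_add subspace_scale)
    show "br l v \<in> B0" if "v \<in> B0" for l v using that b(2) rcomm[of v l] by (simp add: B0_def)
  qed
  have B1: "lideal B1" unfolding lideal_def
  proof (intro conjI allI ballI)
    show "subspace B1"
    proof (rule subspaceI)
      show "0 \<in> B1" unfolding B1_def using subspace_0[OF b(1)] br_zero(2)[of r] by (metis imageI)
      show "x + y \<in> B1" if "x \<in> B1" "y \<in> B1" for x y
        using that subspace_add[OF b(1)] by (force simp: B1_def simp flip: br_add_right)
      show "sc k x \<in> B1" if "x \<in> B1" for k x
        using that subspace_scale[OF b(1)] by (force simp: B1_def simp flip: br_scale_right)
    qed
    show "br l v \<in> B1" if "v \<in> B1" for l v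
      using that b(2) by (force simp: B1_def simp flip: rcomm)
  qed
  have B0B: "B0 \<subseteq> B" by (auto simp: B0_def)
  have B1B: "B1 \<subseteq> B" using b(2) by (auto simp: B1_def)
  have B01: "v = 0" if "v \<in> B0" "v \<in> B1" for v
  proof -
    obtain D where D: "subspace D" "D \<subseteq> B" "\<forall>u\<in>D. br r u \<in> D" "B0 \<inter> D = {0}" "B0 \<boxplus> D = B"
      using cr[OF lidealD(1)[OF B0] B0B lidealD(2)[OF B0], of r] by auto
    obtain w where w: "w \<in> B" "v = br r w" using \<open>v \<in> B1\<close> unfolding B1_def by blast
    have "w \<in> B0 \<boxplus> D" using w D(5) by simp
    then obtain w0 d where wd: "w0 \<in> B0" "d \<in> D" "w = w0 + d" by (rule ssumE)
    have "v = br r d" using w(2) wd by (simp add: br_add_right B0_def)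
    then have "v \<in> D" using D(3) wd(2) by blast
    then show ?thesis using D(4) \<open>v \<in> B0\<close> by blast
  qed
  have Bsum: "B0 \<boxplus> B1 = B"
  proof -
    obtain D where D: "subspace D" "D \<subseteq> B" "\<forall>u\<in>D. br r u \<in> D" "B1 \<inter> D = {0}" "B1 \<boxplus> D = B"
      using cr[OF lidealD(1)[OF B1] B1B lidealD(2)[OF B1], of r] by auto
    have "D \<subseteq> B0"
    proof
      fix d assume d: "d \<in> D"
      then have "br r d \<in> B1 \<inter> D" using D by (auto simp: B1_def)
      then have "br r d = 0" using D(4) by blast
      then show "d \<in> B0" using d D(2) by (auto simp: B0_def)
    qed
    then have "B \<subseteq> B1 \<boxplus> B0" using D(5) by (auto simp: ssum_def)
    moreover have "B0 \<boxplus> B1 \<subseteq> B" by (rule ssum_least[OF b(1) B0B B1B])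
    ultimately show ?thesis by (simp add: ssum_commute)
  qed
  \<comment> \<open>As \<open>[r, h]\<close> always lies in \<open>B\<close>, this is the kernel of
    the square of \<open>ad r\<close>. It meets \<open>B1\<close> in zero and gives \<open>L\<close>
    together with \<open>B1\<close>; it is proper because \<open>B1\<close> is nonzero.\<close>
  define H where "H = {h. br r h \<in> B0}"
  have H: "lsub H" unfolding lsub_def
  proof (intro conjI ballI)
    show "subspace H" unfolding H_def using lidealD(1)[OF B0]
      by (intro subspaceI) (auto simp: br_add_right br_scale_right subspace_0 subspace_add subspace_scale)
    show "br x y \<in> H" if "x \<in> H" "y \<in> H" for x y
      using that lidealD(2,3)[OF B0] subspace_add[OF lidealD(1)[OF B0]]
      by (simp add: H_def jacobi'[of r])
  qed
  have HB1: "v = 0" if v: "v \<in> H" "v \<in> B1" for v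
  proof -
    have "br r v \<in> B1" using v(2) B1B by (auto simp: B1_def)
    then have "br r v = 0" using B01 v(1) by (simp add: H_def)
    then have "v \<in> B0" using v(2) B1B by (auto simp: B0_def)
    then show ?thesis using B01 v(2) by blast
  qed
  have B1H: "l \<in> B1 \<boxplus> H" for l
  proof -
    have "br r l \<in> B0 \<boxplus> B1" using rl[OF r(1)] Bsum by simp
    then obtain v0 v1 where v: "v0 \<in> B0" "v1 \<in> B1" "br r l = v0 + v1" by (rule ssumE)
    obtain w where w: "w \<in> B" "v1 = br r w" using v(2) unfolding B1_def by blast
    have "w \<in> B0 \<boxplus> B1" using w(1) Bsum by simp
    then obtain w0 w1 where ww: "w0 \<in> B0" "w1 \<in> B1" "w = w0 + w1" by (rule ssumE)
    have "br r (l - w1) = v0" using v w ww by (simp add: br_diff_right br_add_right B0_def)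
    then have "l - w1 \<in> H" using v(1) by (simp add: H_def)
    from ssumI[OF ww(2) this] show ?thesis by simp
  qed
  have "r \<notin> Z" using r ZB by simp
  then obtain v where "v \<in> B" "br r v \<noteq> 0" using r(1) by (auto simp: Z_def)
  then have "H \<noteq> UNIV" using HB1 by (auto simp: B1_def)
  then have phiH: "frattini sc br H = {0}" by (rule proper[OF H])
  have abA: "abelian br A" using B(2,3) by (auto simp: abelian_def)
  have AB0: "lideal (A \<inter> B0)"
    using a b lidealD[OF B0] A(1) B0 by (auto simp: lideal_def subspace_inter)
  show ?thesis
  proof (cases "A \<inter> B0 = {0}")
    case False
    then have "A \<inter> B0 = A" using A(3)[OF AB0] by blast
    then have AinB0: "A \<subseteq> B0" by blast
    have "A \<subseteq> H" using AinB0 subspace_0[OF lidealD(1)[OF B0]] by (auto simp: H_def B0_def)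
    then obtain C where C: "lsub C" "C \<subseteq> H" "A \<inter> C = {0}" "A \<boxplus> C = H"
      using abelian_ideal_complement[OF H phiH lideal_ideal_in[OF A(1)] abA] by blast
    show ?thesis
    proof (rule that[of "B1 \<boxplus> C"])
      show "lsub (B1 \<boxplus> C)"
        by (rule lsub_ssum[OF lsub_UNIV _ C(1)]) (use B1 in \<open>auto simp: ideal_in_UNIV\<close>)
      have "A \<boxplus> (B1 \<boxplus> C) = B1 \<boxplus> H" unfolding C(4)[symmetric] by (metis ssum_assoc ssum_commute)
      then show "A \<boxplus> (B1 \<boxplus> C) = UNIV" using B1H by blast
      have "u = 0" if u: "u \<in> A" "u \<in> B1 \<boxplus> C" for u
      proof -
        obtain v c where vc: "v \<in> B1" "c \<in> C" "u = v + c" using u(2) by (rule ssumE)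
        have "v = u - c" using vc by simp
        moreover have "u \<in> H" "c \<in> H" using u(1) \<open>A \<subseteq> H\<close> vc(2) C(2) by auto
        ultimately have "v \<in> H" using subspace_diff[OF lsubD(1)[OF H]] by simp
        then have "v = 0" using HB1 vc(1) by blast
        then show ?thesis using vc u C(3) by auto
      qed
      then show "A \<inter> (B1 \<boxplus> C) = {0}"
        using subspace_0[OF a(1)] subspace_0[OF subspace_ssum[OF lidealD(1)[OF B1] lsubD(1)[OF C(1)]]] by blast
    qed
  next
    case True
    have abB0: "abelian br B0" using B(2) B0B by (auto simp: abelian_def)
    have "B0 \<subseteq> H" using subspace_0[OF lidealD(1)[OF B0]] by (auto simp: H_def B0_def)
    then obtain K where K: "lsub K" "K \<subseteq> H" "B0 \<inter> K = {0}" "B0 \<boxplus> K = H"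
      using abelian_ideal_complement[OF H phiH lideal_ideal_in[OF B0] abB0] by blast
    have BK: "B \<boxplus> K = UNIV"
    proof -
      have "B \<boxplus> K = B1 \<boxplus> H" unfolding K(4)[symmetric] Bsum[symmetric] by (metis ssum_assoc ssum_commute)
      then show ?thesis using B1H by blast
    qed
    have BK0: "v = 0" if v: "v \<in> B" "v \<in> K" for v
    proof -
      obtain v0 v1 where vv: "v0 \<in> B0" "v1 \<in> B1" "v = v0 + v1" using v(1) unfolding Bsum[symmetric] by (rule ssumE)
      have "v1 = v - v0" using vv by simp
      moreover have "v \<in> H" "v0 \<in> H" using v(2) K(2) vv(1) \<open>B0 \<subseteq> H\<close> by auto
      ultimately have "v1 \<in> H" using subspace_diff[OF lsubD(1)[OF H]] by simp
      then have "v1 = 0" using HB1 vv(2) by blast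
      then show ?thesis using vv v(2) K(3) by auto
    qed
    have "br r r = 0" by simp
    then have "r \<in> B0 \<boxplus> K" unfolding K(4) using subspace_0[OF lidealD(1)[OF B0]] by (simp add: H_def)
    then obtain r0 r' where r': "r0 \<in> B0" "r' \<in> K" "r = r0 + r'" by (rule ssumE)
    have "r' = r - r0" using r' by simp
    then have r'I: "r' \<in> I" using subspace_diff[OF i(1) r(1)] r'(1) B0B I(2) by blast
    \<comment> \<open>Brackets of \<open>r'\<close> with \<open>K\<close> lie in \<open>B\<close> by
      \<open>rl\<close> and also in \<open>K\<close>, and \<open>B\<close> meets \<open>K\<close>
      only in zero.\<close>
    have r'K: "br r' k = 0" "br k r' = 0" if "k \<in> K" for k
    proof -
      show "br r' k = 0" by (rule BK0[OF rl[OF r'I] lsubD(2)[OF K(1) r'(2) that]])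
      then show "br k r' = 0" using br_anti[of k r'] by simp
    qed
    have r'0: "r' \<noteq> 0" using r' r(2) B0B by auto
    have "K \<noteq> UNIV"
    proof
      assume "K = UNIV"
      then have "u = 0" if "u \<in> A" for u using BK0 B(3) that by blast
      then show False using A(2) subspace_0[OF a(1)] by blast
    qed
    then have phiK: "frattini sc br K = {0}" by (rule proper[OF K(1)])
    have sR: "ideal_in sc br K (span {r'})"
      unfolding ideal_in_iff
    proof (intro conjI ballI)
      show "span {r'} \<subseteq> K" using span_minimal[of "{r'}" K] r'(2) lsubD(1)[OF K(1)] by blast
      fix k y assume "k \<in> K" "y \<in> span {r'}"
      then have "br k y = 0" using r'K by (auto simp: span_singleton br_scale_right)
      then show "br k y \<in> span {r'}" by (simp add: span_zero)
    qed simp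
    have abR: "abelian br (span {r'})" by (auto simp: abelian_def span_singleton br_scale_left br_scale_right)
    obtain K1 where K1: "lsub K1" "K1 \<subseteq> K" "span {r'} \<inter> K1 = {0}" "span {r'} \<boxplus> K1 = K"
      by (rule abelian_ideal_complement[OF K(1) phiK sR abR])
    let ?L = "B \<boxplus> K1"
    have L: "lsub ?L"
      by (rule lsub_ssum[OF lsub_UNIV _ K1(1)]) (use B in \<open>auto simp: ideal_in_UNIV\<close>)
    have "r' \<notin> ?L"
    proof
      assume "r' \<in> ?L"
      then obtain v k where vk: "v \<in> B" "k \<in> K1" "r' = v + k" by (rule ssumE)
      have "v = r' - k" using vk by simp
      then have "v \<in> K" using subspace_diff[OF lsubD(1)[OF K(1)] r'(2)] vk(2) K1(2) by blast
      then have "r' = k" using BK0 vk by simp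
      then have "r' \<in> span {r'} \<inter> K1" using vk span_base[of r' "{r'}"] by simp
      then show False using K1(3) r'0 by simp
    qed
    then have phiL: "frattini sc br ?L = {0}" using proper[OF L] by blast
    have BL: "B \<subseteq> ?L" by (rule ssum_left[OF lsubD(1)[OF K1(1)]])
    have K1L: "K1 \<subseteq> ?L" by (rule ssum_right[OF b(1)])
    obtain D where D: "ideal_in sc br ?L D" "D \<subseteq> B" "A \<inter> D = {0}" "A \<boxplus> D = B"
      by (rule ideal_complement[OF L phiL lideal_ideal_in[OF A(1) subset_trans[OF B(3) BL]]
            lideal_ideal_in[OF B(1) BL] B(2,3)])
    note d = ideal_inD[OF D(1)]
    \<comment> \<open>Used to extend the projection of \<open>B\<close> onto \<open>A\<close> along
      \<open>D\<close> to a linear map on all of \<open>L\<close>.\<close>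
    obtain E where E: "subspace E" "E \<subseteq> UNIV" "B \<inter> E = {0}" "B \<boxplus> E = UNIV"
      by (rule complement_exists[OF b(1) subset_UNIV subspace_UNIV fdim_UNIV])
    have "A \<inter> (D \<boxplus> E) = {0}"
    proof -
      have "u = 0" if u: "u \<in> A" "u \<in> D \<boxplus> E" for u
      proof -
        obtain x e where xe: "x \<in> D" "e \<in> E" "u = x + e" using u(2) by (rule ssumE)
        have "e = u - x" using xe by simp
        then have "e \<in> B" using subspace_diff[OF b(1)] u(1) B(3) xe(1) D(2) by blast
        then have "e = 0" using E(3) xe(2) by blast
        then show ?thesis using D(3) u(1) xe by auto
      qed
      then show ?thesis using subspace_0[OF a(1)] subspace_0[OF subspace_ssum[OF d(2) E(1)]] by blast
    qed
    moreover have "A \<boxplus> (D \<boxplus> E) = UNIV" using D(4) E(4) by (simp flip: ssum_assoc)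
    ultimately obtain \<phi> where \<phi>: "lin \<phi>" "\<And>v. \<phi> v \<in> A" "\<And>u. u \<in> A \<Longrightarrow> \<phi> u = u" "\<And>x. x \<in> D \<boxplus> E \<Longrightarrow> \<phi> x = 0"
      by (rule projection_along[OF a(1) subspace_ssum[OF d(2) E(1)]]) blast
    have \<phi>D: "\<phi> x = 0" if "x \<in> D" for x using \<phi>(4) ssum_left[OF E(1), of D] that by blast
    have \<phi>K1: "\<phi> (br k v) = br k (\<phi> v)" if k: "k \<in> K1" and v: "v \<in> B" for k v
    proof -
      obtain u x where ux: "u \<in> A" "x \<in> D" "v = u + x" using v unfolding D(4)[symmetric] by (rule ssumE)
      have "br k x \<in> D" using d(3)[OF _ ux(2)] k K1L by blast
      then show ?thesis using ux a(2)[OF ux(1)] \<phi>(3) \<phi>D by (simp add: br_add_right linD(1)[OF \<phi>(1)])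
    qed
    \<comment> \<open>Linear maps into \<open>A\<close> that commute with \<open>K1\<close> on
      \<open>B\<close>. Since \<open>r'\<close> is central in \<open>K\<close>, this space is stable
      under \<open>T\<close>, the commutator with \<open>ad r'\<close>.\<close>
    define M where "M = {\<psi>. lin \<psi> \<and> (\<forall>v. \<psi> v \<in> A) \<and> (\<forall>k\<in>K1. \<forall>v\<in>B. \<psi> (br k v) = br k (\<psi> v))}"
    have Asub: "0 \<in> A" "\<And>u v. u \<in> A \<Longrightarrow> v \<in> A \<Longrightarrow> u + v \<in> A" "\<And>u v. u \<in> A \<Longrightarrow> v \<in> A \<Longrightarrow> u - v \<in> A"
        "\<And>k u. u \<in> A \<Longrightarrow> sc k u \<in> A"
      using a(1) subspace_0 subspace_add subspace_diff subspace_scale by blast+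
    have M: "F.subspace M" using Asub unfolding M_def
      by (intro F.subspaceI) (auto simp: lin_def scf_def br_add_right br_scale_right algebra_simps)
    have fdM: "F.fdim M" by (rule F.fdim_mono[OF fdim_lin]) (auto simp: M_def)
    define T where "T = actf r'"
    have Tadd: "T (u + v) = T u + T v" and Tsc: "T (scf k u) = scf k (T u)" for u v k
      by (simp_all add: T_def actf_def scf_def fun_eq_iff br_add_right br_scale_right scale_right_diff_distrib)
    have TM: "T \<psi> \<in> M" if \<psi>: "\<psi> \<in> M" for \<psi>
    proof -
      have l: "lin \<psi>" and rg: "\<psi> v \<in> A" and c: "k \<in> K1 \<Longrightarrow> v \<in> B \<Longrightarrow> \<psi> (br k v) = br k (\<psi> v)" for k v
        using \<psi> by (auto simp: M_def)
      have rk: "br r' (br k v) = br k (br r' v)" if "k \<in> K1" for k v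
        using r'K(1)[of k] that K1(2) by (auto simp: jacobi'[of r' k v])
      have "T \<psi> (br k v) = br k (T \<psi> v)" if "k \<in> K1" "v \<in> B" for k v
        using that rk[OF that(1)] c[OF that] c[OF that(1) b(2)[OF that(2)], of r']
        by (simp add: T_def actf_def br_diff_right)
      moreover have "T \<psi> v \<in> A" for v unfolding T_def actf_def using a(2)[OF rg] rg Asub(3) by blast
      ultimately show ?thesis using lin_actf[OF l] by (simp add: M_def T_def)
    qed
    have powM: "\<psi> \<in> M \<Longrightarrow> (T ^^ n) \<psi> \<in> M" for n \<psi> by (induction n) (auto simp: TM)
    obtain N where N: "\<forall>v\<in>M. \<exists>w\<in>M. (T ^^ Suc N) (v - (T ^^ Suc N) w) = 0"
      using F.fitting[OF M fdM Tadd Tsc TM] by blast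
    have \<phi>M: "\<phi> \<in> M" using \<phi> \<phi>K1 by (simp add: M_def)
    obtain w where w: "w \<in> M" "(T ^^ Suc N) (\<phi> - (T ^^ Suc N) w) = 0" using N \<phi>M by blast
    \<comment> \<open>Removing the Fitting one-component of \<phi> leaves a map killed by a power of
      \<open>T\<close>; \<open>step\<close> lowers the exponent, so that \<open>\<phi>0\<close>
      commutes with \<open>ad r'\<close> on \<open>B\<close>.\<close>
    define \<phi>0 where "\<phi>0 = \<phi> - (T ^^ Suc N) w"
    have \<phi>0M: "\<phi>0 \<in> M" unfolding \<phi>0_def by (rule F.subspace_diff[OF M \<phi>M powM[OF w(1)]])
    have step: "T \<psi> v = 0" if \<psi>: "\<psi> \<in> M" and z: "\<And>v. v \<in> B \<Longrightarrow> T (T \<psi>) v = 0" and v: "v \<in> B" for \<psi> v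
    proof -
      have l: "lin \<psi>" and rg: "\<psi> v \<in> A" for v using \<psi> by (auto simp: M_def)
      have "br r' (\<psi> v) = \<psi> (br r' v)"
      proof (rule commuting_derivation_zero[where T = "br r'" and \<psi> = \<psi> and B = B, OF b(1) br_add_right br_scale_right b(2) cr linD(1)[OF l] linD(2)[OF l] _ _ v])
        show "\<psi> u \<in> B" for u using rg B(3) by blast
        show "br r' (br r' (\<psi> v) - \<psi> (br r' v)) = br r' (\<psi> (br r' v)) - \<psi> (br r' (br r' v))" if "v \<in> B" for v
          using z[OF that] by (simp add: T_def actf_def)
      qed
      then show ?thesis by (simp add: T_def actf_def)
    qed
    have down: "T \<phi>0 v = 0" if "\<forall>v\<in>B. (T ^^ Suc k) \<phi>0 v = 0" "v \<in> B" for k v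
      using that
    proof (induction k arbitrary: v)
      case 0
      then show ?case by simp
    next
      case (Suc k)
      have "(T ^^ Suc k) \<phi>0 v = 0" if "v \<in> B" for v
        using step[OF powM[OF \<phi>0M, of k] _ that] Suc.prems(1) by simp
      then show ?case using Suc.IH Suc.prems(2) by blast
    qed
    have T\<phi>0: "T \<phi>0 v = 0" if "v \<in> B" for v
      by (rule down[of N]) (use w(2) that in \<open>auto simp: \<phi>0_def\<close>)
    have l0: "lin \<phi>0" and r0: "\<phi>0 v \<in> A" and c0: "k \<in> K1 \<Longrightarrow> v \<in> B \<Longrightarrow> \<phi>0 (br k v) = br k (\<phi>0 v)" for k v
      using \<phi>0M by (auto simp: M_def)
    have hom0: "\<phi>0 (br x v) = br x (\<phi>0 v)" if v: "v \<in> B" for x v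
    proof -
      have "x \<in> B \<boxplus> (span {r'} \<boxplus> K1)" using BK K1(4) by blast
      then obtain u k k1 where x: "u \<in> B" "k1 \<in> K1" "x = u + (sc k r' + k1)"
        by (auto elim!: ssumE simp: span_singleton)
      have "\<phi>0 (br r' v) = br r' (\<phi>0 v)" using T\<phi>0[OF v] by (simp add: T_def actf_def)
      moreover have "br u v = 0" "br u (\<phi>0 v) = 0" using ab x(1) v r0 B(3) by blast+
      ultimately show ?thesis using c0[OF x(2) v]
        by (simp add: x(3) br_add_left br_scale_left linD[OF l0])
    qed
    \<comment> \<open>If \<open>\<phi>0\<close> vanished on \<open>A\<close>, the identity of
      \<open>A\<close> would be the commutator of \<open>ad r'\<close> with \<open>g\<close>, which
      the trace forbids.\<close>
    have ne: "\<exists>u\<in>A. \<phi>0 u \<noteq> 0"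
    proof (rule ccontr)
      assume "\<not> (\<exists>u\<in>A. \<phi>0 u \<noteq> 0)"
      then have z: "\<phi>0 u = 0" if "u \<in> A" for u using that by blast
      define g where "g = (T ^^ N) w"
      have gM: "g \<in> M" unfolding g_def by (rule powM[OF w(1)])
      have lg: "lin g" and rg: "g v \<in> A" for v using gM by (auto simp: M_def)
      have "br r' (g u) - g (br r' u) = u" if "u \<in> A" for u
      proof -
        have "\<phi>0 u = u - T g u" using \<phi>(3)[OF that] by (simp add: \<phi>0_def g_def)
        then have "T g u = u" using z[OF that] by simp
        then show ?thesis by (simp add: T_def actf_def)
      qed
      then have "A = {0}"
        using commutator_not_identity[OF a(1), of "br r'" g] br_add_right br_scale_right a(2) linD[OF lg] rg by blast
      then show False using A(2) by blast
    qed
    \<comment> \<open>By minimality of \<open>A\<close>, \<open>\<phi>0\<close> is bijective on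
      \<open>A\<close>, so its kernel in \<open>B\<close> complements \<open>A\<close>
      there.\<close>
    define Ker where "Ker = {u \<in> A. \<phi>0 u = 0}"
    have "lideal Ker"
      using Asub a(2) hom0 B(3) unfolding Ker_def lideal_def
      by (auto intro!: subspaceI simp: lin_zero[OF l0] linD[OF l0] subset_iff)
    moreover have "Ker \<noteq> A" using ne by (auto simp: Ker_def)
    ultimately have Ker: "Ker = {0}" using A(3)[of Ker] by (auto simp: Ker_def)
    have imA: "\<phi>0 ` A = A"
    proof (rule A(3))
      show "lideal (\<phi>0 ` A)" unfolding lideal_def
      proof (intro conjI allI ballI)
        show "subspace (\<phi>0 ` A)"
        proof (rule subspaceI)
          show "0 \<in> \<phi>0 ` A" using Asub(1) lin_zero[OF l0] by (metis imageI)
          show "x + y \<in> \<phi>0 ` A" if "x \<in> \<phi>0 ` A" "y \<in> \<phi>0 ` A" for x y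
            using that Asub(2) by (force simp flip: linD(1)[OF l0])
          show "sc k x \<in> \<phi>0 ` A" if "x \<in> \<phi>0 ` A" for k x
            using that Asub(4) by (force simp flip: linD(2)[OF l0])
        qed
        show "br x y \<in> \<phi>0 ` A" if y: "y \<in> \<phi>0 ` A" for x y
        proof -
          obtain u where u: "u \<in> A" "y = \<phi>0 u" using y by blast
          then have "br x y = \<phi>0 (br x u)" using hom0 B(3) by auto
          then show ?thesis using a(2)[OF u(1)] by blast
        qed
      qed
      show "\<phi>0 ` A \<subseteq> A" using r0 by blast
      show "\<phi>0 ` A \<noteq> {0}" using ne by blast
    qed
    define D' where "D' = {v \<in> B. \<phi>0 v = 0}"
    have D': "lideal D'"
      using b hom0 unfolding D'_def lideal_def
      by (auto intro!: subspaceI simp: lin_zero[OF l0] linD[OF l0] subspace_0 subspace_add subspace_scale)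
    have AD': "A \<boxplus> D' = B"
    proof
      show "A \<boxplus> D' \<subseteq> B" by (rule ssum_least[OF b(1) B(3)]) (auto simp: D'_def)
      show "B \<subseteq> A \<boxplus> D'"
      proof
        fix v assume v: "v \<in> B"
        obtain u where u: "u \<in> A" "\<phi>0 v = \<phi>0 u" using imA r0[of v] by blast
        have "v - u \<in> B" using subspace_diff[OF b(1) v] u(1) B(3) by blast
        then have "v - u \<in> D'" using u(2) by (simp add: D'_def lin_diff[OF l0])
        from ssumI[OF u(1) this] show "v \<in> A \<boxplus> D'" by simp
      qed
    qed
    show ?thesis
    proof (rule that[of "D' \<boxplus> K"])
      show "lsub (D' \<boxplus> K)"
        by (rule lsub_ssum[OF lsub_UNIV _ K(1)]) (use D' in \<open>auto simp: ideal_in_UNIV\<close>)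
      show "A \<boxplus> (D' \<boxplus> K) = UNIV" using AD' BK by (simp flip: ssum_assoc)
      have "u = 0" if u: "u \<in> A" "u \<in> D' \<boxplus> K" for u
      proof -
        obtain x k where xk: "x \<in> D'" "k \<in> K" "u = x + k" using u(2) by (rule ssumE)
        have "k = u - x" using xk by simp
        moreover have "u \<in> B" "x \<in> B" using u(1) B(3) xk(1) by (auto simp: D'_def)
        ultimately have "k \<in> B" using subspace_diff[OF b(1)] by simp
        then have "k = 0" using BK0 xk(2) by blast
        then have "u \<in> Ker" using xk u(1) by (simp add: Ker_def D'_def)
        then show ?thesis using Ker by simp
      qed
      then show "A \<inter> (D' \<boxplus> K) = {0}"
        using Asub(1) subspace_0[OF subspace_ssum[OF lidealD(1)[OF D'] lsubD(1)[OF K(1)]]] by blast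
    qed
  qed
qed

end


section \<open>Minimal non-elementary algebras\<close>

context lie_alg
begin

text \<open>The nested quantifiers collapse, since a subalgebra of a proper subalgebra is
  proper.\<close>

lemma minimal_non_elementary_iff:
  "minimal_non_elementary sc br \<longleftrightarrow> frattini sc br UNIV \<noteq> {0} \<and>
     (\<forall>C. lsub C \<and> C \<noteq> UNIV \<longrightarrow> frattini sc br C = {0})"
proof
  assume m: "minimal_non_elementary sc br"
  have p: "frattini sc br C = {0}" if "lsub C" "C \<noteq> UNIV" for C
    using m that unfolding minimal_non_elementary_def elementary_def subalg_iff by blast
  moreover have "frattini sc br UNIV \<noteq> {0}"
    using m p unfolding minimal_non_elementary_def elementary_def subalg_iff by metis
  ultimately show "frattini sc br UNIV \<noteq> {0} \<and> (\<forall>C. lsub C \<and> C \<noteq> UNIV \<longrightarrow> frattini sc br C = {0})"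
    by blast
next
  assume a: "frattini sc br UNIV \<noteq> {0} \<and> (\<forall>C. lsub C \<and> C \<noteq> UNIV \<longrightarrow> frattini sc br C = {0})"
  show "minimal_non_elementary sc br"
    unfolding minimal_non_elementary_def elementary_def subalg_iff
  proof (intro conjI allI impI)
    show "\<not> (\<forall>C. C \<subseteq> UNIV \<and> lsub C \<longrightarrow> frattini sc br C = {0})" using a lsub_UNIV by (metis subset_UNIV)
    fix C D assume h: "(C \<subseteq> UNIV \<and> lsub C) \<and> C \<noteq> UNIV" "D \<subseteq> C \<and> lsub D"
    then have "D \<noteq> UNIV" by auto
    then show "frattini sc br D = {0}" using a h(2) by simp
  qed
qed

text \<open>Every linear complement of the Frattini ideal is a subalgebra here.\<close>

lemma frattini_abelian:
  assumes C: "lsub C" "abelian br C"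
  shows "frattini sc br C = {0}"
proof -
  note f = ideal_inD[OF frattini_ideal(1)[OF C(1)]]
  obtain S where S: "subspace S" "S \<subseteq> C" "frattini sc br C \<inter> S = {0}" "frattini sc br C \<boxplus> S = C"
    by (rule complement_exists[OF f(2,1) lsubD(1)[OF C(1)] fdim_all])
  have "br u v = 0" if "u \<in> S" "v \<in> S" for u v using C(2) S(2) that by (auto simp: abelian_def)
  then have "lsub S" using S(1) by (simp add: lsub_def subspace_0)
  then show ?thesis by (rule frattini_complement_zero[OF C(1) order_refl f(2) _ S(2,4,3)])
qed

lemma span_triple: "v \<in> span {x, y, z} \<longleftrightarrow> (\<exists>a b c. v = sc a x + (sc b y + sc c z))"
proof
  assume "v \<in> span {x, y, z}"
  then obtain a where "v - sc a x \<in> span {y, z}" by (auto simp: span_insert)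
  then obtain b where "v - sc a x - sc b y \<in> span {z}" by (auto simp: span_insert)
  then obtain c where "v - sc a x - sc b y = sc c z" by (auto simp: span_singleton)
  then have "v = sc a x + (sc b y + sc c z)" by (simp add: algebra_simps)
  then show "\<exists>a b c. v = sc a x + (sc b y + sc c z)" by blast
next
  assume "\<exists>a b c. v = sc a x + (sc b y + sc c z)"
  then obtain a b c where v: "v = sc a x + (sc b y + sc c z)" by blast
  have "u \<in> span {x, y, z}" if "u \<in> {x, y, z}" for u using that by (rule span_base)
  then show "v \<in> span {x, y, z}" unfolding v by (intro span_add span_scale) auto
qed

text \<open>A maximal subalgebra without \<open>z\<close> would supplement \<open>Fz\<close>, hence
  contain some \<open>x - k z\<close> and \<open>y - k' z\<close>, whose bracket is
  \<open>z\<close>.\<close>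

lemma heisenberg_frattini:
  assumes h: "br x y = z" "br x z = 0" "br y z = 0"
  shows "lsub (span {x, y, z})" "z \<in> frattini sc br (span {x, y, z})"
proof -
  let ?C = "span {x, y, z}"
  have h': "br z x = 0" "br z y = 0" "br y x = - z"
    using h br_anti[of z x] br_anti[of z y] br_anti[of y x] by simp_all
  have brC: "br u v \<in> span {z}" if uvC: "u \<in> ?C" "v \<in> ?C" for u v
  proof -
    obtain a b c a' b' c' where uv: "u = sc a x + (sc b y + sc c z)" "v = sc a' x + (sc b' y + sc c' z)"
      using uvC unfolding span_triple by blast
    have "br u v = sc (a * b' - b * a') z"
      unfolding uv by (simp add: br_add_left br_add_right br_scale_left br_scale_right h h' algebra_simps)
    then show ?thesis by (simp add: span_scale span_base)
  qed
  have zC: "span {z} \<subseteq> ?C" by (rule span_mono) simp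
  show C: "lsub ?C" using brC zC by (auto simp: lsub_def)
  have z: "ideal_in sc br ?C (span {z})"
    unfolding ideal_in_iff using brC zC by auto
  have "span {z} \<subseteq> M" if M: "maximal_subalg sc br ?C M" for M
  proof -
    have m: "lsub M" "M \<subseteq> ?C" "M \<noteq> ?C" and max: "\<And>N. N \<subseteq> ?C \<Longrightarrow> lsub N \<Longrightarrow> M \<subseteq> N \<Longrightarrow> N = M \<or> N = ?C"
      using M unfolding maximal_subalg_def subalg_iff by blast+
    have "z \<in> M"
    proof (rule ccontr)
      assume zM: "z \<notin> M"
      have "lsub (span {z} \<boxplus> M)" by (rule lsub_ssum[OF C z m(1,2)])
      moreover have "span {z} \<boxplus> M \<subseteq> ?C" by (rule ssum_least[OF subspace_span zC m(2)])
      moreover have "M \<subseteq> span {z} \<boxplus> M" by (rule ssum_right[OF subspace_span])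
      moreover have "z \<in> span {z} \<boxplus> M"
        using ssum_left[OF lsubD(1)[OF m(1)], of "span {z}"] span_base[of z "{z}"] by blast
      ultimately have e: "span {z} \<boxplus> M = ?C" using max zM by metis
      have "x \<in> span {z} \<boxplus> M" "y \<in> span {z} \<boxplus> M" unfolding e by (auto intro: span_base)
      then obtain k u k' v where uv: "u \<in> M" "v \<in> M" "x = sc k z + u" "y = sc k' z + v"
        by (auto elim!: ssumE simp: span_singleton)
      have "u = x - sc k z" "v = y - sc k' z" using uv(3,4) by (simp_all add: eq_diff_eq)
      then have "br u v = z"
        by (simp add: br_diff_left br_diff_right br_scale_left br_scale_right h h')
      then show False using lsubD(2)[OF m(1) uv(1,2)] zM by simp
    qed
    then show ?thesis using lsubD(1)[OF m(1)] by (intro span_minimal) auto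
  qed
  then have "span {z} \<subseteq> frattini sc br ?C" by (rule frattini_greatest[OF z])
  then show "z \<in> frattini sc br ?C" using span_base[of z "{z}"] by blast
qed

text \<open>The span of the triple has \<open>z\<close> in its Frattini ideal, so it cannot be
  proper.\<close>

lemma heisenberg_if_triple:
  assumes proper: "\<And>C. lsub C \<Longrightarrow> C \<noteq> UNIV \<Longrightarrow> frattini sc br C = {0}"
    and h: "br x y = z" "br x z = 0" "br y z = 0" "z \<noteq> 0"
  shows "\<not> dependent {x, y, z}" "card {x, y, z} = 3" "span {x, y, z} = UNIV"
proof -
  have h': "br z x = 0" "br z y = 0" "br y x = - z"
    using h br_anti[of z x] br_anti[of z y] br_anti[of y x] by simp_all
  have y: "y \<notin> span {z}"
  proof
    assume "y \<in> span {z}"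
    then obtain k where "y = sc k z" by (auto simp: span_singleton)
    then show False using h by (auto simp: br_scale_right)
  qed
  have x: "x \<notin> span {y, z}"
  proof
    assume "x \<in> span {y, z}"
    then obtain b where "x - sc b y \<in> span {z}" by (auto simp: span_insert)
    then obtain c where "x - sc b y = sc c z" by (auto simp: span_singleton)
    then have "x = sc b y + sc c z" by (simp add: algebra_simps)
    then have "br x y = 0" by (simp add: br_add_left br_scale_left h')
    then show False using h by simp
  qed
  have "\<not> dependent {z}" using h(4) by simp
  then show "\<not> dependent {x, y, z}" using x y independent_insertI by metis
  have "y \<noteq> z" "x \<noteq> y" "x \<noteq> z"
    using y x span_base[of z "{z}"] span_base[of y "{y, z}"] span_base[of z "{y, z}"] by auto
  then show "card {x, y, z} = 3" by simp
  show "span {x, y, z} = UNIV"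
  proof (rule ccontr)
    assume "span {x, y, z} \<noteq> UNIV"
    then have "frattini sc br (span {x, y, z}) = {0}"
      by (rule proper[OF heisenberg_frattini(1)[OF h(1-3)]])
    then show False using heisenberg_frattini(2)[OF h(1-3)] h(4) by simp
  qed
qed

text \<open>The Fitting null component \<open>N\<close> of \<open>ad a\<close> is a subalgebra, and
  the other component lies in the Frattini ideal because \<open>a\<close> does. So \<open>N\<close>
  supplements the Frattini ideal and must be \<open>L\<close>.\<close>

lemma frattini_ad_nilpotent:
  assumes a: "a \<in> frattini sc br UNIV"
  shows "\<exists>k. \<forall>v. (br a ^^ k) v = 0"
proof -
  have fr: "lideal (frattini sc br UNIV)" using frattini_ideal(1)[OF lsub_UNIV] by (simp add: ideal_in_UNIV)
  have add: "(br a ^^ k) (u + v) = (br a ^^ k) u + (br a ^^ k) v"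
    and scl: "(br a ^^ k) (sc c u) = sc c ((br a ^^ k) u)" for k u v c
    by (induction k) (auto simp: br_add_right br_scale_right)
  have zero: "(br a ^^ k) 0 = 0" for k by (induction k) auto
  have mono: "(br a ^^ j) u = 0" if "(br a ^^ i) u = 0" "i \<le> j" for i j u
  proof -
    have "(br a ^^ (j - i + i)) u = 0" unfolding funpow_add using that(1) zero by simp
    then show ?thesis using that(2) by simp
  qed
  define N where "N = {v. \<exists>k. (br a ^^ k) v = 0}"
  have N: "lsub N"
    unfolding lsub_def
  proof (intro conjI ballI)
    show "subspace N"
    proof (rule subspaceI)
      show "0 \<in> N" using zero by (auto simp: N_def)
      show "u + v \<in> N" if uv: "u \<in> N" "v \<in> N" for u v
      proof -
        obtain i j where ij: "(br a ^^ i) u = 0" "(br a ^^ j) v = 0" using uv by (auto simp: N_def)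
        have "(br a ^^ max i j) (u + v) = 0" using mono[OF ij(1)] mono[OF ij(2)] by (simp add: add)
        then show ?thesis by (auto simp: N_def)
      qed
      show "sc c u \<in> N" if "u \<in> N" for c u
      proof -
        obtain i where "(br a ^^ i) u = 0" using \<open>u \<in> N\<close> by (auto simp: N_def)
        then have "(br a ^^ i) (sc c u) = 0" by (simp add: scl)
        then show ?thesis by (auto simp: N_def)
      qed
    qed
    have "(br a ^^ i) u = 0 \<Longrightarrow> (br a ^^ j) v = 0 \<Longrightarrow> (br a ^^ (i + j)) (br u v) = 0" for i j u v
    proof (induction "i + j" arbitrary: i j u v)
      case 0
      then show ?case by simp
    next
      case (Suc m)
      show ?case
      proof (cases "u = 0 \<or> v = 0")
        case True
        then show ?thesis by (auto simp: zero)
      next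
        case False
        then obtain i' j' where ij: "i = Suc i'" "j = Suc j'" using Suc.prems by (cases i; cases j) auto
        have "(br a ^^ (i' + j)) (br (br a u) v) = 0"
          by (rule Suc.hyps(1)) (use Suc.hyps(2) Suc.prems ij in \<open>auto simp: funpow_swap1\<close>)
        moreover have "(br a ^^ (i + j')) (br u (br a v)) = 0"
          by (rule Suc.hyps(1)) (use Suc.hyps(2) Suc.prems ij in \<open>auto simp: funpow_swap1\<close>)
        moreover have "(br a ^^ (i + j)) (br u v) = (br a ^^ (i' + j)) (br a (br u v))"
          unfolding ij by (simp add: funpow_swap1)
        ultimately show ?thesis using ij by (simp add: jacobi'[of a u v] add br_add_right)
      qed
    qed
    then show "br u v \<in> N" if "u \<in> N" "v \<in> N" for u v
      using that unfolding N_def by blast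
  qed
  obtain K where K: "\<forall>v\<in>UNIV. \<exists>w\<in>UNIV. (br a ^^ Suc K) (v - (br a ^^ Suc K) w) = 0"
    using fitting[OF subspace_UNIV fdim_all, of "br a"] br_add_right br_scale_right by blast
  have "v \<in> frattini sc br UNIV \<boxplus> N" for v
  proof -
    obtain w where w: "(br a ^^ Suc K) (v - (br a ^^ Suc K) w) = 0" using K by blast
    have "(br a ^^ Suc K) w \<in> frattini sc br UNIV" using lidealD(3)[OF fr a] by simp
    moreover have "v - (br a ^^ Suc K) w \<in> N" using w unfolding N_def by blast
    ultimately show ?thesis using ssumI[of "(br a ^^ Suc K) w" _ "v - (br a ^^ Suc K) w" N] by simp
  qed
  then have NU: "N = UNIV" by (intro frattini_supplement[OF lsub_UNIV order_refl N]) auto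
  obtain S where S: "finite S" "span S = UNIV" using fin unfolding fin_dim_def by blast
  have "\<forall>s. \<exists>k. (br a ^^ k) s = 0" using NU by (auto simp: N_def)
  then obtain k where k: "\<And>s. (br a ^^ k s) s = 0" by metis
  \<comment> \<open>A finite spanning set turns exponents for single vectors into one that works for
    all.\<close>
  define m where "m = (\<Sum>s\<in>S. k s)"
  have "(br a ^^ m) s = 0" if "s \<in> S" for s
    using mono[OF k[of s]] member_le_sum[of s S k] S(1) that by (simp add: m_def)
  moreover have "subspace {v. (br a ^^ m) v = 0}"
    by (rule subspaceI) (auto simp: zero add scl)
  ultimately have "span S \<subseteq> {v. (br a ^^ m) v = 0}" by (intro span_minimal) auto
  then show ?thesis using S(2) by blast
qed

section \<open>The abelian socle\<close>

lemma minimal_abelian_ideal_iff: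
  "minimal_abelian_ideal sc br UNIV I \<longleftrightarrow> lideal I \<and> I \<noteq> {0} \<and> abelian br I \<and>
     (\<forall>J. lideal J \<and> J \<subseteq> I \<and> J \<noteq> {0} \<longrightarrow> J = I)"
  by (simp add: minimal_abelian_ideal_def ideal_in_UNIV)

lemma asoc_upper: "minimal_abelian_ideal sc br UNIV I \<Longrightarrow> I \<subseteq> asoc sc br UNIV"
  unfolding asoc_def by (rule order_trans[OF Union_upper span_superset]) simp

lemma asoc_least:
  assumes "subspace W" "\<And>I. minimal_abelian_ideal sc br UNIV I \<Longrightarrow> I \<subseteq> W"
  shows "asoc sc br UNIV \<subseteq> W"
  unfolding asoc_def using assms by (intro span_minimal) auto

lemma asoc_ideal: "lideal (asoc sc br UNIV)"
proof -
  have sub: "subspace (asoc sc br UNIV)" by (simp add: asoc_def)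
  have "asoc sc br UNIV \<subseteq> {y. br l y \<in> asoc sc br UNIV}" for l
  proof (rule asoc_least)
    show "subspace {y. br l y \<in> asoc sc br UNIV}"
      using sub by (intro subspaceI) (auto simp: br_add_right br_scale_right subspace_0 subspace_add subspace_scale)
    show "I \<subseteq> {y. br l y \<in> asoc sc br UNIV}" if I: "minimal_abelian_ideal sc br UNIV I" for I
      using asoc_upper[OF I] I lidealD(2)[of I] by (auto simp: minimal_abelian_ideal_iff)
  qed
  then show ?thesis using sub by (auto simp: lideal_def)
qed

lemma lideal_inter: "lideal I \<Longrightarrow> lideal J \<Longrightarrow> lideal (I \<inter> J)"
  by (auto simp: lideal_def subspace_inter)

lemma lideal_zero: "lideal I \<Longrightarrow> 0 \<in> I"
  by (simp add: lideal_def subspace_0)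

text \<open>Complete reducibility of the socle. Let \<open>D\<close> be maximal among its ideals
  that meet \<open>J\<close> in zero; a minimal ideal not inside \<open>J + D\<close> would meet
  \<open>J + D\<close> in zero and could be added to \<open>D\<close>.\<close>

lemma asoc_complement:
  assumes J: "lideal J" "J \<subseteq> asoc sc br UNIV"
  obtains D where "lideal D" "D \<subseteq> asoc sc br UNIV" "J \<inter> D = {0}" "J \<boxplus> D = asoc sc br UNIV"
proof -
  let ?S = "asoc sc br UNIV"
  define Q where "Q D \<longleftrightarrow> lideal D \<and> D \<subseteq> ?S \<and> J \<inter> D = {0}" for D
  have "Q {0}" unfolding Q_def using lideal_zero[OF J(1)] lideal_zero[OF asoc_ideal]
    by (auto simp: lideal_def subspace_single_0)
  then obtain D where D: "Q D" "\<And>N'. Q N' \<Longrightarrow> D \<subseteq> N' \<Longrightarrow> N' = D"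
    by (rule maximal_subspace[where M = ?S]) (auto simp: Q_def lideal_def)
  have d: "lideal D" "D \<subseteq> ?S" "J \<inter> D = {0}" using D(1) by (auto simp: Q_def)
  have JD: "lideal (J \<boxplus> D)" by (rule lideal_ssum[OF J(1) d(1)])
  have "?S \<subseteq> J \<boxplus> D"
  proof (rule asoc_least[OF lidealD(1)[OF JD]])
    fix I assume I: "minimal_abelian_ideal sc br UNIV I"
    show "I \<subseteq> J \<boxplus> D"
    proof (rule ccontr)
      assume n: "\<not> I \<subseteq> J \<boxplus> D"
      have i: "lideal I" "\<And>K. lideal K \<Longrightarrow> K \<subseteq> I \<Longrightarrow> K \<noteq> {0} \<Longrightarrow> K = I"
        using I by (auto simp: minimal_abelian_ideal_iff)
      have z: "I \<inter> (J \<boxplus> D) = {0}" using i(2)[OF lideal_inter[OF i(1) JD]] n by blast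
      have "lideal (D \<boxplus> I)" by (rule lideal_ssum[OF d(1) i(1)])
      moreover have "D \<boxplus> I \<subseteq> ?S" by (rule ssum_least[OF lidealD(1)[OF asoc_ideal] d(2) asoc_upper[OF I]])
      moreover have "J \<inter> (D \<boxplus> I) = {0}"
      proof -
        have "u = 0" if u: "u \<in> J" "u \<in> D \<boxplus> I" for u
        proof -
          obtain v w where vw: "v \<in> D" "w \<in> I" "u = v + w" using u(2) by (rule ssumE)
          have "w = u + - v" using vw by simp
          then have "w \<in> J \<boxplus> D" using ssumI[OF u(1) subspace_neg[OF lidealD(1)[OF d(1)] vw(1)]] by simp
          then have "w = 0" using z vw(2) by blast
          then show ?thesis using vw u(1) d(3) by auto
        qed
        then show ?thesis using lideal_zero[OF J(1)] lideal_zero[OF \<open>lideal (D \<boxplus> I)\<close>] by blast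
      qed
      ultimately have "Q (D \<boxplus> I)" by (simp add: Q_def)
      then have "D \<boxplus> I = D" by (rule D(2)) (rule ssum_left[OF lidealD(1)[OF i(1)]])
      then have "I \<subseteq> D" using ssum_right[OF lidealD(1)[OF d(1)], of I] by simp
      then show False using n ssum_right[OF lidealD(1)[OF J(1)], of D] by blast
    qed
  qed
  moreover have "J \<boxplus> D \<subseteq> ?S" by (rule ssum_least[OF lidealD(1)[OF asoc_ideal] J(2) d(2)])
  ultimately show ?thesis using that d by blast
qed

text \<open>Otherwise a complement of the part of \<open>W\<close> in the socle is nonzero and
  contains a minimal ideal, which is abelian and so belongs to the socle.\<close>

lemma reducible_in_asoc:
  assumes W: "lideal W" "abelian br W"
    and red: "\<And>U. lideal U \<Longrightarrow> U \<subseteq> W \<Longrightarrow> \<exists>D. lideal D \<and> D \<subseteq> W \<and> U \<inter> D = {0} \<and> U \<boxplus> D = W"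
  shows "W \<subseteq> asoc sc br UNIV"
proof -
  let ?U = "W \<inter> asoc sc br UNIV"
  have "lideal ?U" by (rule lideal_inter[OF W(1) asoc_ideal])
  then obtain D where D: "lideal D" "D \<subseteq> W" "?U \<inter> D = {0}" "?U \<boxplus> D = W" using red by blast
  have "D = {0}"
  proof (rule ccontr)
    assume ne: "D \<noteq> {0}"
    define Q where "Q N \<longleftrightarrow> lideal N \<and> N \<subseteq> D \<and> N \<noteq> {0}" for N
    have "Q D" using D ne by (simp add: Q_def)
    then obtain I where I: "Q I" "\<And>N'. Q N' \<Longrightarrow> N' \<subseteq> I \<Longrightarrow> N' = I"
      by (rule minimal_subspace) (auto simp: Q_def lideal_def)
    have i: "lideal I" "I \<subseteq> D" "I \<noteq> {0}" using I(1) by (auto simp: Q_def)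
    have "minimal_abelian_ideal sc br UNIV I"
      unfolding minimal_abelian_ideal_iff
    proof (intro conjI allI impI)
      show "abelian br I" using W(2) i(2) D(2) by (auto simp: abelian_def)
      fix J assume J: "lideal J \<and> J \<subseteq> I \<and> J \<noteq> {0}"
      then have "Q J" using i(2) by (auto simp: Q_def)
      then show "J = I" using I(2) J by blast
    qed (use i in auto)
    then have "I \<subseteq> ?U \<inter> D" using asoc_upper i(2) D(2) by blast
    then show False using D(3) i(3) lideal_zero[OF i(1)] by blast
  qed
  then have "W = ?U" using D(4) by (auto simp: ssum_def)
  then show ?thesis by blast
qed

end


section \<open>The case of codimension one, and the converse implications\<close>

context lie_alg
begin

lemma derived_ideal: "lideal (derived sc br UNIV)"
  using span_brackets_ideal[OF lideal_UNIV] by (simp add: derived_def)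

lemma br_in_derived: "br u v \<in> derived sc br UNIV"
  unfolding derived_def by (rule span_base) auto

lemma codim_one_case:
  assumes proper: "\<And>C. lsub C \<Longrightarrow> C \<noteq> UNIV \<Longrightarrow> frattini sc br C = {0}"
    and nh: "\<And>x y. br x (br x y) = 0 \<Longrightarrow> br y (br x y) = 0 \<Longrightarrow> br x y = 0"
    and A: "lideal A" "A \<noteq> {0}" "\<And>J. lideal J \<Longrightarrow> J \<subseteq> A \<Longrightarrow> J \<noteq> {0} \<Longrightarrow> J = A"
    and nc: "\<And>S. lsub S \<Longrightarrow> A \<boxplus> S = UNIV \<Longrightarrow> A \<inter> S = {0} \<Longrightarrow> False"
    and B: "lideal B" "abelian br B" "A \<subseteq> B" "\<not> abelian br UNIV"
    and x: "B \<boxplus> span {x} = UNIV" "B \<noteq> UNIV"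
  shows "x \<notin> derived sc br UNIV" "\<forall>v. \<exists>w\<in>derived sc br UNIV. \<exists>c. v = w + sc c x"
    "abelian br (derived sc br UNIV)" "frattini sc br UNIV = asoc sc br UNIV" "asoc sc br UNIV \<noteq> {0}"
    "asoc sc br UNIV \<subseteq> derived sc br UNIV" "asoc sc br UNIV \<noteq> derived sc br UNIV"
    "\<forall>I. ideal_in sc br UNIV I \<and> I \<subset> derived sc br UNIV \<longrightarrow> I \<subseteq> asoc sc br UNIV"
proof -
  let ?S = "asoc sc br UNIV" and ?F = "frattini sc br UNIV"
  note a = lidealD[OF A(1)] and b = lidealD[OF B(1)]
  have ab: "br u v = 0" if "u \<in> B" "v \<in> B" for u v using B(2) that by (auto simp: abelian_def)
  have dec: "\<exists>w k. w \<in> B \<and> l = w + sc k x" for l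
  proof -
    have "l \<in> B \<boxplus> span {x}" using x(1) by simp
    then show ?thesis by (auto elim!: ssumE simp: span_singleton)
  qed
  have xB: "x \<notin> B"
  proof
    assume "x \<in> B"
    then have "span {x} \<subseteq> B" using b(1) by (intro span_minimal) auto
    then have "B \<boxplus> span {x} \<subseteq> B" by (intro ssum_least[OF b(1)]) auto
    then show False using x by auto
  qed
  have kx: "k = 0" if "sc k x \<in> B" for k
  proof (rule ccontr)
    assume "k \<noteq> 0"
    then have "x = sc (inverse k) (sc k x)" by simp
    then show False using subspace_scale[OF b(1) that, of "inverse k"] xB by simp
  qed
  have idealI: "lideal W" if "subspace W" "W \<subseteq> B" "\<And>w. w \<in> W \<Longrightarrow> br x w \<in> W" for W
    unfolding lideal_def
  proof (intro conjI allI ballI)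
    fix l w assume w: "w \<in> W"
    obtain u k where u: "u \<in> B" "l = u + sc k x" using dec by blast
    then have "br l w = sc k (br x w)" using ab[OF u(1)] w \<open>W \<subseteq> B\<close> by (auto simp: br_add_left br_scale_left)
    then show "br l w \<in> W" using subspace_scale[OF that(1) that(3)[OF w]] by simp
  qed (rule that(1))
  have lsx: "lsub (W \<boxplus> span {x})" if "lideal W" for W
    by (rule lsub_ssum[OF lsub_UNIV _ lsub_span_single]) (use that in \<open>auto simp: ideal_in_UNIV\<close>)
  have xin: "x \<in> W \<boxplus> span {x}" if "lideal W" for W
    using ssum_right[OF lidealD(1)[OF that], of "span {x}"] span_base[of x "{x}"] by blast
  \<comment> \<open>\<open>W + Fx\<close> is a proper subalgebra, so ideals inside its abelian ideal
    \<open>W\<close> have complements; as \<open>B\<close> is abelian, invariance under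
    \<open>x\<close> is invariance under \<open>L\<close>.\<close>
  have small: "W \<subseteq> ?S" if W: "lideal W" "W \<subseteq> B" "W \<noteq> B" for W
  proof (rule reducible_in_asoc[OF W(1)])
    show abW: "abelian br W" using B(2) W(2) by (auto simp: abelian_def)
    have ne: "W \<boxplus> span {x} \<noteq> UNIV"
    proof
      assume u: "W \<boxplus> span {x} = UNIV"
      have "v \<in> W" if v: "v \<in> B" for v
      proof -
        have "v \<in> W \<boxplus> span {x}" using u by simp
        then obtain w k where wk: "w \<in> W" "v = w + sc k x" by (auto elim!: ssumE simp: span_singleton)
        then have "sc k x = v - w" by simp
        then have "sc k x \<in> B" using subspace_diff[OF b(1) v] wk(1) W(2) by auto
        then have "k = 0" by (rule kx)
        then show ?thesis using wk by simp
      qed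
      then show False using W by blast
    qed
    fix U assume U: "lideal U" "U \<subseteq> W"
    have WC: "W \<subseteq> W \<boxplus> span {x}" by (rule ssum_left[OF subspace_span])
    obtain D where D: "ideal_in sc br (W \<boxplus> span {x}) D" "D \<subseteq> W" "U \<inter> D = {0}" "U \<boxplus> D = W"
      by (rule ideal_complement[OF lsx[OF W(1)] proper[OF lsx[OF W(1)] ne]
            lideal_ideal_in[OF U(1) subset_trans[OF U(2) WC]] lideal_ideal_in[OF W(1) WC] abW U(2)])
    have "lideal D"
      using ideal_inD(2,3)[OF D(1)] D(2) W(2) xin[OF W(1)] by (intro idealI) auto
    then show "\<exists>D. lideal D \<and> D \<subseteq> W \<and> U \<inter> D = {0} \<and> U \<boxplus> D = W" using D by blast
  qed
  have AS: "A \<subseteq> ?S"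
  proof (rule asoc_upper)
    have "abelian br A" using B(2,3) by (auto simp: abelian_def)
    then show "minimal_abelian_ideal sc br UNIV A" using A by (auto simp: minimal_abelian_ideal_iff)
  qed
  \<comment> \<open>Were \<open>B\<close> in the socle, an ideal inside \<open>B\<close> would
    complement \<open>A\<close> in \<open>B\<close>, and adding \<open>Fx\<close> to it would
    complement \<open>A\<close> in \<open>L\<close>.\<close>
  have BnS: "\<not> B \<subseteq> ?S"
  proof
    assume BS: "B \<subseteq> ?S"
    obtain D where D: "lideal D" "D \<subseteq> ?S" "A \<inter> D = {0}" "A \<boxplus> D = ?S"
      by (rule asoc_complement[OF A(1) AS])
    have BD: "A \<boxplus> (B \<inter> D) = B" using modular_law[OF b(1) B(3), of D] D(4) BS by blast
    have BDi: "lideal (B \<inter> D)" by (rule lideal_inter[OF B(1) D(1)])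
    show False
    proof (rule nc[OF lsx[OF BDi]])
      show "A \<boxplus> ((B \<inter> D) \<boxplus> span {x}) = UNIV" using BD x(1) by (simp flip: ssum_assoc)
      have "u = 0" if u: "u \<in> A" "u \<in> (B \<inter> D) \<boxplus> span {x}" for u
      proof -
        obtain w k where wk: "w \<in> B \<inter> D" "u = w + sc k x" using u(2) by (auto elim!: ssumE simp: span_singleton)
        then have "sc k x = u - w" by simp
        then have "sc k x \<in> B" using subspace_diff[OF b(1)] u(1) B(3) wk(1) by auto
        then have "k = 0" by (rule kx)
        then show ?thesis using wk u(1) D(3) by auto
      qed
      then show "A \<inter> ((B \<inter> D) \<boxplus> span {x}) = {0}"
        using lideal_zero[OF A(1)] subspace_0[OF lsubD(1)[OF lsx[OF BDi]]] by blast
    qed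
  qed
  have pow_add: "(br x ^^ k) (u + v) = (br x ^^ k) u + (br x ^^ k) v"
    and pow_sc: "(br x ^^ k) (sc c u) = sc c ((br x ^^ k) u)" for k u v c
    by (induction k) (auto simp: br_add_right br_scale_right)
  have pow0: "(br x ^^ k) 0 = 0" for k by (induction k) auto
  have powB: "v \<in> B \<Longrightarrow> (br x ^^ k) v \<in> B" for k v by (induction k) (auto simp: b)
  obtain N where N: "\<forall>v\<in>B. \<exists>w\<in>B. (br x ^^ Suc N) (v - (br x ^^ Suc N) w) = 0"
    using fitting[OF b(1) fdim_all, of "br x"] br_add_right br_scale_right b(2) by blast
  define B0 where "B0 = {v \<in> B. (br x ^^ Suc N) v = 0}"
  define B1 where "B1 = (br x ^^ Suc N) ` B"
  have B0: "lideal B0"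
  proof (rule idealI)
    show "subspace B0" unfolding B0_def using b(1) pow_add[of "Suc N"] pow_sc[of "Suc N"] pow0[of "Suc N"]
      by (intro subspaceI) (auto simp: subspace_0 subspace_add subspace_scale simp del: funpow.simps)
    have sw: "(br x ^^ Suc N) (br x w) = br x ((br x ^^ Suc N) w)" for w by (simp add: funpow_swap1)
    show "br x w \<in> B0" if "w \<in> B0" for w
      using that b(2) by (simp add: B0_def sw del: funpow.simps)
  qed (auto simp: B0_def)
  have B1: "lideal B1"
  proof (rule idealI)
    show "subspace B1"
    proof (rule subspaceI)
      show "0 \<in> B1" unfolding B1_def using lideal_zero[OF B(1)] pow0 by (metis imageI)
      show "u + v \<in> B1" if "u \<in> B1" "v \<in> B1" for u v
        using that subspace_add[OF b(1)] unfolding B1_def by (force simp flip: pow_add simp del: funpow.simps)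
      show "sc k u \<in> B1" if "u \<in> B1" for k u
        using that subspace_scale[OF b(1)] unfolding B1_def by (force simp flip: pow_sc simp del: funpow.simps)
    qed
    show "B1 \<subseteq> B" using powB by (auto simp: B1_def simp del: funpow.simps)
    show "br x w \<in> B1" if w: "w \<in> B1" for w
    proof -
      obtain v where v: "v \<in> B" "w = (br x ^^ Suc N) v" using w unfolding B1_def by blast
      then have "br x w = (br x ^^ Suc N) (br x v)" by (simp add: funpow_swap1)
      then show ?thesis using b(2)[OF v(1)] unfolding B1_def by blast
    qed
  qed
  have Bsum: "B \<subseteq> W" if W: "subspace W" "B0 \<subseteq> W" "B1 \<subseteq> W" for W
  proof
    fix v assume v: "v \<in> B"
    obtain w where w: "w \<in> B" "(br x ^^ Suc N) (v - (br x ^^ Suc N) w) = 0" using N v by blast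
    let ?w = "(br x ^^ Suc N) w"
    have "?w \<in> B1" unfolding B1_def using w(1) by blast
    moreover have "v - ?w \<in> B0" unfolding B0_def using w subspace_diff[OF b(1) v powB[OF w(1)]] by blast
    ultimately have "(v - ?w) + ?w \<in> W" using W subspace_add by blast
    then show "v \<in> W" by simp
  qed
  \<comment> \<open>If \<open>ad x\<close> were nilpotent on \<open>B\<close>, consider the last
    nonzero iterate at some \<open>y0\<close> with \<open>[x, y0]\<close> nonzero. It has the form
    \<open>[x, y]\<close> with \<open>y\<close> in \<open>B\<close>; it commutes with
    \<open>x\<close>, and with \<open>y\<close> because \<open>B\<close> is abelian, which is an
    excluded Heisenberg pair.\<close>
  have "B0 \<noteq> B"
  proof
    assume "B0 = B"
    then have nilB: "(br x ^^ Suc N) v = 0" if "v \<in> B" for v using that unfolding B0_def by blast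
    obtain y0 where y0: "y0 \<in> B" "br x y0 \<noteq> 0"
    proof -
      have "\<exists>y\<in>B. br x y \<noteq> 0"
      proof (rule ccontr)
        assume "\<not> (\<exists>y\<in>B. br x y \<noteq> 0)"
        then have z: "br x y = 0" "br y x = 0" if "y \<in> B" for y using that br_anti[of y x] by auto
        have "br u v = 0" for u v
        proof -
          obtain p k q l where "p \<in> B" "u = p + sc k x" "q \<in> B" "v = q + sc l x" using dec by metis
          then show ?thesis by (simp add: br_add_left br_add_right br_scale_left br_scale_right z ab)
        qed
        then show False using B(4) by (simp add: abelian_def)
      qed
      then show ?thesis using that by blast
    qed
    define k where "k = (LEAST k. (br x ^^ k) y0 = 0)"
    have k0: "(br x ^^ k) y0 = 0" unfolding k_def by (rule LeastI[of _ "Suc N"]) (rule nilB[OF y0(1)])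
    have "(br x ^^ 0) y0 \<noteq> 0" "(br x ^^ 1) y0 \<noteq> 0" using y0(2) by auto
    then have "k \<noteq> 0" "k \<noteq> 1" using k0 by metis+
    then obtain m where m: "k = Suc (Suc m)" by (metis One_nat_def not0_implies_Suc)
    define y where "y = (br x ^^ m) y0"
    have "br x y = (br x ^^ Suc m) y0" "br x (br x y) = (br x ^^ k) y0" by (simp_all add: y_def m)
    moreover have "(br x ^^ Suc m) y0 \<noteq> 0"
      using not_less_Least[of "Suc m" "\<lambda>k. (br x ^^ k) y0 = 0"] m k_def by (metis lessI)
    moreover have "y \<in> B" unfolding y_def by (rule powB[OF y0(1)])
    then have "br y (br x y) = 0" using ab b(2) by blast
    ultimately show False using nh[of x y] k0 by simp
  qed
  then have B0S: "B0 \<subseteq> ?S" by (intro small[OF B0]) (auto simp: B0_def)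
  have B1B: "B1 \<subseteq> B" using powB by (auto simp: B1_def simp del: funpow.simps)
  \<comment> \<open>Otherwise both Fitting components lie in the socle by \<open>small\<close>, and
    so does their sum \<open>B\<close>.\<close>
  have "B1 = B"
  proof (rule ccontr)
    assume "B1 \<noteq> B"
    then have "B1 \<subseteq> ?S" by (rule small[OF B1 B1B])
    then show False using Bsum[OF lidealD(1)[OF asoc_ideal] B0S] BnS by blast
  qed
  then have surj: "\<exists>w\<in>B. v = br x w" if "v \<in> B" for v
  proof -
    have "v \<in> B1" using that \<open>B1 = B\<close> by simp
    then obtain w where w: "w \<in> B" "v = (br x ^^ Suc N) w" unfolding B1_def by blast
    then have "v = br x ((br x ^^ N) w)" by simp
    then show ?thesis using powB[OF w(1)] by blast
  qed
  have der: "derived sc br UNIV = B"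
  proof
    have "br u v \<in> B" for u v
    proof -
      obtain p k q l where h: "p \<in> B" "u = p + sc k x" "q \<in> B" "v = q + sc l x" using dec by metis
      have "br u v = sc l (br p x) + sc k (br x q)"
        using ab[OF h(1,3)] by (simp add: h br_add_left br_add_right br_scale_left br_scale_right)
      then show ?thesis using h b subspace_add[OF b(1)] subspace_scale[OF b(1)] by simp
    qed
    then show "derived sc br UNIV \<subseteq> B" unfolding derived_def using b(1) by (intro span_minimal) auto
    show "B \<subseteq> derived sc br UNIV" using surj br_in_derived by blast
  qed
  \<comment> \<open>A minimal ideal \<open>I\<close> not inside \<open>B\<close> meets
    \<open>B\<close> in zero and so centralizes it. As \<open>I\<close> has an element with nonzero
    \<open>x\<close>-part, \<open>ad x\<close> would be zero on \<open>B\<close>, against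
    \<open>surj\<close>.\<close>
  have SB: "?S \<subseteq> B"
  proof (rule asoc_least[OF b(1)])
    fix I assume I: "minimal_abelian_ideal sc br UNIV I"
    have i: "lideal I" "\<And>K. lideal K \<Longrightarrow> K \<subseteq> I \<Longrightarrow> K \<noteq> {0} \<Longrightarrow> K = I"
      using I by (auto simp: minimal_abelian_ideal_iff)
    show "I \<subseteq> B"
    proof (rule ccontr)
      assume n: "\<not> I \<subseteq> B"
      have z: "I \<inter> B = {0}" using i(2)[OF lideal_inter[OF i(1) B(1)]] n by blast
      obtain u where u: "u \<in> I" "u \<notin> B" using n by blast
      obtain p k where p: "p \<in> B" "u = p + sc k x" using dec by blast
      then have k: "k \<noteq> 0" using u(2) by auto
      have "br x v = 0" if v: "v \<in> B" for v
      proof -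
        have "br u v \<in> I \<inter> B" using lidealD(3)[OF i(1) u(1)] b(2)[OF v] by blast
        then have "br u v = 0" using z by blast
        then have "sc k (br x v) = 0" using ab[OF p(1) v] by (simp add: p(2) br_add_left br_scale_left)
        then show ?thesis using k by simp
      qed
      then have "v = 0" if "v \<in> B" for v using surj[OF that] by auto
      then show False using A(2) B(3) lideal_zero[OF A(1)] by blast
    qed
  qed
  have FB: "?F \<subseteq> B"
  proof (rule frattini_ideal(2)[OF lsub_UNIV])
    show "maximal_subalg sc br UNIV B"
      unfolding maximal_subalg_def subalg_iff
    proof (intro conjI allI impI)
      show "lsub B" by (rule lideal_lsub[OF B(1)])
      show "B \<noteq> UNIV" by (rule x(2))
      fix W assume W: "(W \<subseteq> UNIV \<and> lsub W) \<and> B \<subseteq> W"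
      show "W = B \<or> W = UNIV"
      proof (cases "W = B")
        case False
        then obtain u where u: "u \<in> W" "u \<notin> B" using W by blast
        obtain p k where p: "p \<in> B" "u = p + sc k x" using dec by blast
        then have k: "k \<noteq> 0" using u(2) by auto
        have sW: "subspace W" using W lsubD(1) by blast
        have "sc k x = u - p" using p by simp
        then have "sc k x \<in> W" using subspace_diff[OF sW u(1)] p(1) W by auto
        from subspace_scale[OF sW this, of "inverse k"] have "x \<in> W" using k by simp
        then have "span {x} \<subseteq> W" using sW by (intro span_minimal) auto
        then have "B \<boxplus> span {x} \<subseteq> W" using W sW by (intro ssum_least) auto
        then show ?thesis using x(1) by blast
      qed simp
    qed simp
  qed
  have F: "lideal ?F" using frattini_ideal(1)[OF lsub_UNIV] by (simp add: ideal_in_UNIV)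
  \<comment> \<open>Otherwise \<open>Fx\<close> supplements the Frattini ideal, so it is all of
    \<open>L\<close> and \<open>B\<close> is zero.\<close>
  have "?F \<noteq> B"
  proof
    assume e: "?F = B"
    have "span {x} = UNIV"
      by (rule frattini_supplement[OF lsub_UNIV order_refl lsub_span_single subset_UNIV]) (simp add: e x(1))
    then have "v = 0" if v: "v \<in> B" for v
    proof -
      have "v \<in> span {x}" using \<open>span {x} = UNIV\<close> by simp
      then obtain k where "v = sc k x" by (auto simp: span_singleton)
      then show ?thesis using kx v by auto
    qed
    then show False using A(2) B(3) lideal_zero[OF A(1)] by blast
  qed
  then have FS: "?F \<subseteq> ?S" by (rule small[OF F FB])
  \<comment> \<open>If a maximal \<open>M\<close> does not contain the socle, the two together give
    \<open>L\<close>, and some \<open>t\<close> in \<open>M\<close> acts on \<open>B\<close> like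
    \<open>x\<close>. So \<open>B \<inter> M\<close> is an ideal, it lies in the socle by
    \<open>small\<close>, and the modular law puts \<open>B\<close> there too.\<close>
  have SF: "?S \<subseteq> ?F"
  proof (rule frattini_greatest)
    show "ideal_in sc br UNIV ?S" using asoc_ideal by (simp add: ideal_in_UNIV)
    fix M assume M: "maximal_subalg sc br UNIV M"
    have m: "lsub M" and max: "\<And>W. lsub W \<Longrightarrow> M \<subseteq> W \<Longrightarrow> W = M \<or> W = UNIV"
      using M unfolding maximal_subalg_def subalg_iff by auto
    show "?S \<subseteq> M"
    proof (rule ccontr)
      assume n: "\<not> ?S \<subseteq> M"
      have "lsub (?S \<boxplus> M)"
        by (rule lsub_ssum[OF lsub_UNIV _ m]) (use asoc_ideal in \<open>auto simp: ideal_in_UNIV\<close>)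
      moreover have "M \<subseteq> ?S \<boxplus> M" by (rule ssum_right[OF lidealD(1)[OF asoc_ideal]])
      moreover have "?S \<subseteq> ?S \<boxplus> M" by (rule ssum_left[OF lsubD(1)[OF m]])
      ultimately have SM: "?S \<boxplus> M = UNIV" using max n by metis
      have "x \<in> ?S \<boxplus> M" using SM by simp
      then obtain s t where st: "s \<in> ?S" "t \<in> M" "x = s + t" by (rule ssumE)
      have "lideal (B \<inter> M)"
      proof (rule idealI)
        show "subspace (B \<inter> M)" by (rule subspace_inter[OF b(1) lsubD(1)[OF m]])
        show "br x w \<in> B \<inter> M" if w: "w \<in> B \<inter> M" for w
        proof -
          have "br x w = br t w" using ab[of s w] st SB w by (auto simp: br_add_left)
          then show ?thesis using b(2)[of w x] w lsubD(2)[OF m st(2), of w] by simp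
        qed
      qed simp
      moreover have "B \<inter> M \<noteq> B" using n SB by blast
      ultimately have "B \<inter> M \<subseteq> ?S" by (intro small) auto
      then have "?S \<boxplus> (B \<inter> M) \<subseteq> ?S" by (intro ssum_least[OF lidealD(1)[OF asoc_ideal]]) auto
      then show False using modular_law[OF b(1) SB, of M] SM BnS by auto
    qed
  qed
  show "x \<notin> derived sc br UNIV" using der xB by simp
  show "\<forall>v. \<exists>w\<in>derived sc br UNIV. \<exists>c. v = w + sc c x" using der dec by blast
  show "abelian br (derived sc br UNIV)" using der B(2) by simp
  show "?F = ?S" using FS SF by blast
  show "?S \<noteq> {0}" using AS A(2) lideal_zero[OF A(1)] by blast
  show "?S \<subseteq> derived sc br UNIV" using der SB by simp
  show "?S \<noteq> derived sc br UNIV" using der BnS by auto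
  show "\<forall>I. ideal_in sc br UNIV I \<and> I \<subset> derived sc br UNIV \<longrightarrow> I \<subseteq> ?S"
    using der small by (auto simp: ideal_in_UNIV)
qed

text \<open>A proper subalgebra \<open>C\<close> not inside \<open>L^2\<close> is
  \<open>U + Fy\<close> with \<open>U\<close> its part in \<open>L^2\<close>. As \<open>L^2\<close>
  is abelian, \<open>U\<close> and the Frattini ideal of \<open>C\<close> are ideals of
  \<open>L\<close>, and \<open>U\<close> is proper in \<open>L^2\<close>, hence inside the socle.
  There the Frattini ideal of \<open>C\<close> has a complement; its part in \<open>U\<close>,
  together with \<open>Fy\<close>, is a subalgebra complementing that Frattini ideal in
  \<open>C\<close>.\<close>

lemma minimal_non_elementary_if_cyclic:
  assumes x: "\<forall>v. \<exists>w\<in>derived sc br UNIV. \<exists>c. v = w + sc c x"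
    and V: "abelian br (derived sc br UNIV)"
    and F: "frattini sc br UNIV = asoc sc br UNIV" "asoc sc br UNIV \<noteq> {0}"
    and max: "\<And>I. ideal_in sc br UNIV I \<Longrightarrow> I \<subset> derived sc br UNIV \<Longrightarrow> I \<subseteq> asoc sc br UNIV"
  shows "minimal_non_elementary sc br"
  unfolding minimal_non_elementary_iff
proof (intro conjI allI impI)
  let ?V = "derived sc br UNIV" and ?S = "asoc sc br UNIV"
  note v = lidealD[OF derived_ideal]
  have ab: "br u w = 0" if "u \<in> ?V" "w \<in> ?V" for u w using V that by (auto simp: abelian_def)
  show "frattini sc br UNIV \<noteq> {0}" using F by simp
  fix C assume "lsub C \<and> C \<noteq> UNIV"
  then have C: "lsub C" "C \<noteq> UNIV" by auto
  note sC = lsubD(1)[OF C(1)]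
  show "frattini sc br C = {0}"
  proof (cases "C \<subseteq> ?V")
    case True
    then have "abelian br C" using V by (auto simp: abelian_def)
    then show ?thesis by (rule frattini_abelian[OF C(1)])
  next
    case False
    then obtain y where y: "y \<in> C" "y \<notin> ?V" by blast
    obtain p k where p: "p \<in> ?V" "y = p + sc k x" using x by blast
    then have k: "k \<noteq> 0" using y(2) by auto
    have dec: "\<exists>w c. w \<in> ?V \<and> l = w + sc c y" for l
    proof -
      obtain q c where q: "q \<in> ?V" "l = q + sc c x" using x by blast
      have "q - sc (c / k) p \<in> ?V" using subspace_diff[OF v(1) q(1) subspace_scale[OF v(1) p(1)]] .
      moreover have "l = (q - sc (c / k) p) + sc (c / k) y" using k by (simp add: q(2) p(2) scale_right_distrib)
      ultimately show ?thesis by blast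
    qed
    have ky: "c = 0" if "sc c y \<in> ?V" for c
    proof (rule ccontr)
      assume "c \<noteq> 0"
      then have "y = sc (inverse c) (sc c y)" by simp
      then show False using subspace_scale[OF v(1) that, of "inverse c"] y(2) by simp
    qed
    have idealI: "lideal W" if W: "subspace W" "W \<subseteq> ?V" "\<And>w. w \<in> W \<Longrightarrow> br y w \<in> W" for W
      unfolding lideal_def
    proof (intro conjI allI ballI)
      fix l w assume w: "w \<in> W"
      obtain u c where u: "u \<in> ?V" "l = u + sc c y" using dec by blast
      then have "br l w = sc c (br y w)" using ab[OF u(1)] w W(2) by (auto simp: br_add_left br_scale_left)
      then show "br l w \<in> W" using subspace_scale[OF W(1) W(3)[OF w]] by simp
    qed (rule W(1))
    define U where "U = C \<inter> ?V"
    have sU: "subspace U" unfolding U_def by (rule subspace_inter[OF sC v(1)])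
    have U: "lideal U"
      by (rule idealI[OF sU]) (use lsubD(2)[OF C(1) y(1)] v(2) in \<open>auto simp: U_def\<close>)
    have Cdec: "\<exists>w c. w \<in> U \<and> l = w + sc c y" if l: "l \<in> C" for l
    proof -
      obtain w c where w: "w \<in> ?V" "l = w + sc c y" using dec by blast
      then have "w = l - sc c y" by simp
      then have "w \<in> C" using subspace_diff[OF sC l subspace_scale[OF sC y(1)]] by simp
      then show ?thesis using w by (auto simp: U_def)
    qed
    have "U \<noteq> ?V"
    proof
      assume "U = ?V"
      then have "l \<in> C" for l
      proof -
        obtain w c where w: "w \<in> ?V" "l = w + sc c y" using dec by blast
        then have "w \<in> C" using \<open>U = ?V\<close> by (auto simp: U_def)
        then show ?thesis unfolding w(2) using subspace_add[OF sC _ subspace_scale[OF sC y(1)]] by blast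
      qed
      then show False using C(2) by blast
    qed
    then have US: "U \<subseteq> ?S" by (intro max) (use U in \<open>auto simp: ideal_in_UNIV U_def\<close>)
    let ?J = "frattini sc br C"
    note j = ideal_inD[OF frattini_ideal(1)[OF C(1)]]
    have "maximal_subalg sc br C U"
      unfolding maximal_subalg_def subalg_iff
    proof (intro conjI allI impI)
      show "U \<subseteq> C" by (simp add: U_def)
      show "lsub U" by (rule lideal_lsub[OF U])
      show "U \<noteq> C" using y by (auto simp: U_def)
      fix W assume W: "(W \<subseteq> C \<and> lsub W) \<and> U \<subseteq> W"
      show "W = U \<or> W = C"
      proof (cases "W = U")
        case False
        then obtain u where u: "u \<in> W" "u \<notin> U" using W by blast
        have sW: "subspace W" using W lsubD(1) by blast
        obtain w c where w: "w \<in> U" "u = w + sc c y" using Cdec u(1) W by blast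
        then have c: "c \<noteq> 0" using u(2) by auto
        have "sc c y = u - w" using w by simp
        then have "sc c y \<in> W" using subspace_diff[OF sW u(1)] w(1) W by auto
        from subspace_scale[OF sW this, of "inverse c"] have yW: "y \<in> W" using c by simp
        have "C \<subseteq> W"
        proof
          fix l assume "l \<in> C"
          then obtain w c where "w \<in> U" "l = w + sc c y" using Cdec by blast
          then show "l \<in> W" using W subspace_add[OF sW _ subspace_scale[OF sW yW]] by blast
        qed
        then show ?thesis using W by blast
      qed simp
    qed
    then have JU: "?J \<subseteq> U" by (rule frattini_ideal(2)[OF C(1)])
    have J: "lideal ?J" by (rule idealI[OF j(2)]) (use JU j(3)[OF y(1)] in \<open>auto simp: U_def\<close>)
    obtain D where D: "lideal D" "D \<subseteq> ?S" "?J \<inter> D = {0}" "?J \<boxplus> D = ?S"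
      by (rule asoc_complement[OF J subset_trans[OF JU US]])
    have UD: "?J \<boxplus> (U \<inter> D) = U" using modular_law[OF sU JU, of D] D(4) US by blast
    have UDi: "lideal (U \<inter> D)" by (rule lideal_inter[OF U D(1)])
    let ?T = "(U \<inter> D) \<boxplus> span {y}"
    have T: "lsub ?T"
      by (rule lsub_ssum[OF lsub_UNIV _ lsub_span_single]) (use UDi in \<open>auto simp: ideal_in_UNIV\<close>)
    have yC: "span {y} \<subseteq> C" using sC y(1) by (intro span_minimal) auto
    have TC: "?T \<subseteq> C" by (rule ssum_least[OF sC _ yC]) (auto simp: U_def)
    show ?thesis
    proof (rule frattini_complement_zero[OF C(1) order_refl j(2) T TC])
      have "?J \<boxplus> ?T = U \<boxplus> span {y}" using UD by (simp flip: ssum_assoc)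
      also have "\<dots> = C"
      proof
        show "U \<boxplus> span {y} \<subseteq> C" by (rule ssum_least[OF sC _ yC]) (auto simp: U_def)
        show "C \<subseteq> U \<boxplus> span {y}"
        proof
          fix l assume "l \<in> C"
          then obtain w c where w: "w \<in> U" "l = w + sc c y" using Cdec by blast
          have "sc c y \<in> span {y}" by (intro span_scale span_base) simp
          then show "l \<in> U \<boxplus> span {y}" unfolding w(2) using w(1) by (intro ssumI)
        qed
      qed
      finally show "?J \<boxplus> ?T = C" .
      have "u = 0" if u: "u \<in> ?J" "u \<in> ?T" for u
      proof -
        obtain w c where w: "w \<in> U \<inter> D" "u = w + sc c y" using u(2) by (auto elim!: ssumE simp: span_singleton)
        then have "sc c y = u - w" by simp
        moreover have "u \<in> ?V" "w \<in> ?V" using u(1) JU w(1) by (auto simp: U_def)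
        ultimately have "sc c y \<in> ?V" using subspace_diff[OF v(1)] by simp
        then have "c = 0" by (rule ky)
        then have "u \<in> D" using w by simp
        then show ?thesis using u(1) D(3) by blast
      qed
      then show "?J \<inter> ?T = {0}" using subspace_0[OF j(2)] subspace_0[OF lsubD(1)[OF T]] by blast
    qed
  qed
qed

text \<open>Every proper subalgebra is abelian: for two noncommuting elements the determinant
  \<open>d\<close> of their coefficients at \<open>x\<close> and \<open>y\<close> is nonzero, so
  they generate \<open>z\<close> and then \<open>x\<close> and \<open>y\<close>.\<close>

lemma minimal_non_elementary_if_heisenberg:
  assumes ind: "\<not> dependent {x, y, z}" and sp: "span {x, y, z} = UNIV"
    and h: "br x y = z" "br x z = 0" "br y z = 0"
  shows "minimal_non_elementary sc br"
  unfolding minimal_non_elementary_iff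
proof (intro conjI allI impI)
  have h': "br z x = 0" "br z y = 0" "br y x = - z"
    using h br_anti[of z x] br_anti[of z y] br_anti[of y x] by simp_all
  have z: "z \<noteq> 0" using ind dependent_zero[of "{x, y, z}"] by auto
  have "z \<in> frattini sc br UNIV" using heisenberg_frattini(2)[OF h] sp by simp
  then show "frattini sc br UNIV \<noteq> {0}" using z by auto
  fix C assume "lsub C \<and> C \<noteq> UNIV"
  then have C: "lsub C" "C \<noteq> UNIV" by auto
  note sC = lsubD(1)[OF C(1)]
  have "br u v = 0" if uv: "u \<in> C" "v \<in> C" for u v
  proof (rule ccontr)
    assume ne: "br u v \<noteq> 0"
    obtain a b c where u: "u = sc a x + (sc b y + sc c z)" using sp span_triple[of u x y z] by auto
    obtain a' b' c' where v: "v = sc a' x + (sc b' y + sc c' z)" using sp span_triple[of v x y z] by auto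
    define d where "d = a * b' - b * a'"
    have e: "br u v = sc d z"
      unfolding u v d_def by (simp add: br_add_left br_add_right br_scale_left br_scale_right h h' algebra_simps)
    then have d: "d \<noteq> 0" using ne by auto
    have "sc d z \<in> C" using lsubD(2)[OF C(1) uv] e by simp
    from subspace_scale[OF sC this, of "inverse d"] have zC: "z \<in> C" using d by simp
    have uC: "sc a x + sc b y \<in> C"
      using subspace_diff[OF sC uv(1) subspace_scale[OF sC zC, of c]] by (simp add: u)
    have vC: "sc a' x + sc b' y \<in> C"
      using subspace_diff[OF sC uv(2) subspace_scale[OF sC zC, of c']] by (simp add: v)
    have "sc b' (sc a x + sc b y) - sc b (sc a' x + sc b' y) = sc d x"
      by (simp add: d_def algebra_simps)
    then have "sc d x \<in> C"
      using subspace_diff[OF sC subspace_scale[OF sC uC, of b'] subspace_scale[OF sC vC, of b]] by simp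
    from subspace_scale[OF sC this, of "inverse d"] have xC: "x \<in> C" using d by simp
    have "sc a (sc a' x + sc b' y) - sc a' (sc a x + sc b y) = sc d y"
      by (simp add: d_def algebra_simps)
    then have "sc d y \<in> C"
      using subspace_diff[OF sC subspace_scale[OF sC vC, of a] subspace_scale[OF sC uC, of a']] by simp
    from subspace_scale[OF sC this, of "inverse d"] have yC: "y \<in> C" using d by simp
    have "span {x, y, z} \<subseteq> C" using xC yC zC sC by (intro span_minimal) auto
    then show False using sp C(2) by auto
  qed
  then show "frattini sc br C = {0}" by (intro frattini_abelian[OF C(1)]) (auto simp: abelian_def)
qed

lemma minimal_non_elementary_cases:
  assumes mne: "minimal_non_elementary sc br"
    and nh: "\<And>x y. br x (br x y) = 0 \<Longrightarrow> br y (br x y) = 0 \<Longrightarrow> br x y = 0"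
  shows "(\<exists>x. x \<notin> derived sc br UNIV \<and> (\<forall>v. \<exists>w\<in>derived sc br UNIV. \<exists>c. v = w + sc c x))
      \<and> abelian br (derived sc br UNIV)
      \<and> frattini sc br UNIV = asoc sc br UNIV
      \<and> asoc sc br UNIV \<noteq> {0}
      \<and> asoc sc br UNIV \<subseteq> derived sc br UNIV
      \<and> asoc sc br UNIV \<noteq> derived sc br UNIV
      \<and> (\<forall>I. ideal_in sc br UNIV I \<and> I \<subset> derived sc br UNIV \<longrightarrow> I \<subseteq> asoc sc br UNIV)"
proof -
  let ?F = "frattini sc br UNIV"
  have F0: "?F \<noteq> {0}" and proper: "\<And>C. lsub C \<Longrightarrow> C \<noteq> UNIV \<Longrightarrow> frattini sc br C = {0}"
    using mne unfolding minimal_non_elementary_iff by blast+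
  have F: "lideal ?F" using frattini_ideal(1)[OF lsub_UNIV] by (simp add: ideal_in_UNIV)
  define Q where "Q N \<longleftrightarrow> lideal N \<and> N \<subseteq> ?F \<and> N \<noteq> {0}" for N
  have "Q ?F" using F F0 by (simp add: Q_def)
  then obtain A where QA: "Q A" "\<And>N'. Q N' \<Longrightarrow> N' \<subseteq> A \<Longrightarrow> N' = A"
    by (rule minimal_subspace) (auto simp: Q_def lideal_def)
  have A: "lideal A" "A \<noteq> {0}" and AF: "A \<subseteq> ?F" using QA(1) by (auto simp: Q_def)
  have Amin: "J = A" if "lideal J" "J \<subseteq> A" "J \<noteq> {0}" for J
    using QA(2)[of J] that AF by (auto simp: Q_def)
  \<comment> \<open>\<open>A\<close> is an irreducible module for \<open>L\<close> and, lying in the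
    Frattini ideal, acts on itself by nilpotent maps; so it acts on itself as zero.\<close>
  have abA: "abelian br A"
  proof -
    have z: "lideal {0}" by (auto simp: lideal_def subspace_single_0)
    interpret N: lie_mod sc br sc br A "{0}"
      using A(1) z lideal_zero[OF A(1)] by (intro adjoint_module) auto
    have irr: "N.irreducible"
      unfolding N.irreducible_def
    proof (intro conjI allI impI)
      show "{0} \<noteq> A" using A(2) by blast
      fix W assume "subspace W \<and> {0} \<subseteq> W \<and> W \<subseteq> A \<and> (\<forall>x. \<forall>m\<in>W. br x m \<in> W)"
      then show "W = {0} \<or> W = A" using Amin[of W] by (auto simp: lideal_def)
    qed
    have "br u v \<in> {0}" if uv: "u \<in> A" "v \<in> A" for u v
    proof (rule N.nilpotent_ideal_trivial[OF irr A(1) _ uv])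
      show "\<exists>k. \<forall>m\<in>A. (br u ^^ k) m \<in> {0}" if u: "u \<in> A" for u
      proof -
        obtain k where "\<forall>v. (br u ^^ k) v = 0" using frattini_ad_nilpotent[of u] u AF by blast
        then show ?thesis by auto
      qed
    qed
    then show ?thesis by (auto simp: abelian_def)
  qed
  have nc: False if "lsub S" "A \<boxplus> S = UNIV" "A \<inter> S = {0}" for S
    using frattini_complement_zero[OF lsub_UNIV AF lidealD(1)[OF A(1)] that(1) subset_UNIV that(2,3)] A(2) by blast
  define R where "R N \<longleftrightarrow> lideal N \<and> abelian br N \<and> A \<subseteq> N" for N
  have "R A" using A abA by (simp add: R_def)
  then obtain B where RB: "R B" "\<And>N'. R N' \<Longrightarrow> B \<subseteq> N' \<Longrightarrow> N' = B"
    by (rule maximal_subspace[where M = UNIV]) (auto simp: R_def lideal_def)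
  have B: "lideal B" "abelian br B" "A \<subseteq> B" using RB(1) by (auto simp: R_def)
  have Bmax: "J = B" if "lideal J" "abelian br J" "B \<subseteq> J" for J
    using RB(2)[of J] that B(3) by (auto simp: R_def)
  have nab: "\<not> abelian br UNIV"
  proof
    assume "abelian br UNIV"
    then have "?F = {0}" by (rule frattini_abelian[OF lsub_UNIV])
    then show False using F0 by simp
  qed
  then have BU: "B \<noteq> UNIV" using B(2) by auto
  show ?thesis
  proof (cases "\<exists>x. B \<boxplus> span {x} = UNIV")
    case True
    then obtain x where x: "B \<boxplus> span {x} = UNIV" by blast
    note case_facts = proper nh A Amin nc B nab x BU
    show ?thesis
    proof (intro conjI exI[of _ x])
      show "x \<notin> derived sc br UNIV"
        by (rule codim_one_case(1)[where A = A and B = B and x = x]) (fact case_facts)+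
      show "\<forall>v. \<exists>w\<in>derived sc br UNIV. \<exists>c. v = w + sc c x"
        by (rule codim_one_case(2)[where A = A and B = B and x = x]) (fact case_facts)+
      show "abelian br (derived sc br UNIV)"
        by (rule codim_one_case(3)[where A = A and B = B and x = x]) (fact case_facts)+
      show "frattini sc br UNIV = asoc sc br UNIV"
        by (rule codim_one_case(4)[where A = A and B = B and x = x]) (fact case_facts)+
      show "asoc sc br UNIV \<noteq> {0}"
        by (rule codim_one_case(5)[where A = A and B = B and x = x]) (fact case_facts)+
      show "asoc sc br UNIV \<subseteq> derived sc br UNIV"
        by (rule codim_one_case(6)[where A = A and B = B and x = x]) (fact case_facts)+
      show "asoc sc br UNIV \<noteq> derived sc br UNIV"
        by (rule codim_one_case(7)[where A = A and B = B and x = x]) (fact case_facts)+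
      show "\<forall>I. ideal_in sc br UNIV I \<and> I \<subset> derived sc br UNIV \<longrightarrow> I \<subseteq> asoc sc br UNIV"
        by (rule codim_one_case(8)[where A = A and B = B and x = x]) (fact case_facts)+
    qed
  next
    case False
    then have big: "B \<boxplus> span {x} \<noteq> UNIV" for x by blast
    have False
    proof (cases "semisimple_mod B")
      case True
      show False
        by (rule semisimple_complement[where A = A and B = B]) (fact A Amin B True nc)+
    next
      case False
      then obtain I where I: "lideal I" "B \<subseteq> I" "\<forall>x\<in>I. \<forall>y\<in>I. br x y \<in> B" "I \<noteq> B"
        unfolding semisimple_mod_def by blast
      have BI: "B \<subset> I" using I(2,4) by blast
      have II: "br x y \<in> B" if "x \<in> I" "y \<in> I" for x y using I(3) that by blast
      show False
        by (rule abelian_quotient_complement[where A = A and B = B and I = I])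
          (fact proper nh A Amin B Bmax big I(1) BI II nc)+
    qed
    then show ?thesis ..
  qed
qed

end

theorem theorem4p5:
  fixes sc :: "'f::field_char_0 \<Rightarrow> 'v::ab_group_add \<Rightarrow> 'v"
    and br :: "'v \<Rightarrow> 'v \<Rightarrow> 'v"
  assumes "lie_algebra sc br"
    and "fin_dim sc"
  shows "minimal_non_elementary sc br \<longleftrightarrow>
    ((\<exists>x. x \<notin> derived sc br UNIV
          \<and> (\<forall>v. \<exists>w\<in>derived sc br UNIV. \<exists>c. v = w + sc c x))
      \<and> abelian br (derived sc br UNIV)
      \<and> frattini sc br UNIV = asoc sc br UNIV
      \<and> asoc sc br UNIV \<noteq> {0}
      \<and> asoc sc br UNIV \<subseteq> derived sc br UNIV
      \<and> asoc sc br UNIV \<noteq> derived sc br UNIV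
      \<and> (\<forall>I. ideal_in sc br UNIV I \<and> I \<subset> derived sc br UNIV \<longrightarrow> I \<subseteq> asoc sc br UNIV))
    \<or> (\<exists>x y z. \<not> module.dependent sc {x, y, z} \<and> card {x, y, z} = 3
          \<and> module.span sc {x, y, z} = UNIV
          \<and> br x y = z \<and> br x z = 0 \<and> br y z = 0)"
    (is "_ \<longleftrightarrow> ?cyclic \<or> ?heisenberg")
proof -
  interpret lie_alg sc br using assms by unfold_locales
  show ?thesis
  proof (intro iffI)
    assume mne: "minimal_non_elementary sc br"
    show "?cyclic \<or> ?heisenberg"
    proof (cases "\<exists>x y. br x (br x y) = 0 \<and> br y (br x y) = 0 \<and> br x y \<noteq> 0")
      case True
      then obtain x y where xy: "br x (br x y) = 0" "br y (br x y) = 0" "br x y \<noteq> 0" by blast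
      have proper: "\<And>C. lsub C \<Longrightarrow> C \<noteq> UNIV \<Longrightarrow> frattini sc br C = {0}"
        using mne unfolding minimal_non_elementary_iff by blast
      have ?heisenberg
      proof (intro exI conjI)
        show "\<not> dependent {x, y, br x y}" "card {x, y, br x y} = 3" "span {x, y, br x y} = UNIV"
          by (rule heisenberg_if_triple[where x = x and y = y and z = "br x y"]; fact proper refl xy)+
      qed (fact refl xy)+
      then show ?thesis ..
    next
      case False
      then have nh: "br x y = 0" if "br x (br x y) = 0" "br y (br x y) = 0" for x y using that by blast
      have ?cyclic by (rule minimal_non_elementary_cases[OF mne]) (fact nh)
      then show ?thesis ..
    qed
  next
    assume "?cyclic \<or> ?heisenberg"
    then show "minimal_non_elementary sc br"
    proof
      assume c: ?cyclic
      obtain x where x: "\<forall>v. \<exists>w\<in>derived sc br UNIV. \<exists>c. v = w + sc c x"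
        using conjunct1[OF c] by (elim exE conjE)
      from c have c': "abelian br (derived sc br UNIV)" "frattini sc br UNIV = asoc sc br UNIV"
          "asoc sc br UNIV \<noteq> {0}"
          "\<forall>I. ideal_in sc br UNIV I \<and> I \<subset> derived sc br UNIV \<longrightarrow> I \<subseteq> asoc sc br UNIV"
        by - (elim conjE, assumption)+
      show ?thesis
        by (rule minimal_non_elementary_if_cyclic[OF x c'(1-3)]) (rule c'(4)[rule_format], rule conjI)
    next
      assume "?heisenberg"
      then obtain x y z where "\<not> dependent {x, y, z}" "span {x, y, z} = UNIV"
          "br x y = z" "br x z = 0" "br y z = 0" by blast
      then show ?thesis by (rule minimal_non_elementary_if_heisenberg)
    qed
  qed
qed

end
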